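(* Let $N$ be a positive integer, $w=\mathrm{polylog}(N)$, and let $f\colon[N]\to[2^{w}]$ be a function computable in $\tilde{O}(1)$ time. For any choice of a constant $0<\alpha<1$, one can construct in $\tilde{O}(N)$ time with high probability a data structure using $\tilde{O}(N^{1-\alpha/4})$ words of space which supports the following queries in $\tilde{O}(N^{\alpha})$ time: (Preimage ranking) given two integers $y,z\in[2^{w}]$, return $|\{x\in[N] : f(x)=y,\ x<z\}|$; (Preimage selection) given an integer $k\in[N]$ and an integer $y\in[2^{w}]$, report the $k$th largest value $x\in[N]$ such that $f(x)=y$, if it exists; (Preimage median) given an integer $y\in[2^{w}]$, return the median of the values $x\in[N]$ such that $f(x)=y$, if such a value exists.
   Context: $[M]$ denotes $\{0,1,\dots,M-1\}$. The notation $\tilde{O}(\cdot)$ omits factors polylogarithmic in $N$. Space is measured in machine words (word RAM model). *)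

theory Defs
  imports "HOL-Probability.Probability_Mass_Function" "HOL-Library.Landau_Symbols"
begin

unbundle bit_operations_syntax

section \<open>Asymptotics up to polylogarithmic factors\<close>

definition soft_O :: "(nat \<Rightarrow> real) \<Rightarrow> (nat \<Rightarrow> real) set" where
  "soft_O g = {h. \<exists>c::nat. h \<in> O(\<lambda>N. g N * ln (real N) ^ c)}"

definition polylog :: "(nat \<Rightarrow> nat) \<Rightarrow> bool" where
  "polylog h \<longleftrightarrow> (\<lambda>N. real (h N)) \<in> soft_O (\<lambda>_. 1)"


section \<open>The word RAM\<close>

text \<open>
  Words of length \<open>W\<close> bits are the naturals below \<open>2 ^ W\<close>; the word length is a parameter of the
  semantics because it grows with the input size. A program is a list of instructions, control
  starts at position \<open>0\<close>, and the machine has halted once control has left the list. A program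
  mentions only finitely many registers; everything else lives in memory.
\<close>

datatype binop = Add | Sub | Mul | Div | Mod | And | Or | Xor | Shl | Shr

fun eval_binop :: "nat \<Rightarrow> binop \<Rightarrow> nat \<Rightarrow> nat \<Rightarrow> nat" where
  "eval_binop W Add x y = (x + y) mod 2 ^ W"
| "eval_binop W Sub x y = (x + 2 ^ W - y) mod 2 ^ W"
| "eval_binop W Mul x y = (x * y) mod 2 ^ W"
| "eval_binop W Div x y = x div y"
| "eval_binop W Mod x y = x mod y"
| "eval_binop W And x y = x AND y"
| "eval_binop W Or x y = x OR y"
| "eval_binop W Xor x y = x XOR y"
| "eval_binop W Shl x y = push_bit y x mod 2 ^ W"
| "eval_binop W Shr x y = drop_bit y x"

datatype basic_instr =
    Const nat nat             \<comment> \<open>\<open>Const r n\<close>: \<open>r := n\<close>\<close>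
  | Arith binop nat nat nat   \<comment> \<open>\<open>Arith b r p q\<close>: \<open>r := p b q\<close>\<close>
  | Load nat nat              \<comment> \<open>\<open>Load r p\<close>: \<open>r := mem[p]\<close>\<close>
  | Store nat nat             \<comment> \<open>\<open>Store p q\<close>: \<open>mem[p] := q\<close>\<close>
  | JumpLess nat nat nat      \<comment> \<open>\<open>JumpLess p q l\<close>: if \<open>p < q\<close> goto \<open>l\<close>\<close>
  | JumpEq nat nat nat        \<comment> \<open>\<open>JumpEq p q l\<close>: if \<open>p = q\<close> goto \<open>l\<close>\<close>

record config =
  pc :: nat
  regs :: "nat \<Rightarrow> nat"
  mem :: "nat \<Rightarrow> nat"
  time :: nat

definition halted :: "'i list \<Rightarrow> config \<Rightarrow> bool" where
  "halted P c \<longleftrightarrow> length P \<le> pc c"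

definition set_reg :: "nat \<Rightarrow> nat \<Rightarrow> config \<Rightarrow> config" where
  "set_reg r v c = c\<lparr>pc := Suc (pc c), regs := (regs c)(r := v)\<rparr>"

fun basic_effect :: "nat \<Rightarrow> basic_instr \<Rightarrow> config \<Rightarrow> config" where
  "basic_effect W (Const r n) c = set_reg r (n mod 2 ^ W) c"
| "basic_effect W (Arith b r p q) c = set_reg r (eval_binop W b (regs c p) (regs c q)) c"
| "basic_effect W (Load r p) c = set_reg r (mem c (regs c p)) c"
| "basic_effect W (Store p q) c =
     c\<lparr>pc := Suc (pc c), mem := (mem c)(regs c p := regs c q)\<rparr>"
| "basic_effect W (JumpLess p q l) c =
     c\<lparr>pc := (if regs c p < regs c q then l else Suc (pc c))\<rparr>"
| "basic_effect W (JumpEq p q l) c =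
     c\<lparr>pc := (if regs c p = regs c q then l else Suc (pc c))\<rparr>"

definition tick :: "nat \<Rightarrow> config \<Rightarrow> config" where
  "tick t c = c\<lparr>time := time c + t\<rparr>"

text \<open>Input words are given in the first registers and at the beginning of memory.\<close>

definition words_at_start :: "nat list \<Rightarrow> nat \<Rightarrow> nat" where
  "words_at_start xs i = (if i < length xs then xs ! i else 0)"

definition start :: "nat list \<Rightarrow> (nat \<Rightarrow> nat) \<Rightarrow> config" where
  "start rs m = \<lparr>pc = 0, regs = words_at_start rs, mem = m, time = 0\<rparr>"

text \<open>A number below \<open>2 ^ w\<close> occupies \<open>\<lceil>w / W\<rceil>\<close> words, least significant word first.\<close>

definition num_words :: "nat \<Rightarrow> nat \<Rightarrow> nat" where
  "num_words W w = nat \<lceil>real w / real W\<rceil>"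

definition encode :: "nat \<Rightarrow> nat \<Rightarrow> nat \<Rightarrow> nat list" where
  "encode W w v = map (\<lambda>i. v div 2 ^ (W * i) mod 2 ^ W) [0..<num_words W w]"


section \<open>Computable functions on \<open>[N]\<close>\<close>

text \<open>
  An evaluator is a deterministic program \<open>F\<close> together with an initial memory image \<open>D\<close>, i.e. data
  the function may depend on (such as a text that is being indexed). Given \<open>x\<close>, it halts with the
  address of the words of the result in register \<open>0\<close>.
\<close>

definition basic_step :: "nat \<Rightarrow> basic_instr list \<Rightarrow> config \<Rightarrow> config" where
  "basic_step W F c =
     (if halted F c then c else tick 1 (basic_effect W (F ! pc c) c))"

definition basic_run :: "nat \<Rightarrow> basic_instr list \<Rightarrow> nat \<Rightarrow> config \<Rightarrow> config" where
  "basic_run W F n = basic_step W F ^^ n"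

text \<open>The running time and the result of an evaluation; \<open>None\<close> if it does not terminate.\<close>

definition evaluate ::
  "nat \<Rightarrow> nat \<Rightarrow> nat \<Rightarrow> basic_instr list \<Rightarrow> (nat \<Rightarrow> nat) \<Rightarrow> nat \<Rightarrow> (nat \<times> nat list) option" where
  "evaluate W N w F D x =
     (let c = (\<lambda>n. basic_run W F n (start [x, N, w, W] D)) in
      if \<exists>n. halted F (c n)
      then let n = (LEAST n. halted F (c n))
           in Some (n, map (\<lambda>i. mem (c n) (regs (c n) 0 + i)) [0..<num_words W w])
      else None)"

definition computes_within ::
  "nat \<Rightarrow> nat \<Rightarrow> nat \<Rightarrow> basic_instr list \<Rightarrow> (nat \<Rightarrow> nat) \<Rightarrow> (nat \<Rightarrow> nat) \<Rightarrow> nat \<Rightarrow> bool" where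
  "computes_within W N w F D f T \<longleftrightarrow>
     (\<forall>a. D a < 2 ^ W) \<and>
     (\<forall>x<N. \<exists>t\<le>T. evaluate W N w F D x = Some (t, encode W w (f x)))"


section \<open>Randomised programs with access to \<open>f\<close>\<close>

text \<open>
  The construction and the query procedures use the evaluator as a subroutine, running in a private
  copy of its workspace: \<open>Eval p q\<close> evaluates the function at the content of register \<open>q\<close> and stores
  the result from the address in register \<open>p\<close> on; it is charged with the running time of the
  evaluator plus the number of words copied. An evaluation that does not terminate blocks the
  machine. \<open>Random r\<close> puts a uniformly random word into register \<open>r\<close>.
\<close>

datatype instr = Basic basic_instr | Random nat | Eval nat nat

definition store_block :: "nat \<Rightarrow> nat list \<Rightarrow> config \<Rightarrow> config" where
  "store_block p ws c =
     c\<lparr>pc := Suc (pc c),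
       mem := (\<lambda>a. if p \<le> a \<and> a < p + length ws then ws ! (a - p) else mem c a)\<rparr>"

fun effect ::
  "nat \<Rightarrow> (nat \<Rightarrow> (nat \<times> nat list) option) \<Rightarrow> instr \<Rightarrow> config \<Rightarrow> config pmf" where
  "effect W ev (Basic i) c = return_pmf (tick 1 (basic_effect W i c))"
| "effect W ev (Random r) c = map_pmf (\<lambda>v. tick 1 (set_reg r v c)) (pmf_of_set {..<2 ^ W})"
| "effect W ev (Eval p q) c = return_pmf (case ev (regs c q) of
       None \<Rightarrow> tick 1 c
     | Some (t, ws) \<Rightarrow> tick (1 + t + length ws) (store_block (regs c p) ws c))"

definition step ::
  "nat \<Rightarrow> (nat \<Rightarrow> (nat \<times> nat list) option) \<Rightarrow> instr list \<Rightarrow> config \<Rightarrow> config pmf" where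
  "step W ev P c = (if halted P c then return_pmf c else effect W ev (P ! pc c) c)"

definition run ::
  "nat \<Rightarrow> (nat \<Rightarrow> (nat \<times> nat list) option) \<Rightarrow> instr list \<Rightarrow> nat \<Rightarrow> config \<Rightarrow> config pmf" where
  "run W ev P n c = ((\<lambda>p. bind_pmf p (step W ev P)) ^^ n) (return_pmf c)"

text \<open>
  Every step takes at least one unit of time, so a computation that takes time at most \<open>T\<close> has
  halted after \<open>T\<close> steps. Queries are not allowed to err or to exceed the time bound.
\<close>

definition halts_within :: "instr list \<Rightarrow> nat \<Rightarrow> config \<Rightarrow> bool" where
  "halts_within P T c \<longleftrightarrow> halted P c \<and> time c \<le> T"

definition answers ::
  "nat \<Rightarrow> (nat \<Rightarrow> (nat \<times> nat list) option) \<Rightarrow> instr list \<Rightarrow> nat \<Rightarrow> config \<Rightarrow>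
     (config \<Rightarrow> 'r) \<Rightarrow> 'r \<Rightarrow> bool" where
  "answers W ev Q T c0 out r \<longleftrightarrow>
     (\<forall>c \<in> set_pmf (run W ev Q T c0). halts_within Q T c \<and> out c = r)"

definition read_number :: "config \<Rightarrow> nat" where
  "read_number c = regs c 0"

definition read_option :: "config \<Rightarrow> nat option" where
  "read_option c = (if regs c 0 = 0 then None else Some (regs c 1))"


section \<open>Preimage queries\<close>

definition preimages :: "nat \<Rightarrow> (nat \<Rightarrow> nat) \<Rightarrow> nat \<Rightarrow> nat set" where
  "preimages N f y = {x \<in> {..<N}. f x = y}"

text \<open>Ranks range over \<open>[N] = {0, \<dots>, N - 1}\<close>, so the \<open>0\<close>th largest element is the maximum.\<close>

definition kth_largest :: "nat \<Rightarrow> nat set \<Rightarrow> nat option" where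
  "kth_largest k A = (if k < card A then Some (rev (sorted_list_of_set A) ! k) else None)"

text \<open>For an even number of elements this is the lower median.\<close>

definition median :: "nat set \<Rightarrow> nat option" where
  "median A = (if A = {} then None else Some (sorted_list_of_set A ! ((card A - 1) div 2)))"


section \<open>The data structure\<close>

text \<open>
  All programs receive \<open>N\<close>, \<open>w\<close>, the word length \<open>W\<close> and the trade-off parameter \<open>A = \<lfloor>N\<^sup>\<alpha>\<rfloor>\<close> in
  their registers, the latter because \<open>\<alpha>\<close> need not be a computable real. A query additionally gets
  the size of the data structure and the rank \<open>k\<close> (where applicable), and finds in its memory the
  data structure, followed by its arguments from \<open>[2 ^ w]\<close>. Nothing but the data structure is
  retained from the memory of the construction.
\<close>

definition build_start :: "nat \<Rightarrow> nat \<Rightarrow> nat \<Rightarrow> nat \<Rightarrow> config" where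
  "build_start W N w A = start [N, w, W, A] (\<lambda>_. 0)"

definition query_start ::
  "nat \<Rightarrow> nat \<Rightarrow> nat \<Rightarrow> nat \<Rightarrow> nat list \<Rightarrow> nat \<Rightarrow> nat list \<Rightarrow> config" where
  "query_start W N w A ds k args =
     start [N, w, W, A, length ds, k] (words_at_start (ds @ concat (map (encode W w) args)))"

text \<open>The construction leaves the data structure at the beginning of memory, its size in register \<open>0\<close>.\<close>

definition data_structure :: "config \<Rightarrow> nat list" where
  "data_structure c = map (mem c) [0..<regs c 0]"

definition supports_ranking ::
  "nat \<Rightarrow> nat \<Rightarrow> nat \<Rightarrow> nat \<Rightarrow> (nat \<Rightarrow> (nat \<times> nat list) option) \<Rightarrow> (nat \<Rightarrow> nat) \<Rightarrow>
     instr list \<Rightarrow> nat \<Rightarrow> nat list \<Rightarrow> bool" where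
  "supports_ranking W N w A ev f Q T ds \<longleftrightarrow>
     (\<forall>y<2 ^ w. \<forall>z<2 ^ w.
        answers W ev Q T (query_start W N w A ds 0 [y, z]) read_number
          (card {x \<in> {..<N}. f x = y \<and> x < z}))"

definition supports_selection ::
  "nat \<Rightarrow> nat \<Rightarrow> nat \<Rightarrow> nat \<Rightarrow> (nat \<Rightarrow> (nat \<times> nat list) option) \<Rightarrow> (nat \<Rightarrow> nat) \<Rightarrow>
     instr list \<Rightarrow> nat \<Rightarrow> nat list \<Rightarrow> bool" where
  "supports_selection W N w A ev f Q T ds \<longleftrightarrow>
     (\<forall>k<N. \<forall>y<2 ^ w.
        answers W ev Q T (query_start W N w A ds k [y]) read_option
          (kth_largest k (preimages N f y)))"

definition supports_median ::
  "nat \<Rightarrow> nat \<Rightarrow> nat \<Rightarrow> nat \<Rightarrow> (nat \<Rightarrow> (nat \<times> nat list) option) \<Rightarrow> (nat \<Rightarrow> nat) \<Rightarrow>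
     instr list \<Rightarrow> nat \<Rightarrow> nat list \<Rightarrow> bool" where
  "supports_median W N w A ev f Q T ds \<longleftrightarrow>
     (\<forall>y<2 ^ w.
        answers W ev Q T (query_start W N w A ds 0 [y]) read_option
          (median (preimages N f y)))"

end

theory Submission
  imports Defs
begin

text \<open>
  Sort the pairs \<open>(f x, x)\<close> lexicographically and cut the sorted sequence into groups of
  \<open>s = N\<^bsup>\<alpha>/4\<^esup>\<close> consecutive elements, up to constants. The data structure stores the first
  element of each group. The map \<open>G\<close> from \<open>x\<close> to the index of its group is computed by binary
  search, and it is exactly \<open>s\<close>-to-one; without this regularization a value with many preimages
  would make all chains collide. Rainbow tables invert \<open>G\<close>: each of \<open>O(s log N)\<close> tables contains
  \<open>N / (4 s\<^sup>2)\<close> chains of \<open>s\<close> steps, every column of a table uses a fresh multiply-shift hash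
  function, and a further hash function maps the ends of the chains to table slots. By a
  second-moment (Bonferroni) estimate, a table covers a given \<open>x\<close> with probability
  \<open>\<Omega>(1 / s)\<close>, so that with high probability every \<open>x\<close> is covered by some table.

  The number of pairs below \<open>(y, z)\<close> is determined by the group in which the boundary lies, found
  by binary search, and by the elements of this group, all of which are found in
  \<open>s\<^sup>3\<close> steps, up to logarithmic factors, by probing every column of every table. Ranking is a
  difference of two such numbers, and selection and median are binary searches over ranks.
\<close>

section \<open>Derandomising the word RAM\<close>

text \<open>With \<open>s\<close> near N^(\<alpha>/4), samples and tables both take about
  \<open>V / s\<close> words, and the three factors of the query time (tables, columns, steps of a
  walk) stay below N^\<alpha>. A table obeys \<open>m * s * s = V / 4\<close>, because beyond that
  product its chains merge too often. Relative to the expected number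
  \<open>m * s / V = 1 / (4 * s)\<close> of hits, shared keys then cost at most 1/2 and repeated
  hits at most 1/4. This leaves \<open>1 / (16 * s)\<close>, and \<open>C = 16 * (d + 1)\<close>
  lowers the chance of missing \<open>x\<close> to N^-(d+1). Multiply-shift is only pairwise
  independent; this suffices because the estimate looks at two chains at a time and different
  columns have independent seeds. It wants powers of two, hence the padded domain
  \<open>2 ^ n\<close> and a group size taken from the largest power of 16 up to \<open>A\<close>.
  Queries must never err, so randomness is confined to establishing a deterministic property
  \<open>good\<close> of the stored words. Chains with equal keys overwrite each other's slot;
  coverage therefore asks for a key that is unique in its table.\<close>

fun deff :: "nat \<Rightarrow> (nat \<Rightarrow> (nat \<times> nat list) option) \<Rightarrow> instr \<Rightarrow> config \<times> nat list \<Rightarrow> config \<times> nat list"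
where
  "deff W ev (Basic i) (c, rs) = (tick 1 (basic_effect W i c), rs)"
| "deff W ev (Random r) (c, rs) = (tick 1 (set_reg r (hd rs) c), tl rs)"
| "deff W ev (Eval p q) (c, rs) = (case ev (regs c q) of
       None \<Rightarrow> tick 1 c
     | Some (t, ws) \<Rightarrow> tick (1 + t + length ws) (store_block (regs c p) ws c), rs)"

definition dstep :: "nat \<Rightarrow> (nat \<Rightarrow> (nat \<times> nat list) option) \<Rightarrow> instr list \<Rightarrow>
    config \<times> nat list \<Rightarrow> config \<times> nat list" where
  "dstep W ev P x = (if halted P (fst x) then x else deff W ev (P ! pc (fst x)) x)"

abbreviation unif_words :: "nat \<Rightarrow> nat \<Rightarrow> nat list pmf" where
  "unif_words W L \<equiv> replicate_pmf L (pmf_of_set {..<2 ^ W})"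

text \<open>\<open>run\<close> appends steps at the end; peeling off the first step instead allows
  an induction that varies the start configuration.\<close>

lemma run_Suc: "run W ev P (Suc n) c = bind_pmf (step W ev P c) (run W ev P n)"
proof -
  let ?F = "\<lambda>p. bind_pmf p (step W ev P)"
  have *: "(?F ^^ n) p = bind_pmf p (\<lambda>c. (?F ^^ n) (return_pmf c))" for p
    by (induction n) (simp_all add: bind_return_pmf' bind_assoc_pmf)
  have "run W ev P (Suc n) c = (?F ^^ n) (step W ev P c)"
    unfolding run_def by (simp only: funpow_Suc_right o_def bind_return_pmf)
  then show ?thesis
    by (subst (asm) *) (simp add: run_def[abs_def])
qed

text \<open>All coin tosses can be drawn in advance, since a run of \<open>n\<close> steps reads at most \<open>n\<close> of them.\<close>

lemma run_conv_unif_words: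
  "n \<le> L \<Longrightarrow> run W ev P n c =
     map_pmf (\<lambda>rs. fst ((dstep W ev P ^^ n) (c, rs))) (unif_words W L)"
proof (induction n arbitrary: c L)
  case 0
  then show ?case by (simp add: run_def map_pmf_const)
next
  case (Suc n)
  have unroll: "(dstep W ev P ^^ Suc n) x = (dstep W ev P ^^ n) (dstep W ev P x)" for x
    by (simp only: funpow_Suc_right o_def)
  show ?case
  proof (cases "halted P c \<or> (\<forall>r. P ! pc c \<noteq> Random r)")
    \<comment> \<open>A halted machine and all instructions but \<open>Random\<close> leave the
      supply of words alone, so the same \<open>L\<close> serves the remaining steps.\<close>
    case True
    obtain c' where c': "step W ev P c = return_pmf c'" "\<And>rs. dstep W ev P (c, rs) = (c', rs)"
      using True by (cases "halted P c"; cases "P ! pc c") (auto simp: step_def dstep_def)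
    show ?thesis
      using Suc.IH[of L c'] Suc.prems by (simp only: run_Suc c' bind_return_pmf unroll)
  next
    case False
    then obtain r where r: "P ! pc c = Random r" "\<not> halted P c" by auto
    \<comment> \<open>The word drawn is the head of the list; its tail still suffices for the
      remaining \<open>n\<close> steps.\<close>
    obtain L' where L: "L = Suc L'" "n \<le> L'" using Suc.prems by (cases L) auto
    have "run W ev P (Suc n) c = bind_pmf (pmf_of_set {..<2 ^ W})
        (\<lambda>v. run W ev P n (tick 1 (set_reg r v c)))"
      using r by (simp add: run_Suc step_def bind_map_pmf)
    also have "\<dots> = bind_pmf (pmf_of_set {..<2 ^ W}) (\<lambda>v. map_pmf
        (\<lambda>rs. fst ((dstep W ev P ^^ n) (tick 1 (set_reg r v c), rs))) (unif_words W L'))"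
      using L by (intro bind_pmf_cong refl Suc.IH)
    also have "\<dots> = map_pmf (\<lambda>rs. fst ((dstep W ev P ^^ Suc n) (c, rs))) (unif_words W L)"
      using r by (simp add: L unroll map_pmf_def bind_assoc_pmf bind_return_pmf dstep_def
          del: funpow.simps)
    finally show ?thesis .
  qed
qed


section \<open>A structured language\<close>

datatype com =
    Bas basic_instr
  | Rnd nat
  | Ev nat nat
  | Skip
  | Seq com com (infixr ";;" 60)
  | IfLess nat nat com com
  | IfEq nat nat com com
  | While nat nat com

record st =
  rg :: "nat \<Rightarrow> nat"
  mm :: "nat \<Rightarrow> nat"
  rnd :: "nat list"

definition setr :: "nat \<Rightarrow> nat \<Rightarrow> st \<Rightarrow> st" where
  "setr r v s = s\<lparr>rg := (rg s)(r := v)\<rparr>"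

definition setm :: "nat \<Rightarrow> nat \<Rightarrow> st \<Rightarrow> st" where
  "setm a v s = s\<lparr>mm := (mm s)(a := v)\<rparr>"

definition setblk :: "nat \<Rightarrow> nat list \<Rightarrow> st \<Rightarrow> st" where
  "setblk p ws s = s\<lparr>mm := (\<lambda>a. if p \<le> a \<and> a < p + length ws then ws ! (a - p) else mm s a)\<rparr>"

text \<open>A derivation certifies termination: \<open>Rnd\<close> is stuck on an exhausted supply
  and \<open>Ev\<close> on a diverging evaluator. The charge of 2 for a test covers the at most two
  jumps of the compiled code.\<close>

inductive exec :: "nat \<Rightarrow> (nat \<Rightarrow> (nat \<times> nat list) option) \<Rightarrow> com \<Rightarrow> st \<Rightarrow> nat \<Rightarrow> st \<Rightarrow> bool"
  for W ev where
  Const: "exec W ev (Bas (Const r n)) s 1 (setr r (n mod 2 ^ W) s)"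
| Arith: "exec W ev (Bas (Arith b r p q)) s 1 (setr r (eval_binop W b (rg s p) (rg s q)) s)"
| Load: "exec W ev (Bas (Load r p)) s 1 (setr r (mm s (rg s p)) s)"
| Store: "exec W ev (Bas (Store p q)) s 1 (setm (rg s p) (rg s q) s)"
| Rnd: "rnd s \<noteq> [] \<Longrightarrow> exec W ev (Rnd r) s 1 (setr r (hd (rnd s)) s\<lparr>rnd := tl (rnd s)\<rparr>)"
| Ev: "ev (rg s q) = Some (t, ws) \<Longrightarrow>
    exec W ev (Ev p q) s (1 + t + length ws) (setblk (rg s p) ws s)"
| Skip: "exec W ev Skip s 0 s"
| Seq: "exec W ev c1 s t1 s1 \<Longrightarrow> exec W ev c2 s1 t2 s2 \<Longrightarrow> exec W ev (c1 ;; c2) s (t1 + t2) s2"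
| IfLess: "exec W ev (if rg s p < rg s q then c1 else c2) s t s' \<Longrightarrow>
    exec W ev (IfLess p q c1 c2) s (2 + t) s'"
| IfEq: "exec W ev (if rg s p = rg s q then c1 else c2) s t s' \<Longrightarrow>
    exec W ev (IfEq p q c1 c2) s (2 + t) s'"
| While_done: "\<not> rg s p < rg s q \<Longrightarrow> exec W ev (While p q c) s 2 s"
| While_step: "rg s p < rg s q \<Longrightarrow> exec W ev c s t1 s1 \<Longrightarrow> exec W ev (While p q c) s1 t2 s2 \<Longrightarrow>
    exec W ev (While p q c) s (2 + t1 + t2) s2"

fun csize :: "com \<Rightarrow> nat" where
  "csize Skip = 0"
| "csize (c1 ;; c2) = csize c1 + csize c2"
| "csize (IfLess p q c1 c2) = csize c1 + csize c2 + 2"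
| "csize (IfEq p q c1 c2) = csize c1 + csize c2 + 2"
| "csize (While p q c) = csize c + 3"
| "csize _ = 1"

text \<open>Jump targets are absolute, hence the offset \<open>l\<close>. \<open>JumpEq 0 0\<close>
  compares a register with itself and so always jumps; in conditionals the else branch is placed
  first.\<close>

fun comp :: "nat \<Rightarrow> com \<Rightarrow> instr list" where
  "comp l (Bas i) = [Basic i]"
| "comp l (Rnd r) = [Random r]"
| "comp l (Ev p q) = [Eval p q]"
| "comp l Skip = []"
| "comp l (c1 ;; c2) = comp l c1 @ comp (l + csize c1) c2"
| "comp l (IfLess p q c1 c2) =
     [Basic (JumpLess p q (l + csize c2 + 2))] @ comp (l + 1) c2 @
     [Basic (JumpEq 0 0 (l + csize c2 + 2 + csize c1))] @ comp (l + csize c2 + 2) c1"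
| "comp l (IfEq p q c1 c2) =
     [Basic (JumpEq p q (l + csize c2 + 2))] @ comp (l + 1) c2 @
     [Basic (JumpEq 0 0 (l + csize c2 + 2 + csize c1))] @ comp (l + csize c2 + 2) c1"
| "comp l (While p q c) =
     [Basic (JumpLess p q (l + 2)), Basic (JumpEq 0 0 (l + csize c + 3))] @ comp (l + 2) c @
     [Basic (JumpEq 0 0 l)]"

lemma length_comp [simp]: "length (comp l c) = csize c"
  by (induction l c rule: comp.induct) auto

section \<open>Correctness of the compiler\<close>

definition conf :: "nat \<Rightarrow> st \<Rightarrow> nat \<Rightarrow> config \<times> nat list" where
  "conf l s T = (\<lparr>pc = l, regs = rg s, mem = mm s, time = T\<rparr>, rnd s)"

text \<open>From \<open>s\<close> at position \<open>l\<close>, at most \<open>t\<close> time units (and steps) lead to \<open>s'\<close> at position \<open>l'\<close>.\<close>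

definition reach :: "nat \<Rightarrow> (nat \<Rightarrow> (nat \<times> nat list) option) \<Rightarrow> instr list \<Rightarrow>
    nat \<Rightarrow> st \<Rightarrow> nat \<Rightarrow> nat \<Rightarrow> st \<Rightarrow> bool" where
  "reach W ev P l s t l' s' \<longleftrightarrow>
     (\<forall>T. \<exists>k T'. (dstep W ev P ^^ k) (conf l s T) = conf l' s' T' \<and> T + k \<le> T' \<and> T' \<le> T + t)"

lemma reach_refl: "reach W ev P l s t l s"
  unfolding reach_def by (intro allI exI[of _ 0] exI) auto

lemma reach_trans:
  assumes "reach W ev P l s t l' s'" "reach W ev P l' s' t' l'' s''" "t + t' \<le> t''"
  shows "reach W ev P l s t'' l'' s''"
  unfolding reach_def
proof
  fix T
  obtain k T1 where 1: "(dstep W ev P ^^ k) (conf l s T) = conf l' s' T1" "T + k \<le> T1" "T1 \<le> T + t"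
    using assms(1) unfolding reach_def by blast
  obtain k' T2 where 2: "(dstep W ev P ^^ k') (conf l' s' T1) = conf l'' s'' T2"
      "T1 + k' \<le> T2" "T2 \<le> T1 + t'"
    using assms(2) unfolding reach_def by blast
  show "\<exists>k T'. (dstep W ev P ^^ k) (conf l s T) = conf l'' s'' T' \<and> T + k \<le> T' \<and> T' \<le> T + t''"
    using 1 2 assms(3)
    by (intro exI[of _ "k' + k"] exI[of _ T2]) (auto simp: funpow_add)
qed

lemma reach_step:
  assumes "l < length P"
    and "\<And>T. \<exists>T'. deff W ev (P ! l) (conf l s T) = conf l' s' T' \<and> T < T' \<and> T' \<le> T + t"
  shows "reach W ev P l s t l' s'"
  unfolding reach_def
proof
  fix T
  obtain T' where "deff W ev (P ! l) (conf l s T) = conf l' s' T'" "T < T'" "T' \<le> T + t"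
    using assms(2) by blast
  then show "\<exists>k T'. (dstep W ev P ^^ k) (conf l s T) = conf l' s' T' \<and> T + k \<le> T' \<and> T' \<le> T + t"
    using assms(1)
    by (intro exI[of _ 1] exI[of _ T'])
       (auto simp: dstep_def halted_def conf_def)
qed

definition code_at :: "instr list \<Rightarrow> nat \<Rightarrow> instr list \<Rightarrow> bool" where
  "code_at P l xs \<longleftrightarrow> l + length xs \<le> length P \<and> (\<forall>i<length xs. P ! (l + i) = xs ! i)"

lemma code_at_Cons:
  "code_at P l (x # xs) \<longleftrightarrow> l < length P \<and> P ! l = x \<and> code_at P (Suc l) xs"
  by (auto simp: code_at_def All_less_Suc2)

lemma code_at_append:
  "code_at P l (xs @ ys) \<longleftrightarrow> code_at P l xs \<and> code_at P (l + length xs) ys"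
proof (induction xs arbitrary: l)
  case Nil
  then show ?case by (auto simp: code_at_def)
next
  case (Cons x xs)
  then show ?case by (simp add: code_at_Cons)
qed

lemma jump_reach:
  assumes "l < length P" "P ! l = Basic (JumpEq 0 0 l')"
  shows "reach W ev P l s 1 l' s"
  using assms by (intro reach_step) (auto simp: conf_def tick_def)

text \<open>Induction on the derivation with \<open>l\<close> arbitrary; a loop step uses the
  hypothesis for the remaining loop at the same \<open>l\<close>, to which the last jump of the body
  returns.\<close>

lemma reach_comp:
  "exec W ev c s t s' \<Longrightarrow> code_at P l (comp l c) \<Longrightarrow> reach W ev P l s t (l + csize c) s'"
proof (induction arbitrary: l rule: exec.induct)
  case (Seq c1 s t1 s1 c2 t2 s2)
  from Seq.prems have "code_at P l (comp l c1)" "code_at P (l + csize c1) (comp (l + csize c1) c2)"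
    by (auto simp: code_at_append)
  from Seq.IH(1)[OF this(1)] Seq.IH(2)[OF this(2)] show ?case
    by (auto intro: reach_trans simp: add.assoc)
next
  case (IfLess s p q c1 c2 t s' l)
  from IfLess.prems have c: "l < length P" "P ! l = Basic (JumpLess p q (l + csize c2 + 2))"
    "code_at P (l + 1) (comp (l + 1) c2)"
    "l + csize c2 + 1 < length P" "P ! (l + csize c2 + 1) = Basic (JumpEq 0 0 (l + csize c2 + 2 + csize c1))"
    "code_at P (l + csize c2 + 2) (comp (l + csize c2 + 2) c1)"
    by (auto simp: code_at_append code_at_Cons algebra_simps)
  show ?case
  proof (cases "rg s p < rg s q")
    case True
    have r: "reach W ev P l s 1 (l + csize c2 + 2) s"
      using c(1,2) True by (intro reach_step) (auto simp: conf_def tick_def)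
    have r': "reach W ev P (l + csize c2 + 2) s t (l + csize c2 + 2 + csize c1) s'"
      using IfLess.IH[of "l + csize c2 + 2"] True c(6) by simp
    from reach_trans[OF r r', of "2 + t"] show ?thesis by (simp add: algebra_simps)
  next
    case False
    have r: "reach W ev P l s 1 (l + 1) s"
      using c(1,2) False by (intro reach_step) (auto simp: conf_def tick_def)
    have r': "reach W ev P (l + 1) s t (l + 1 + csize c2) s'"
      using IfLess.IH[of "l + 1"] False c(3) by simp
    from reach_trans[OF r r' order.refl] have "reach W ev P l s (1 + t) (l + csize c2 + 1) s'"
      by (simp add: algebra_simps)
    from reach_trans[OF this jump_reach[OF c(4,5)]] show ?thesis
      by (simp add: algebra_simps)
  qed
next
  case (IfEq s p q c1 c2 t s' l)
  from IfEq.prems have c: "l < length P" "P ! l = Basic (JumpEq p q (l + csize c2 + 2))"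
    "code_at P (l + 1) (comp (l + 1) c2)"
    "l + csize c2 + 1 < length P" "P ! (l + csize c2 + 1) = Basic (JumpEq 0 0 (l + csize c2 + 2 + csize c1))"
    "code_at P (l + csize c2 + 2) (comp (l + csize c2 + 2) c1)"
    by (auto simp: code_at_append code_at_Cons algebra_simps)
  show ?case
  proof (cases "rg s p = rg s q")
    case True
    have r: "reach W ev P l s 1 (l + csize c2 + 2) s"
      using c(1,2) True by (intro reach_step) (auto simp: conf_def tick_def)
    have r': "reach W ev P (l + csize c2 + 2) s t (l + csize c2 + 2 + csize c1) s'"
      using IfEq.IH[of "l + csize c2 + 2"] True c(6) by simp
    from reach_trans[OF r r', of "2 + t"] show ?thesis by (simp add: algebra_simps)
  next
    case False
    have r: "reach W ev P l s 1 (l + 1) s"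
      using c(1,2) False by (intro reach_step) (auto simp: conf_def tick_def)
    have r': "reach W ev P (l + 1) s t (l + 1 + csize c2) s'"
      using IfEq.IH[of "l + 1"] False c(3) by simp
    from reach_trans[OF r r' order.refl] have "reach W ev P l s (1 + t) (l + csize c2 + 1) s'"
      by (simp add: algebra_simps)
    from reach_trans[OF this jump_reach[OF c(4,5)]] show ?thesis
      by (simp add: algebra_simps)
  qed
next
  case (While_done s p q c)
  then have c: "l < length P" "P ! l = Basic (JumpLess p q (l + 2))"
    "l + 1 < length P" "P ! (l + 1) = Basic (JumpEq 0 0 (l + csize c + 3))"
    by (auto simp: code_at_append code_at_Cons)
  have "reach W ev P l s 1 (l + 1) s"
    using c(1,2) While_done by (intro reach_step) (auto simp: conf_def tick_def)
  from reach_trans[OF this jump_reach[OF c(3,4)]] show ?case by (simp add: add.assoc)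
next
  case (While_step s p q c t1 s1 t2 s2)
  from While_step.prems have c: "l < length P" "P ! l = Basic (JumpLess p q (l + 2))"
    "code_at P (l + 2) (comp (l + 2) c)"
    "l + 2 + csize c < length P" "P ! (l + 2 + csize c) = Basic (JumpEq 0 0 l)"
    by (auto simp: code_at_append code_at_Cons algebra_simps)
  have "reach W ev P l s 1 (l + 2) s"
    using c(1,2) While_step.hyps by (intro reach_step) (auto simp: conf_def tick_def)
  from reach_trans[OF this While_step.IH(1)[OF c(3)] order.refl]
  have "reach W ev P l s (1 + t1) (l + 2 + csize c) s1" .
  from reach_trans[OF this jump_reach[OF c(4,5)] order.refl]
  have "reach W ev P l s (1 + t1 + 1) l s1" .
  from reach_trans[OF this While_step.IH(2)[OF While_step.prems]] show ?case by simp
next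
  case (Skip s)
  then show ?case by (simp add: reach_refl)
qed (auto intro!: reach_step simp: code_at_Cons conf_def tick_def set_reg_def setr_def setm_def
    setblk_def store_block_def cong: if_cong)


section \<open>Weakest preconditions with running times\<close>

text \<open>Existence of a derivation expresses total correctness, since \<open>reach_comp\<close>
  turns any derivation into the actual run.\<close>

definition wp :: "nat \<Rightarrow> (nat \<Rightarrow> (nat \<times> nat list) option) \<Rightarrow> com \<Rightarrow>
    (nat \<Rightarrow> st \<Rightarrow> bool) \<Rightarrow> st \<Rightarrow> bool" where
  "wp W ev c Q s \<longleftrightarrow> (\<exists>t s'. exec W ev c s t s' \<and> Q t s')"

lemma setr_sel [simp]:
  "rg (setr r v s) = (rg s)(r := v)" "mm (setr r v s) = mm s" "rnd (setr r v s) = rnd s"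
  by (simp_all add: setr_def)

lemma setm_sel [simp]:
  "rg (setm a v s) = rg s" "mm (setm a v s) = (mm s)(a := v)" "rnd (setm a v s) = rnd s"
  by (simp_all add: setm_def)

lemma setblk_sel [simp]:
  "rg (setblk a ws s) = rg s" "rnd (setblk a ws s) = rnd s"
  "mm (setblk p ws s) =
     (\<lambda>a. if p \<le> a \<and> a < p + length ws then ws ! (a - p) else mm s a)"
  by (simp_all add: setblk_def)

inductive_cases exec_ConstE: "exec W ev (Bas (Const r n)) s t s'"
inductive_cases exec_ArithE: "exec W ev (Bas (Arith b r p q)) s t s'"
inductive_cases exec_LoadE: "exec W ev (Bas (Load r p)) s t s'"
inductive_cases exec_StoreE: "exec W ev (Bas (Store p q)) s t s'"
inductive_cases exec_SkipE: "exec W ev Skip s t s'"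
inductive_cases exec_SeqE: "exec W ev (c1 ;; c2) s t s'"
inductive_cases exec_IfLessE: "exec W ev (IfLess p q c1 c2) s t s'"
inductive_cases exec_IfEqE: "exec W ev (IfEq p q c1 c2) s t s'"

text \<open>Equations rather than implications, so that straight-line code is verified by rewriting
  alone.\<close>

lemma wp_simps [simp]:
  "wp W ev (Bas (Const r n)) Q s = Q 1 (setr r (n mod 2 ^ W) s)"
  "wp W ev (Bas (Arith b r p q)) Q s = Q 1 (setr r (eval_binop W b (rg s p) (rg s q)) s)"
  "wp W ev (Bas (Load r p)) Q s = Q 1 (setr r (mm s (rg s p)) s)"
  "wp W ev (Bas (Store p q)) Q s = Q 1 (setm (rg s p) (rg s q) s)"
  "wp W ev Skip Q s = Q 0 s"
  unfolding wp_def
  subgoal by (metis exec_ConstE exec.Const)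
  subgoal by (metis exec_ArithE exec.Arith)
  subgoal by (metis exec_LoadE exec.Load)
  subgoal by (metis exec_StoreE exec.Store)
  subgoal by (metis exec_SkipE exec.Skip)
  done

lemma wp_Seq [simp]:
  "wp W ev (c1 ;; c2) Q s = wp W ev c1 (\<lambda>t1 s1. wp W ev c2 (\<lambda>t2. Q (t1 + t2)) s1) s"
  unfolding wp_def by (metis exec_SeqE exec.Seq)

lemma wp_If [simp]:
  "wp W ev (IfLess p q c1 c2) Q s = (if rg s p < rg s q then wp W ev c1 (\<lambda>t. Q (2 + t)) s
      else wp W ev c2 (\<lambda>t. Q (2 + t)) s)"
  "wp W ev (IfEq p q c1 c2) Q s = (if rg s p = rg s q then wp W ev c1 (\<lambda>t. Q (2 + t)) s
      else wp W ev c2 (\<lambda>t. Q (2 + t)) s)"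
proof -
  have "exec W ev (IfLess p q c1 c2) s t s' \<longleftrightarrow>
      (\<exists>t'. t = 2 + t' \<and> exec W ev (if rg s p < rg s q then c1 else c2) s t' s')" for t s'
    by (rule iffI, erule exec_IfLessE, simp, elim exE conjE, hypsubst, erule exec.IfLess)
  then show "wp W ev (IfLess p q c1 c2) Q s = (if rg s p < rg s q then wp W ev c1 (\<lambda>t. Q (2 + t)) s
      else wp W ev c2 (\<lambda>t. Q (2 + t)) s)"
    unfolding wp_def by (cases "rg s p < rg s q") auto
  have "exec W ev (IfEq p q c1 c2) s t s' \<longleftrightarrow>
      (\<exists>t'. t = 2 + t' \<and> exec W ev (if rg s p = rg s q then c1 else c2) s t' s')" for t s'
    by (rule iffI, erule exec_IfEqE, simp, elim exE conjE, hypsubst, erule exec.IfEq)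
  then show "wp W ev (IfEq p q c1 c2) Q s = (if rg s p = rg s q then wp W ev c1 (\<lambda>t. Q (2 + t)) s
      else wp W ev c2 (\<lambda>t. Q (2 + t)) s)"
    unfolding wp_def by (cases "rg s p = rg s q") auto
qed

text \<open>\<open>Rnd\<close> and \<open>Ev\<close> can be stuck; their rules are implications that
  ask for a nonempty supply and a terminating evaluation.\<close>

lemma wp_Rnd: "rnd s = v # vs \<Longrightarrow> Q 1 (setr r v s\<lparr>rnd := vs\<rparr>) \<Longrightarrow> wp W ev (Rnd r) Q s"
  unfolding wp_def using exec.Rnd[of s W ev r] by auto

lemma wp_Ev:
  "ev (rg s q) = Some (t, ws) \<Longrightarrow> Q (1 + t + length ws) (setblk (rg s p) ws s) \<Longrightarrow>
   wp W ev (Ev p q) Q s"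
  unfolding wp_def using exec.Ev by blast

lemma wp_mono:
  "wp W ev c Q s \<Longrightarrow> (\<And>t s'. Q t s' \<Longrightarrow> Q' t s') \<Longrightarrow> wp W ev c Q' s"
  unfolding wp_def by blast

text \<open>Indexing the invariant by the number of remaining rounds delivers termination and the
  time bound together.\<close>

lemma wp_while:
  assumes "I k s"
    and "\<And>k s. I (Suc k) s \<Longrightarrow> rg s p < rg s q \<and> wp W ev c (\<lambda>t s'. t \<le> B \<and> I k s') s"
    and "\<And>s. I 0 s \<Longrightarrow> \<not> rg s p < rg s q"
  shows "wp W ev (While p q c) (\<lambda>t s'. t \<le> k * (B + 2) + 2 \<and> I 0 s') s"
  using assms(1)
proof (induction k arbitrary: s)
  case 0
  with assms(3) have "exec W ev (While p q c) s 2 s" by (simp add: exec.While_done)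
  with 0 show ?case unfolding wp_def by (intro exI[of _ 2] exI[of _ s]) simp
next
  case (Suc k)
  then obtain t1 s1 where 1: "rg s p < rg s q" "exec W ev c s t1 s1" "t1 \<le> B" "I k s1"
    using assms(2) unfolding wp_def by blast
  then obtain t2 s2 where "exec W ev (While p q c) s1 t2 s2" "t2 \<le> k * (B + 2) + 2" "I 0 s2"
    using Suc.IH unfolding wp_def by blast
  moreover from this(1) 1 have "exec W ev (While p q c) s (2 + t1 + t2) s2"
    by (intro exec.While_step)
  ultimately show ?case using \<open>t1 \<le> B\<close> unfolding wp_def
    by (intro exI[of _ "2 + t1 + t2"] exI[of _ s2]) auto
qed

text \<open>Relies on register \<open>7\<close> holding the constant \<open>1\<close>.\<close>

definition For :: "nat \<Rightarrow> nat \<Rightarrow> com \<Rightarrow> com" where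
  "For i e c = Bas (Const i 0) ;; While i e (c ;; Bas (Arith Add i i 7))"

text \<open>The counter is incremented after the body, hence \<open>I (Suc j)\<close> is demanded of
  the state with the counter already advanced. Increment and loop test account for the
  \<open>+ 3\<close> per round.\<close>

lemma wp_for:
  assumes init: "I 0 (setr i 0 s)" and n: "n < 2 ^ W"
    and bound: "\<And>j s'. I j s' \<Longrightarrow> rg s' e = n \<and> rg s' 7 = 1"
    and body: "\<And>j s'. j < n \<Longrightarrow> rg s' i = j \<Longrightarrow> I j s' \<Longrightarrow>
      wp W ev c (\<lambda>t s''. t \<le> B \<and> rg s'' i = j \<and> rg s'' 7 = 1 \<and> I (Suc j) (setr i (Suc j) s'')) s'"
  shows "wp W ev (For i e c) (\<lambda>t s'. t \<le> n * (B + 3) + 3 \<and> I n s') s"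
proof -
  define J where "J k s' \<longleftrightarrow> k \<le> n \<and> rg s' i = n - k \<and> I (n - k) s'" for k s'
  have "wp W ev (While i e (c ;; Bas (Arith Add i i 7)))
      (\<lambda>t s'. t \<le> n * (B + 1 + 2) + 2 \<and> J 0 s') (setr i 0 s)"
  proof (rule wp_while)
    show "J n (setr i 0 s)" using init by (simp add: J_def)
  next
    fix k s' assume "J (Suc k) s'"
    then have *: "Suc k \<le> n" "rg s' i = n - Suc k" "I (n - Suc k) s'" by (auto simp: J_def)
    then have "wp W ev c (\<lambda>t s''. t \<le> B \<and> rg s'' i = n - Suc k \<and> rg s'' 7 = 1 \<and>
        I (Suc (n - Suc k)) (setr i (Suc (n - Suc k)) s'')) s'"
      by (intro body) auto
    then have "wp W ev (c ;; Bas (Arith Add i i 7)) (\<lambda>t s'. t \<le> B + 1 \<and> J k s') s'"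
      unfolding wp_Seq wp_simps
      by (rule wp_mono) (use * n in \<open>auto simp: J_def Suc_diff_Suc\<close>)
    then show "rg s' i < rg s' e \<and> wp W ev (c ;; Bas (Arith Add i i 7)) (\<lambda>t s'. t \<le> B + 1 \<and> J k s') s'"
      using * bound[OF *(3)] by auto
  next
    fix s' assume "J 0 s'"
    then show "\<not> rg s' i < rg s' e" using bound[of n s'] by (auto simp: J_def)
  qed
  then show ?thesis unfolding For_def wp_Seq wp_simps
    by (auto elim!: wp_mono simp: J_def algebra_simps)
qed

text \<open>Stack discipline: a macro of level \<open>h\<close> writes only to registers from \<open>h\<close> on.\<close>

definition keeps :: "nat \<Rightarrow> nat \<Rightarrow> st \<Rightarrow> st \<Rightarrow> bool" where
  "keeps h X s s' \<longleftrightarrow> (\<forall>r<h. rg s' r = rg s r) \<and> (\<forall>a<X. mm s' a = mm s a)"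

lemma keeps_refl [simp]: "keeps h X q q"
  by (simp add: keeps_def)

lemma keeps_setr [simp]: "keeps h X q q' \<Longrightarrow> h \<le> k \<Longrightarrow> keeps h X q (setr k v q')"
  by (simp add: keeps_def)

section \<open>The order of the preimages\<close>

text \<open>\<open>n\<close> is the number of bits of the padded domain and \<open>sg\<close> that
  of the group size. \<open>2 * n \<le> W\<close> is what pairwise independence of multiply-shift
  requires for inputs and outputs of \<open>n\<close> bits; \<open>4 * sg \<le> n\<close> reflects
  \<open>s ^ 4 \<le> A \<le> N\<close>.\<close>

locale inversion =
  fixes N W w n sg C \<tau> :: nat and f :: "nat \<Rightarrow> nat" and ev :: "nat \<Rightarrow> (nat \<times> nat list) option"
  assumes N_pos: "0 < N" and N_le: "N \<le> 2 ^ n" and n_ge: "4 \<le> n" and sg_le: "4 * sg \<le> n"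
    and C_pos: "0 < C"
    and n_le_W: "2 * n \<le> W"
    and ev: "\<And>x. x < N \<Longrightarrow> \<exists>t\<le>\<tau>. ev x = Some (t, encode W w (f x))"
    and f_less: "\<And>x. x < N \<Longrightarrow> f x < 2 ^ w"
begin

text \<open>
  The domain is padded to \<open>V\<close> elements, split into \<open>Gs\<close> groups of size \<open>s\<close>. There are \<open>r\<close> tables
  of \<open>Kq\<close> slots with \<open>m\<close> chains each. The data structure occupies the addresses below \<open>D\<close>: the first
  elements of the groups, then \<open>cs\<close> hash seeds per table, and from \<open>aT\<close> on the tables. An encoded
  value of \<open>f\<close> has \<open>nw\<close> words.
\<close>

definition "V = (2::nat) ^ n"
definition "s = (2::nat) ^ sg"
definition "Gs = (2::nat) ^ (n - sg)"
definition "m = (2::nat) ^ (n - 2 * sg - 2)"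
definition "Kq = (2::nat) ^ (n - 2 * sg)"
definition "r = C * s * n"
definition "cs = 2 * (s + 1)"
definition "aT = Gs + r * cs"
definition "D = aT + r * Kq"
definition "nw = num_words W w"

lemma pos_params: "0 < V" "0 < s" "0 < Gs" "0 < m" "0 < Kq" "0 < r" "0 < W"
  using n_ge n_le_W C_pos by (auto simp: V_def s_def Gs_def m_def Kq_def r_def)

lemma Gs_s: "Gs * s = V"
  using sg_le by (simp add: V_def s_def Gs_def power_add[symmetric])

lemma N_le_V: "N \<le> V"
  using N_le by (simp add: V_def)

definition less :: "nat \<Rightarrow> nat \<Rightarrow> nat \<Rightarrow> bool" where
  "less u y z \<longleftrightarrow> u < N \<and> (f u < y \<or> f u = y \<and> u < z)"

definition P :: "nat \<Rightarrow> nat \<Rightarrow> nat" where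
  "P y z = card {u. less u y z}"

text \<open>Padding elements keep their own index behind all real pairs, which makes
  \<open>pos\<close> a permutation of \<open>{..<V}\<close>.\<close>

definition pos :: "nat \<Rightarrow> nat" where
  "pos u = (if u < N then P (f u) u else u)"

definition G :: "nat \<Rightarrow> nat" where
  "G u = pos u div s"

text \<open>Samples are stored as elements, one word each; the value of \<open>f\<close> at a sample
  is recomputed whenever it is compared.\<close>

definition smp :: "nat \<Rightarrow> nat" where
  "smp g = inv_into {..<V} pos (g * s)"

lemma finite_less [simp]: "finite {u. less u y z}"
  by (rule finite_subset[of _ "{..<N}"]) (auto simp: less_def)

lemma P_le: "P y z \<le> N"
  unfolding P_def by (rule order.trans[OF card_mono[of "{..<N}"]]) (auto simp: less_def)

lemma P_mono: "z \<le> z' \<Longrightarrow> P y z \<le> P y z'"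
  unfolding P_def by (rule card_mono) (auto simp: less_def)

lemma P_ge_N: "N \<le> z \<Longrightarrow> P y z = P y N"
  unfolding P_def by (rule arg_cong[of _ _ card]) (auto simp: less_def)

text \<open>The sets of pairs below a bound are nested, so strict inclusion shows as strict
  inequality of cardinalities. Padding has positions from \<open>N\<close> on, which no
  \<open>P\<close> exceeds.\<close>

lemma less_iff_pos:
  assumes "u < V"
  shows "less u y z \<longleftrightarrow> pos u < P y z"
proof (cases "u < N")
  case False
  then show ?thesis using P_le[of y z] by (auto simp: less_def pos_def)
next
  case True
  show ?thesis
  proof (cases "less u y z")
    case True
    have "{v. less v (f u) u} \<subset> {v. less v y z}"
      using True by (auto simp: less_def)
    then have "P (f u) u < P y z" unfolding P_def by (rule psubset_card_mono[rotated]) simp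
    then show ?thesis using True \<open>u < N\<close> by (simp add: pos_def)
  next
    case False
    have "{v. less v y z} \<subseteq> {v. less v (f u) u}"
      using False \<open>u < N\<close> by (auto simp: less_def)
    then have "P y z \<le> P (f u) u" unfolding P_def by (rule card_mono[rotated]) simp
    then show ?thesis using False \<open>u < N\<close> by (simp add: pos_def)
  qed
qed

lemma P_Suc: "u < N \<Longrightarrow> P (f u) (Suc u) = Suc (pos u)"
proof -
  assume u: "u < N"
  have "{v. less v (f u) (Suc u)} = insert u {v. less v (f u) u}" using u by (auto simp: less_def)
  then show ?thesis using u by (simp add: P_def pos_def card_insert_if less_def)
qed

lemma pos_less: "u < N \<Longrightarrow> pos u < N"
  using P_Suc[of u] P_le[of "f u" "Suc u"] by auto

text \<open>Distinct real pairs are comparable and so get distinct ranks below \<open>N\<close>,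
  while padding is fixed. An injective self-map of a finite set is onto.\<close>

lemma pos_bij: "bij_betw pos {..<V} {..<V}"
proof -
  have "inj_on pos {..<V}"
  proof (rule inj_onI)
    fix u v assume uv: "u \<in> {..<V}" "v \<in> {..<V}" "pos u = pos v"
    show "u = v"
    proof (cases "u < N \<and> v < N")
      case True
      then have "\<not> less u (f v) v" "\<not> less v (f u) u"
        using uv less_iff_pos[of u "f v" v] less_iff_pos[of v "f u" u] by (auto simp: pos_def)
      then show ?thesis using True by (auto simp: less_def)
    next
      case False
      then show ?thesis using uv(3) pos_less[of u] pos_less[of v] by (auto simp: pos_def split: if_splits)
    qed
  qed
  moreover have "pos ` {..<V} \<subseteq> {..<V}"
    using pos_less N_le_V by (fastforce simp: pos_def)
  ultimately show ?thesis
    by (simp add: bij_betw_def endo_inj_surj)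
qed

lemma smp: "g < Gs \<Longrightarrow> smp g < V" "g < Gs \<Longrightarrow> pos (smp g) = g * s"
proof -
  assume "g < Gs"
  then have "g * s < V" using Gs_s pos_params by (metis mult_less_cancel2)
  then have "g * s \<in> pos ` {..<V}" using pos_bij by (simp add: bij_betw_def)
  from inv_into_into[OF this] f_inv_into_f[OF this]
  show "smp g < V" "pos (smp g) = g * s" by (auto simp: smp_def)
qed

lemma G_less: "u < V \<Longrightarrow> G u < Gs"
proof -
  assume "u < V"
  then have "pos u < V" using pos_bij by (auto simp: bij_betw_def)
  then show ?thesis unfolding G_def using Gs_s pos_params by (simp add: div_less_iff_less_mult)
qed

text \<open>Under the bijection \<open>pos\<close> a group is a block of \<open>s\<close>
  consecutive positions; padding makes even the last block complete.\<close>

lemma G_fibre: "g < Gs \<Longrightarrow> card {u. u < V \<and> G u = g} = s"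
proof -
  assume g: "g < Gs"
  have "bij_betw pos {u. u < V \<and> G u = g} {g * s..<g * s + s}"
  proof (rule bij_betw_imageI)
    show "inj_on pos {u. u < V \<and> G u = g}"
      using pos_bij by (auto simp: bij_betw_def intro: inj_on_subset)
    have iff: "p div s = g \<longleftrightarrow> g * s \<le> p \<and> p < g * s + s" for p
      using pos_params(2) dividend_less_div_times[of s p] div_times_less_eq_dividend[of p s]
      by (auto simp: algebra_simps intro: div_nat_eqI)
    have "g * s + s \<le> V" using g Gs_s by (metis Suc_leI mult_Suc mult_le_mono1 add.commute)
    then have "{g * s..<g * s + s} \<subseteq> pos ` {..<V}"
      using pos_bij by (auto simp: bij_betw_def)
    then show "pos ` {u. u < V \<and> G u = g} = {g * s..<g * s + s}"
      by (force simp: G_def iff)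
  qed
  from bij_betw_same_card[OF this] show ?thesis by simp
qed

text \<open>The boundary group of \<open>(y, z)\<close> is the last one that contains a pair below \<open>(y, z)\<close>;
  \<open>loc y z\<close> is its index plus one, or \<open>0\<close> if there is none.\<close>

definition loc :: "nat \<Rightarrow> nat \<Rightarrow> nat" where
  "loc y z = (P y z + s - 1) div s"

text \<open>\<open>loc\<close> is the ceiling of \<open>P y z / s\<close>, and this is the
  adjunction that characterises a ceiling.\<close>

lemma less_loc_iff: "g < loc y z \<longleftrightarrow> g * s < P y z"
proof -
  have "g < loc y z \<longleftrightarrow> Suc g \<le> (P y z + s - 1) div s" by (auto simp: loc_def)
  also have "\<dots> \<longleftrightarrow> Suc g * s \<le> P y z + s - 1" using pos_params(2) by (rule less_eq_div_iff_mult_less_eq)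
  also have "\<dots> \<longleftrightarrow> g * s < P y z" using pos_params(2) by auto
  finally show ?thesis .
qed

lemma loc_le: "loc y z \<le> Gs"
  using less_loc_iff[of Gs y z] Gs_s P_le[of y z] N_le_V by auto

lemma less_smp_iff: "g < Gs \<Longrightarrow> less (smp g) y z \<longleftrightarrow> g < loc y z"
  by (simp add: less_iff_pos smp less_loc_iff)

lemma loc_eq_0: "loc y z = 0 \<Longrightarrow> P y z = 0"
  using less_loc_iff[of 0 y z] by auto

text \<open>The boundary \<open>(f u, u + 1)\<close> lies right behind \<open>u\<close>, so the
  binary search for boundary groups computes \<open>G\<close> as well.\<close>

lemma G_eq_loc: "u < N \<Longrightarrow> G u = loc (f u) (Suc u) - 1"
  using pos_params(2) by (simp add: loc_def P_Suc G_def)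

text \<open>All groups before the boundary group lie completely below \<open>(y, z)\<close> and
  contribute \<open>s\<close> each; in the boundary group \<open>pos\<close> maps the pairs in
  question onto an interval.\<close>

lemma P_eq_loc:
  assumes "0 < loc y z"
  shows "P y z = (loc y z - 1) * s + card {u. less u y z \<and> G u = loc y z - 1}"
proof -
  define g where "g = loc y z - 1"
  have 1: "g * s < P y z" using assms less_loc_iff[of g y z] by (auto simp: g_def)
  have 2: "P y z \<le> g * s + s" using assms less_loc_iff[of "loc y z" y z]
    by (cases "loc y z") (auto simp: g_def)
  have "bij_betw pos {u. less u y z \<and> G u = g} {g * s..<P y z}"
  proof (rule bij_betw_imageI)
    have sub: "{u. less u y z \<and> G u = g} \<subseteq> {..<V}" using N_le_V by (auto simp: less_def)
    then show "inj_on pos {u. less u y z \<and> G u = g}"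
      using pos_bij by (auto simp: bij_betw_def intro: inj_on_subset)
    have "p \<in> pos ` {u. less u y z \<and> G u = g}" if "g * s \<le> p" "p < P y z" for p
    proof -
      have "p < V" using that P_le[of y z] N_le_V by simp
      then have "p \<in> pos ` {..<V}" using pos_bij by (simp add: bij_betw_def)
      then obtain u where "u < V" "pos u = p" by auto
      moreover have "p div s = g"
        using that 2 by (intro div_nat_eqI) (auto simp: algebra_simps)
      ultimately show ?thesis using that by (auto simp: less_iff_pos G_def)
    qed
    moreover have "g * s \<le> pos u \<and> pos u < P y z" if "less u y z" "G u = g" for u
    proof -
      have "u < V" using that sub by auto
      then show ?thesis using that less_iff_pos[of u y z] by (auto simp: G_def)
    qed
    ultimately show "pos ` {u. less u y z \<and> G u = g} = {g * s..<P y z}" by auto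
  qed
  from bij_betw_same_card[OF this] 1 show ?thesis by (simp add: g_def)
qed


section \<open>Rainbow chains\<close>

text \<open>Multiply-shift hashing with the seeds \<open>M p\<close> and \<open>M (p + 1)\<close>.\<close>

definition hsh :: "(nat \<Rightarrow> nat) \<Rightarrow> nat \<Rightarrow> nat \<Rightarrow> nat" where
  "hsh M p g = (M p * g + M (p + 1)) mod 2 ^ W"

text \<open>The leading bits are the well distributed part of a multiply-shift hash:
  \<open>n\<close> of them name an element of the padded domain, and the \<open>n - 2 * sg\<close>
  kept by \<open>kv\<close> name a table slot.\<close>

definition xv :: "(nat \<Rightarrow> nat) \<Rightarrow> nat \<Rightarrow> nat \<Rightarrow> nat" where
  "xv M p g = drop_bit (W - n) (hsh M p g)"

definition kv :: "(nat \<Rightarrow> nat) \<Rightarrow> nat \<Rightarrow> nat \<Rightarrow> nat" where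
  "kv M p g = drop_bit (W - (n - 2 * sg)) (hsh M p g)"

text \<open>Chains live on group indices: column \<open>k\<close> hashes the current group to an
  element, and the chain continues with the group of that element.\<close>

fun walk :: "(nat \<Rightarrow> nat) \<Rightarrow> nat \<Rightarrow> nat \<Rightarrow> nat \<Rightarrow> nat" where
  "walk M p 0 g = g"
| "walk M p (Suc k) g = G (xv M (p + 2 * k) (walk M p k g))"

text \<open>Guesses that the sought element occurs in column \<open>k\<close>. Then the chain leaves
  this column in group \<open>g\<close>, so its end and its slot can be computed from
  \<open>g\<close>, and the stored start is replayed up to column \<open>k\<close>.\<close>

definition probe :: "(nat \<Rightarrow> nat) \<Rightarrow> nat \<Rightarrow> nat \<Rightarrow> nat \<Rightarrow> nat" where
  "probe M i k g =
    (let p = Gs + i * cs;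
         a = walk M (p + 2 * (k + 1)) (s - k - 1) g;
         j = M (aT + i * Kq + kv M (p + 2 * s) a)
     in xv M (p + 2 * k) (walk M p k j))"

text \<open>The deterministic interface between construction and queries; chance enters only in
  establishing it.\<close>

definition good :: "(nat \<Rightarrow> nat) \<Rightarrow> bool" where
  "good M \<longleftrightarrow> (\<forall>g<Gs. M g = smp g) \<and> (\<forall>x<N. \<exists>i<r. \<exists>k<s. probe M i k (G x) = x)"

lemma hsh_less: "hsh M p g < 2 ^ W"
  by (simp add: hsh_def)

lemma xv_less: "xv M p g < V"
proof -
  have "2 ^ W = (2::nat) ^ n * 2 ^ (W - n)" using n_le_W by (simp add: power_add[symmetric])
  then show ?thesis using hsh_less[of M p g]
    by (simp add: xv_def V_def drop_bit_eq_div div_less_iff_less_mult)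
qed

lemma kv_less: "kv M p g < Kq"
proof -
  have "2 ^ W = (2::nat) ^ (n - 2 * sg) * 2 ^ (W - (n - 2 * sg))"
    using n_le_W by (simp add: power_add[symmetric])
  then show ?thesis using hsh_less[of M p g]
    by (simp add: kv_def Kq_def drop_bit_eq_div div_less_iff_less_mult)
qed

lemma Gs_le_V: "Gs \<le> V" "s \<le> V"
  using Gs_s pos_params by (metis Suc_leI mult.right_neutral mult_le_mono2 One_nat_def,
    metis Suc_leI mult.left_neutral mult_le_mono1 One_nat_def)

end

section \<open>Programs\<close>

abbreviation "const r k \<equiv> Bas (Const r k)"
abbreviation "mov r p \<equiv> Bas (Arith Or r p p)"
abbreviation "add r p q \<equiv> Bas (Arith Add r p q)"
abbreviation "sub r p q \<equiv> Bas (Arith Sub r p q)"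
abbreviation "mul r p q \<equiv> Bas (Arith Mul r p q)"
abbreviation "shr r p q \<equiv> Bas (Arith Shr r p q)"
abbreviation "load r p \<equiv> Bas (Load r p)"
abbreviation "store p q \<equiv> Bas (Store p q)"

text \<open>
  Registers below \<open>25\<close> are set up in advance and hold the parameters of the problem,
  addresses, \<open>1\<close> (register \<open>7\<close>) and \<open>0\<close> (register \<open>24\<close>). Arguments and results of the macros:
  \<open>LESS\<close> compares the element in \<open>60\<close> with the value at address \<open>61\<close> and the element in \<open>62\<close>, result
  in \<open>60\<close>; \<open>LOC\<close> takes a value at address \<open>51\<close> and an element in \<open>52\<close>, result in \<open>50\<close>; \<open>GRP\<close>
  works in place on \<open>45\<close>; \<open>HASH\<close> applies the seeds at address \<open>40\<close> to \<open>38\<close>, result in \<open>42\<close>; \<open>WALK\<close>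
  does \<open>39\<close> steps from \<open>38\<close> with the seeds from address \<open>40\<close> on; \<open>CNT\<close> counts the pairs below
  the value at address \<open>4\<close> and the element in \<open>29\<close>, result in \<open>28\<close>.
\<close>

definition LESS :: com where
  "LESS =
     const 64 0 ;;
     IfLess 60 0
      (Ev 23 60 ;;
       IfLess 60 62 (const 64 1) Skip ;;
       For 66 6
        (add 67 23 66 ;; load 67 67 ;; add 68 61 66 ;; load 68 68 ;;
         IfLess 67 68 (const 64 1) (IfLess 68 67 (const 64 0) Skip)))
      Skip ;;
     mov 60 64"

definition LOC :: com where
  "LOC =
     const 50 0 ;; mov 53 14 ;;
     While 24 53
      (add 54 50 53 ;;
       IfLess 14 54 Skip
        (sub 55 54 7 ;; load 60 55 ;; mov 61 51 ;; mov 62 52 ;; LESS ;;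
         IfEq 60 7 (mov 50 54) Skip) ;;
       shr 53 53 7)"

definition GRP :: com where
  "GRP =
     IfLess 45 0
      (Ev 22 45 ;; mov 51 22 ;; add 52 45 7 ;; LOC ;; sub 45 50 7)
      (shr 45 45 11)"

definition HASH :: com where
  "HASH = load 42 40 ;; mul 42 42 38 ;; add 43 40 7 ;; load 43 43 ;; add 42 42 43"

definition WALK :: com where
  "WALK = For 41 39 (HASH ;; shr 45 42 12 ;; GRP ;; mov 38 45 ;; add 40 40 7 ;; add 40 40 7)"

definition DEDUP :: com where
  "DEDUP =
     const 38 0 ;;
     For 39 36 (add 40 21 39 ;; load 41 40 ;; IfEq 41 37 (mov 38 7) Skip) ;;
     IfEq 38 24 (add 40 21 36 ;; store 40 37 ;; add 36 36 7) Skip"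

definition TEST :: com where
  "TEST =
     IfLess 37 0
      (mov 45 37 ;; GRP ;;
       IfEq 45 30
        ((mov 60 37 ;; mov 61 4 ;; mov 62 29) ;; LESS ;; IfEq 60 7 DEDUP Skip)
        Skip)
      Skip"

definition TRY :: com where
  "TRY =
     (mov 38 30 ;; sub 39 10 35 ;; sub 39 39 7 ;; add 40 35 7 ;; add 40 40 40 ;; add 40 32 40) ;;
     WALK ;; HASH ;;
     (shr 42 42 13 ;; add 42 33 42 ;; load 38 42 ;; mov 39 35 ;; mov 40 32) ;;
     WALK ;; HASH ;; shr 37 42 12 ;; TEST"

definition CNT :: com where
  "CNT =
     (const 28 0 ;; mov 51 4 ;; mov 52 29) ;; LOC ;;
     IfLess 24 50
      ((sub 30 50 7 ;; const 36 0 ;; mov 32 14 ;; mov 33 19) ;;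
       For 34 17 (For 35 10 TRY ;; add 32 32 18 ;; add 33 33 16) ;;
       mul 28 30 10 ;; add 28 28 36)
      Skip"

section \<open>Program logic with time bounds\<close>

definition ok :: "nat \<Rightarrow> (nat \<Rightarrow> (nat \<times> nat list) option) \<Rightarrow> com \<Rightarrow> nat \<Rightarrow>
    (st \<Rightarrow> bool) \<Rightarrow> st \<Rightarrow> bool" where
  "ok W ev c B Q q \<longleftrightarrow> wp W ev c (\<lambda>t q'. t \<le> B \<and> Q q') q"

lemma ok_seq:
  "ok W ev c1 B1 R q \<Longrightarrow> (\<And>q'. R q' \<Longrightarrow> ok W ev c2 B2 Q q') \<Longrightarrow> B1 + B2 \<le> B \<Longrightarrow>
   ok W ev (c1 ;; c2) B Q q"
  unfolding ok_def wp_Seq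
  by (elim wp_mono) (fastforce elim!: wp_mono)

lemma ok_mono:
  "ok W ev c B Q q \<Longrightarrow> (\<And>q'. Q q' \<Longrightarrow> Q' q') \<Longrightarrow> B \<le> B' \<Longrightarrow> ok W ev c B' Q' q"
  unfolding ok_def by (elim wp_mono) auto

lemma ok_If:
  assumes "rg q p < rg q p' \<Longrightarrow> ok W ev c1 B Q q" "\<not> rg q p < rg q p' \<Longrightarrow> ok W ev c2 B Q q"
  shows "ok W ev (IfLess p p' c1 c2) (B + 2) Q q"
  using assms unfolding ok_def by (auto elim!: wp_mono)

lemma ok_IfEq:
  assumes "rg q p = rg q p' \<Longrightarrow> ok W ev c1 B Q q" "rg q p \<noteq> rg q p' \<Longrightarrow> ok W ev c2 B Q q"
  shows "ok W ev (IfEq p p' c1 c2) (B + 2) Q q"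
  using assms unfolding ok_def by (auto elim!: wp_mono)

lemma ok_for:
  assumes "I 0 (setr i 0 s)" "n < 2 ^ W"
    and "\<And>j s'. I j s' \<Longrightarrow> rg s' e = n \<and> rg s' 7 = 1"
    and "\<And>j s'. j < n \<Longrightarrow> rg s' i = j \<Longrightarrow> I j s' \<Longrightarrow>
      ok W ev c B (\<lambda>s''. rg s'' i = j \<and> rg s'' 7 = 1 \<and> I (Suc j) (setr i (Suc j) s'')) s'"
    and "n * (B + 3) + 3 \<le> B'"
  shows "ok W ev (For i e c) B' (I n) s"
  using wp_for[of I i s n W e ev c B] assms unfolding ok_def by (auto elim!: wp_mono)

section \<open>Numbers spread over several words\<close>

lemma mod_Suc_word:
  "(a::nat) mod 2 ^ (W * Suc j) = a mod 2 ^ (W * j) + 2 ^ (W * j) * (a div 2 ^ (W * j) mod 2 ^ W)"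
  using mod_mult2_eq[of a "2 ^ (W * j)" "2 ^ W"] by (simp add: power_add[symmetric] add.commute)

lemma lex_less:
  assumes "p < B" "p' < (B::nat)"
  shows "p + B * d < p' + B * d' \<longleftrightarrow> d < d' \<or> d = d' \<and> p < p'"
proof -
  consider "d < d'" | "d = d'" | "d' < d" by linarith
  then show ?thesis
  proof cases
    case 1
    then have "B * Suc d \<le> B * d'" by (intro mult_le_mono2) auto
    then show ?thesis using 1 assms by simp
  next
    case 3
    then have "B * Suc d' \<le> B * d" by (intro mult_le_mono2) auto
    then show ?thesis using 3 assms by simp
  qed simp
qed

lemma lex_eq:
  assumes "p < B" "p' < (B::nat)"
  shows "p + B * d = p' + B * d' \<longleftrightarrow> d = d' \<and> p = p'"
  using lex_less[OF assms, of d d'] lex_less[OF assms(2,1), of d' d] by (metis nat_neq_iff)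

lemma num_words_eq: "0 < W \<Longrightarrow> num_words W w = (w + W - 1) div W"
proof -
  assume W: "0 < W"
  have "\<lceil>real w / real W\<rceil> = int ((w + W - 1) div W)"
  proof (rule ceiling_unique)
    define k where "k = (w + W - 1) div W"
    have "k * W \<le> w + W - 1" "w + W - 1 < k * W + W"
      using W dividend_less_div_times[of W "w + W - 1"] div_times_less_eq_dividend[of "w + W - 1" W]
      by (auto simp: k_def algebra_simps)
    then have "k * W < w + W" "w \<le> k * W" using W by auto
    then have "real k * real W < real w + real W" "real w \<le> real k * real W"
      by (metis of_nat_add of_nat_less_iff of_nat_mult, metis of_nat_le_iff of_nat_mult)
    then show "of_int (int ((w + W - 1) div W)) - 1 < real w / real W"
      "real w / real W \<le> of_int (int ((w + W - 1) div W))"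
      using W unfolding k_def[symmetric] by (simp_all add: field_simps)
  qed
  then show ?thesis by (simp add: num_words_def)
qed

lemma num_words_ge: "0 < W \<Longrightarrow> w \<le> W * num_words W w"
  using dividend_less_div_times[of W "w + W - 1"] by (simp add: num_words_eq algebra_simps)

lemma num_words_le: "0 < W \<Longrightarrow> num_words W w \<le> w"
proof -
  assume W: "0 < W"
  have "w + W - 1 < Suc w * W" using W by (cases W) auto
  then show ?thesis using W by (simp add: num_words_eq less_mult_imp_div_less less_Suc_eq_le[symmetric])
qed

lemma length_encode [simp]: "length (encode W w v) = num_words W w"
  by (simp add: encode_def)

lemma encode_nth: "i < num_words W w \<Longrightarrow> encode W w v ! i = v div 2 ^ (W * i) mod 2 ^ W"
  by (simp add: encode_def)

text \<open>One word can address the data structure together with every work area, so that outside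
  the hash function arithmetic modulo \<open>2 ^ W\<close> is exact.\<close>

locale machine = inversion +
  assumes big: "D + 64 * V + 8 * nw + 8 * s + w + W + 64 \<le> 2 ^ W"
begin

lemma small [simp]: "k < 64 \<Longrightarrow> k mod 2 ^ W = (k::nat)"
  using big by simp

lemma W_pos [simp]: "0 < W" "W \<noteq> 0" "Suc 0 mod 2 ^ W = Suc 0"
  using pos_params(7) by auto

lemma sub_word [simp]:
  fixes x y :: nat
  assumes "y \<le> x" "x < 2 ^ W"
  shows "(x + 2 ^ W - y) mod 2 ^ W = x - y"
  unfolding diff_add_assoc2[OF assms(1)] using assms(2) by (simp add: less_imp_diff_less)

definition env :: "st \<Rightarrow> bool" where
  "env q \<longleftrightarrow> rg q 0 = N \<and> rg q 1 = w \<and> rg q 2 = W \<and> rg q 6 = nw \<and> rg q 7 = 1 \<and> rg q 8 = V \<and>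
     rg q 9 = n \<and> rg q 10 = s \<and> rg q 11 = sg \<and> rg q 12 = W - n \<and> rg q 13 = W - (n - 2 * sg) \<and>
     rg q 14 = Gs \<and> rg q 15 = m \<and> rg q 16 = Kq \<and> rg q 17 = r \<and> rg q 18 = cs \<and> rg q 19 = aT \<and>
     rg q 20 = D \<and> rg q 24 = 0"

lemma env_setr [simp]: "env q \<Longrightarrow> 25 \<le> k \<Longrightarrow> env (setr k v q)"
  by (simp add: env_def)

lemma env_set_mem [simp]: "env (setblk a ws q) = env q" "env (setm a v q) = env q"
  by (simp_all add: env_def)

lemma env_keeps: "env q \<Longrightarrow> keeps h X q q' \<Longrightarrow> 25 \<le> h \<Longrightarrow> env q'"
  by (simp add: env_def keeps_def)

lemma env_simps [simp]:
  assumes "env q"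
  shows "rg q 0 = N" "rg q (Suc 0) = w" "rg q 2 = W" "rg q 6 = nw" "rg q 7 = 1" "rg q 8 = V"
    "rg q 9 = n" "rg q 10 = s" "rg q 11 = sg" "rg q 12 = W - n" "rg q 13 = W - (n - 2 * sg)"
    "rg q 14 = Gs" "rg q 15 = m" "rg q 16 = Kq" "rg q 17 = r" "rg q 18 = cs" "rg q 19 = aT"
    "rg q 20 = D" "rg q 24 = 0"
  using assms by (simp_all add: env_def)

section \<open>Correctness of comparison, location and group computation\<close>

definition num_at :: "nat \<Rightarrow> nat \<Rightarrow> st \<Rightarrow> bool" where
  "num_at a y q \<longleftrightarrow> (\<forall>i<nw. mm q (a + i) = y div 2 ^ (W * i) mod 2 ^ W)"

lemma num_at_keeps: "num_at a y q \<Longrightarrow> keeps h X q q' \<Longrightarrow> a + nw \<le> X \<Longrightarrow> num_at a y q'"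
  by (simp add: num_at_def keeps_def)

lemma mod_words: "y < 2 ^ w \<Longrightarrow> y mod 2 ^ (W * nw) = (y::nat)"
proof -
  assume "y < 2 ^ w"
  also have "(2::nat) ^ w \<le> 2 ^ (W * nw)"
    using num_words_ge[OF pos_params(7)] by (simp add: nw_def)
  finally show ?thesis by simp
qed

definition "B_less = \<tau> + 15 * nw + 20"

text \<open>Words come least significant first, so a later word that differs overrides the verdict
  so far. The flag starts with the comparison of \<open>u\<close> and \<open>z\<close>, which
  thereby decides ties.\<close>

lemma LESS_spec:
  assumes "env q" "rg q 23 = X" "rg q 60 = u" "rg q 61 = a" "rg q 62 = z"
    and num: "num_at a y q" and y: "y < 2 ^ w" and X: "a + nw \<le> X" "X + nw < 2 ^ W"
  shows "wp W ev LESS (\<lambda>t q'. t \<le> B_less \<and> keeps 60 X q q' \<and>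
           rg q' 60 = (if less u y z then 1 else 0)) q"
proof (cases "u < N")
  case False
  then show ?thesis using assms by (simp add: LESS_def keeps_def less_def B_less_def)
next
  case True
  obtain t where t: "t \<le> \<tau>" "ev u = Some (t, encode W w (f u))" using ev[OF True] by auto
  define R where "R j \<longleftrightarrow> f u mod 2 ^ (W * j) < y mod 2 ^ (W * j) \<or>
      f u mod 2 ^ (W * j) = y mod 2 ^ (W * j) \<and> u < z" for j
  define I where "I j q' \<longleftrightarrow> keeps 64 X q q' \<and> num_at X (f u) q' \<and>
      rg q' 64 = (if R j then 1 else 0)" for j q'
  define body where "body = add 67 23 66 ;; load 67 67 ;; add 68 61 66 ;; load 68 68 ;;
         IfLess 67 68 (const 64 1) (IfLess 68 67 (const 64 0) Skip)"
  have step: "R (Suc j) \<longleftrightarrow> f u div 2 ^ (W * j) mod 2 ^ W < y div 2 ^ (W * j) mod 2 ^ W \<or>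
      f u div 2 ^ (W * j) mod 2 ^ W = y div 2 ^ (W * j) mod 2 ^ W \<and> R j" for j
    unfolding R_def mod_Suc_word by (subst lex_less lex_eq, simp, simp)+ auto
  have "wp W ev (For 66 6 body) (\<lambda>t q'. t \<le> nw * (10 + 3) + 3 \<and> I nw q') q1"
    if q1: "I 0 q1" for q1
  proof (rule wp_for)
    show "I 0 (setr 66 0 q1)" using q1 by (simp add: I_def keeps_def num_at_def)
    show "nw < 2 ^ W" using X by simp
  next
    fix j q' assume "I j q'"
    then have "env q'" using env_keeps[OF assms(1)] by (auto simp: I_def)
    then show "rg q' 6 = nw \<and> rg q' 7 = 1" by simp
  next
    fix j q' assume j: "j < nw" "rg q' 66 = j" "I j q'"
    have "env q'" using env_keeps[OF assms(1)] j by (auto simp: I_def)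
    have "rg q' 23 = X" "rg q' 61 = a" "rg q' 7 = 1" "mm q' (a + j) = y div 2 ^ (W * j) mod 2 ^ W"
      "mm q' (X + j) = f u div 2 ^ (W * j) mod 2 ^ W" "X + j < 2 ^ W" "a + j < 2 ^ W"
      using j assms \<open>env q'\<close> by (auto simp: I_def keeps_def num_at_def)
    then show "wp W ev body (\<lambda>t q''. t \<le> 10 \<and> rg q'' 66 = j \<and> rg q'' 7 = 1 \<and>
        I (Suc j) (setr 66 (Suc j) q'')) q'"
      using j unfolding body_def
      by (auto simp: I_def step keeps_def num_at_def)
  qed
  note loop = this
  have "wp W ev (Ev 23 60 ;; IfLess 60 62 (const 64 1) Skip ;; For 66 6 body)
     (\<lambda>t q'. t \<le> \<tau> + 15 * nw + 10 \<and> I nw q') (setr 64 0 q)"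
    unfolding wp_Seq
  proof (rule wp_Ev)
    show "ev (rg (setr 64 0 q) 60) = Some (t, encode W w (f u))" using t assms by simp
    let ?q = "setblk (rg (setr 64 0 q) 23) (encode W w (f u)) (setr 64 0 q)"
    have I0: "I 0 (setr 64 (if u < z then 1 else 0) ?q)"
      using assms by (auto simp: I_def keeps_def num_at_def R_def nw_def[symmetric] encode_nth)
    \<comment> \<open>Register 64 is 0 already, so the \<open>Skip\<close> branch ends in the state
      that writing a 0 would give.\<close>
    have "setr 64 0 ?q = ?q" by (simp add: setblk_def setr_def fun_upd_idem)
    then have *: "wp W ev (For 66 6 body) (\<lambda>t q'. t \<le> nw * (10 + 3) + 3 \<and> I nw q')
        (if u < z then setr 64 1 ?q else ?q)"
      using loop[OF I0] by (cases "u < z") (simp_all only: if_True if_False)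
    show "wp W ev (IfLess 60 62 (const 64 1) Skip) (\<lambda>t1. wp W ev (For 66 6 body)
       (\<lambda>t2 q'. 1 + t + length (encode W w (f u)) + (t1 + t2) \<le> \<tau> + 15 * nw + 10 \<and> I nw q')) ?q"
      using * t(1) assms(3,5) by (cases "u < z") (auto elim!: wp_mono simp: nw_def[symmetric])
  qed
  note main = this
  have "R nw \<longleftrightarrow> less u y z"
    using True mod_words[OF f_less[OF True]] mod_words[OF y] by (auto simp: R_def less_def)
  then have fin: "I nw q' \<Longrightarrow> keeps 60 X q (setr 60 v q') \<and>
      rg q' 64 = (if less u y z then 1 else 0)" for q' v
    by (auto simp: I_def keeps_def)
  have "u < rg q 0" using True assms(1) by simp
  then show ?thesis
    unfolding LESS_def body_def[symmetric]
    using assms(3) fin by (auto simp: B_less_def intro!: wp_mono[OF main[unfolded wp_Seq]]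
        elim!: wp_mono)
qed

lemma drop_bit_pow: "drop_bit (Suc 0) (2 ^ k :: nat) = (if k = 0 then 0 else 2 ^ (k - 1))"
  by (cases k) (auto simp: drop_bit_eq_div)

definition "B_loc = (n + 1) * (B_less + 24) + 5"

text \<open>\<open>loc y z\<close> stays in a window of \<open>2 ^ k\<close> candidates, and
  register 53 holds half its width. At width 1 the step has been shifted down to 0, which ends the
  loop.\<close>

lemma LOC_spec:
  assumes "env q" "rg q 23 = X" "rg q 51 = a" "rg q 52 = z"
    and num: "num_at a y q" and y: "y < 2 ^ w" and X: "a + nw \<le> X" "X + nw < 2 ^ W" "Gs \<le> X"
    and smp: "\<forall>g<Gs. mm q g = smp g"
  shows "wp W ev LOC (\<lambda>t q'. t \<le> B_loc \<and> keeps 50 X q q' \<and> rg q' 50 = loc y z) q"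
proof -
  define I where "I k q' \<longleftrightarrow> k \<le> n - sg + 1 \<and> keeps 50 X q q' \<and> rg q' 51 = a \<and> rg q' 52 = z \<and>
     rg q' 53 = (if k = 0 then 0 else 2 ^ (k - 1)) \<and>
     rg q' 50 \<le> loc y z \<and> loc y z < rg q' 50 + 2 ^ k" for k q'
  define body where "body = add 54 50 53 ;;
       IfLess 14 54 Skip
        (sub 55 54 7 ;; load 60 55 ;; mov 61 51 ;; mov 62 52 ;; LESS ;;
         IfEq 60 7 (mov 50 54) Skip) ;;
       shr 53 53 7"
  have step: "wp W ev body (\<lambda>t q''. t \<le> B_less + 20 \<and> I k q'') q'" if I: "I (Suc k) q'" for k q'
  proof -
    define c where "c = rg q' 50"
    have "2 ^ k \<le> Gs" using I by (auto simp: I_def Gs_def)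
    moreover have "c \<le> Gs" using I loc_le[of y z] by (auto simp: I_def c_def)
    ultimately have c: "c + 2 ^ k < 2 ^ W" "c + 2 ^ k \<le> Gs + Gs" using big Gs_le_V by auto
    have e: "env q'" using I assms(1) env_keeps by (auto simp: I_def)
    have r: "rg q' 14 = Gs" "rg q' 7 = 1" "rg q' 53 = 2 ^ k" "rg q' 50 = c" "rg q' 51 = a"
        "rg q' 52 = z" "c \<le> loc y z" "loc y z < c + 2 * 2 ^ k" "rg q' 23 = X" "k \<le> n - sg + 1"
      using I e assms(2) by (auto simp: I_def c_def keeps_def)
    show ?thesis
    proof (cases "Gs < c + 2 ^ k")
      \<comment> \<open>A probe past the last sample is skipped; \<open>loc y z \<le> Gs\<close>
        tells its outcome.\<close>
      case True
      then show ?thesis unfolding body_def using r c loc_le[of y z] I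
        by (auto simp: I_def keeps_def drop_bit_pow)
    next
      case False
      define q1 where "q1 = setr 62 z (setr 61 a (setr 60 (mm q' (c + 2 ^ k - 1))
         (setr 55 (c + 2 ^ k - 1) (setr 54 (c + 2 ^ k) q'))))"
      have q1: "wp W ev LESS (\<lambda>t q''. t \<le> B_less \<and> keeps 60 X q1 q'' \<and>
           rg q'' 60 = (if less (mm q' (c + 2 ^ k - 1)) y z then 1 else 0)) q1"
        using e r X num_at_keeps[OF num, of 50 X q'] I y
        by (intro LESS_spec[where a=a]) (auto simp: q1_def num_at_def I_def)
      have "c + 2 ^ k - 1 < Gs" using False pos_params(3) by simp
      \<comment> \<open>Sample indices start at 0: the one at \<open>c + 2 ^ k - 1\<close> is below
        the boundary iff at least \<open>c + 2 ^ k\<close> samples are.\<close>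
      then have less: "less (mm q' (c + 2 ^ k - 1)) y z \<longleftrightarrow> c + 2 ^ k \<le> loc y z"
        using I smp X less_smp_iff[of "c + 2 ^ k - 1" y z] by (auto simp: I_def keeps_def)
      have post: "wp W ev (IfEq 60 7 (mov 50 54) Skip ;; shr 53 53 7) (\<lambda>t q3. t \<le> 5 \<and> I k q3) q''"
        if "keeps 60 X q1 q''" "rg q'' 60 = (if less (mm q' (c + 2 ^ k - 1)) y z then 1 else 0)" for q''
      proof -
        have r': "rg q'' 7 = 1" "rg q'' 53 = 2 ^ k" "rg q'' 54 = c + 2 ^ k" "rg q'' 50 = c"
            "rg q'' 51 = a" "rg q'' 52 = z" and kp: "keeps 50 X q q''"
          using that(1) r I by (simp_all add: keeps_def q1_def I_def)
        then have "I k (setr 53 (drop_bit (Suc 0) (2 ^ k))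
            (if c + 2 ^ k \<le> loc y z then setr 50 (c + 2 ^ k) q'' else q''))"
          using r by (simp add: I_def drop_bit_pow keeps_def)
        then show ?thesis using that(2)[unfolded less] r' by (simp split: if_splits)
      qed
      have "wp W ev LESS (\<lambda>t. wp W ev (IfEq 60 7 (mov 50 54) Skip ;; shr 53 53 7)
          (\<lambda>t' q3. t + t' \<le> B_less + 5 \<and> I k q3)) q1"
        by (rule wp_mono[OF q1]) (use post in \<open>blast intro: wp_mono add_mono elim!: wp_mono\<close>)
      then have "wp W ev LESS (\<lambda>t. wp W ev (IfEq 60 7 (mov 50 54) Skip ;; shr 53 53 7)
          (\<lambda>t' q3. 8 + t + t' \<le> B_less + 20 \<and> I k q3)) q1"
        by (elim wp_mono) auto
      then show ?thesis unfolding body_def using False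
        by (auto simp: r c(1) q1_def sub_word[of 1 "c + 2 ^ k", simplified] Suc_le_eq elim!: wp_mono)
    qed
  qed
  have "wp W ev (While 24 53 body) (\<lambda>t q'. t \<le> (n - sg + 1) * (B_less + 20 + 2) + 2 \<and> I 0 q')
      (setr 53 Gs (setr 50 0 q))"
  proof (rule wp_while)
    show "I (n - sg + 1) (setr 53 Gs (setr 50 0 q))"
    proof -
      \<comment> \<open>The first step is \<open>Gs\<close>; the window of width
        \<open>2 * Gs\<close> contains all possible values from 0 to \<open>Gs\<close>.\<close>
      have "loc y z < Gs + Gs" using loc_le[of y z] pos_params(3) by (simp add: add_strict_increasing)
      also have "Gs + Gs = 2 ^ (n - sg + 1)" by (simp add: Gs_def)
      finally show ?thesis using assms by (simp add: I_def keeps_def Gs_def)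
    qed
  next
    fix k q' assume I: "I (Suc k) q'"
    then have "env q'" using env_keeps[OF assms(1)] by (auto simp: I_def)
    then have "rg q' 24 = 0" by simp
    then show "rg q' 24 < rg q' 53 \<and> wp W ev body (\<lambda>t q''. t \<le> B_less + 20 \<and> I k q'') q'"
      using step I by (auto simp: I_def)
  next
    fix q' assume "I 0 q'" then show "\<not> rg q' 24 < rg q' 53" by (simp add: I_def)
  qed
  note main = this
  have "(n - sg + 1) * (B_less + 20 + 2) \<le> (n + 1) * (B_less + 24)"
    by (intro mult_le_mono) auto
  then show ?thesis unfolding LOC_def body_def[symmetric]
    using assms(1) by (auto simp: B_loc_def I_def intro!: wp_mono[OF main])
qed

definition "B_grp = \<tau> + nw + B_loc + 10"

text \<open>A real element is located through its value and the bound \<open>x + 1\<close>, by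
  \<open>G_eq_loc\<close>; for padding \<open>pos x = x\<close>, so that a shift by
  \<open>sg\<close> bits gives the group.\<close>

lemma GRP_spec:
  assumes "env q" "rg q 23 = X1" "rg q 22 = X2" "rg q 45 = x" "X2 + nw \<le> X1" "X1 + nw < 2 ^ W"
     "Gs \<le> X2" "x < V"
    and smp: "\<forall>g<Gs. mm q g = smp g"
  shows "wp W ev GRP (\<lambda>t q'. t \<le> B_grp \<and> keeps 45 X2 q q' \<and> rg q' 45 = G x) q"
proof (cases "x < N")
  case False
  then show ?thesis using assms
    by (simp add: GRP_def keeps_def B_grp_def G_def pos_def s_def drop_bit_eq_div)
next
  case True
  obtain t where t: "t \<le> \<tau>" "ev x = Some (t, encode W w (f x))" using ev[OF True] by auto
  define q1 where "q1 = setr 52 (x + 1) (setr 51 X2 (setblk X2 (encode W w (f x)) q))"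
  have q1: "wp W ev LOC (\<lambda>t q'. t \<le> B_loc \<and> keeps 50 X1 q1 q' \<and> rg q' 50 = loc (f x) (x + 1)) q1"
    using assms f_less[OF True]
    by (intro LOC_spec[where a=X2])
       (auto simp: q1_def num_at_def nw_def[symmetric] encode_nth)
  have x: "x + 1 < 2 ^ W" using assms big by simp
  have l: "loc (f x) (Suc x) < 2 ^ W" using loc_le[of "f x" "Suc x"] Gs_le_V big by simp
  have l0: "0 < loc (f x) (Suc x)" 
    using less_loc_iff[of 0 "f x" "Suc x"] P_Suc[OF True] by simp
  have "wp W ev LOC (\<lambda>t' q'. t + t' \<le> B_grp - nw - 6 \<and> keeps 45 X2 q (setr 45 (G x) q') \<and>
      rg q' 50 = loc (f x) (Suc x) \<and> rg q' 7 = 1) q1"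
    using assms(1,5) t(1)
    by (intro wp_mono[OF q1]) (auto simp: keeps_def q1_def B_grp_def)
  then have "wp W ev LOC (\<lambda>t' q'. wp W ev (sub 45 50 7) (\<lambda>t2 q'. t + (nw + (t' + t2)) + 5 \<le> B_grp \<and>
      keeps 45 X2 q q' \<and> rg q' 45 = G x) q') q1"
    by (rule wp_mono) (use l l0 in \<open>auto simp: G_eq_loc[OF True] B_grp_def\<close>)
  then show ?thesis
    unfolding GRP_def
    using assms(1,3,4) True t(2) x by (auto intro!: wp_Ev simp: q1_def nw_def[symmetric] elim!: wp_mono)
qed

lemma HASH_ok:
  assumes "env q" "rg q 40 = p" "rg q 38 = g" "p + 1 < 2 ^ W"
  shows "ok W ev HASH 5 (\<lambda>q'. keeps 42 X q q' \<and> mm q' = mm q \<and> rg q' 42 = hsh (mm q) p g) q"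
  using assms by (simp add: HASH_def ok_def hsh_def mod_add_left_eq)

definition "B_walk = s * (B_grp + 20) + 3"

definition "B_dedup = s * 20 + 20"

definition "B_test = B_grp + B_less + B_dedup + 20"

definition "B_try = 2 * B_walk + B_test + 40"

definition "B_cnt = B_loc + r * (s * (B_try + 3) + 8) + 20"

definition "B_find = (n + 1) * (B_cnt + 10) + 10"

end

text \<open>\<open>M\<close> stands for the memory image at the start of a query and
  \<open>y\<close> for the queried value. Only the samples are assumed correct; coverage comes in
  later as \<open>good M\<close>.\<close>

locale query = machine +
  fixes M :: "nat \<Rightarrow> nat" and y :: nat
  assumes y: "y < 2 ^ w" and M_smp: "\<And>g. g < Gs \<Longrightarrow> M g = smp g"
begin

text \<open>Work areas behind the data structure and up to two arguments: the list of found
  elements, a buffer for the value of an element being located, and one for the value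
  \<open>LESS\<close> compares. Locating calls \<open>LESS\<close>, so the two buffers are live
  together.\<close>

definition "X3 = D + 2 * nw"
definition "X2 = X3 + s"
definition "X1 = X2 + nw"

definition qenv :: "st \<Rightarrow> bool" where
  "qenv q \<longleftrightarrow> env q \<and> rg q 4 = D \<and> rg q 21 = X3 \<and> rg q 22 = X2 \<and> rg q 23 = X1 \<and>
     (\<forall>a<D. mm q a = M a) \<and> num_at D y q"

lemma X_less: "D \<le> X3" "X3 \<le> X2" "X2 \<le> X1" "D + nw \<le> X3" "D + 2 * nw \<le> X3" "X2 + nw \<le> X1"
   "X1 + nw < 2 ^ W" "X3 + s \<le> X2" "Gs \<le> D" "aT \<le> D" "X3 + s < 2 ^ W" "Gs < 2 ^ W"
   "aT + r * Kq \<le> D" "Gs + r * cs \<le> aT" "V < 2 ^ W" "D < 2 ^ W"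
  using big Gs_le_V by (simp_all add: X1_def X2_def X3_def aT_def D_def)

lemma qenv_setr [simp]: "qenv q \<Longrightarrow> 25 \<le> k \<Longrightarrow> qenv (setr k v q)"
  by (simp add: qenv_def num_at_def)

lemma qenv_keeps: "qenv q \<Longrightarrow> keeps h X q q' \<Longrightarrow> 25 \<le> h \<Longrightarrow> X3 \<le> X \<Longrightarrow> qenv q'"
  using X_less env_keeps[of q h X q'] num_at_keeps[of D y q h X q']
  by (auto simp: qenv_def keeps_def)

lemma qenvD [simp]:
  assumes "qenv q"
  shows "env q" "rg q 4 = D" "rg q 21 = X3" "rg q 22 = X2" "rg q 23 = X1"
    "num_at D y q" "a < D \<Longrightarrow> mm q a = M a"
  using assms by (simp_all add: qenv_def)

lemma GRP_ok:
  assumes "qenv q" "rg q 45 = x" "x < V"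
  shows "ok W ev GRP B_grp (\<lambda>q'. keeps 45 X2 q q' \<and> rg q' 45 = G x) q"
  unfolding ok_def
  using assms X_less by (intro GRP_spec[where ?X1.0=X1]) (auto simp: M_smp)

lemma WALK_ok:
  assumes q: "qenv q" "rg q 38 = g" "rg q 39 = l" "rg q 40 = p" "p + 2 * l < D" "l \<le> s"
  shows "ok W ev WALK B_walk (\<lambda>q'. keeps 38 X2 q q' \<and> rg q' 38 = walk M p l g \<and>
           rg q' 40 = p + 2 * l) q"
proof -
  define I where "I j q' \<longleftrightarrow> keeps 38 X2 q q' \<and> rg q' 39 = l \<and> rg q' 38 = walk M p j g \<and>
     rg q' 40 = p + 2 * j" for j q'
  have "ok W ev WALK B_walk (I l) q"
    unfolding WALK_def
  proof (rule ok_for)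
    show "I 0 (setr 41 0 q)" using q by (simp add: I_def)
    show "l < 2 ^ W" by (rule order.strict_trans[OF _ X_less(16)]) (use q(5) in simp)
    show "l * (B_grp + 9 + 3) + 3 \<le> B_walk"
      using mult_le_mono[OF q(6), of "B_grp + 12" "B_grp + 20"] by (simp add: B_walk_def ac_simps)
  next
    fix j q' assume "I j q'"
    then have "qenv q'" using qenv_keeps[OF q(1)] X_less by (auto simp: I_def)
    then show "rg q' 39 = l \<and> rg q' 7 = 1" using \<open>I j q'\<close> by (simp add: I_def)
  next
    fix j q' assume j: "j < l" "rg q' 41 = j" "I j q'"
    then have q': "qenv q'" using qenv_keeps[OF q(1)] X_less by (auto simp: I_def)
    have p: "p + 2 * j + 1 < D" "p + 2 * j + 2 < 2 ^ W" using j q X_less by auto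
    define x where "x = xv M (p + 2 * j) (walk M p j g)"
    show "ok W ev (HASH ;; shr 45 42 12 ;; GRP ;; mov 38 45 ;; add 40 40 7 ;; add 40 40 7) (B_grp + 9)
       (\<lambda>q''. rg q'' 41 = j \<and> rg q'' 7 = 1 \<and> I (Suc j) (setr 41 (Suc j) q'')) q'"
    proof (rule ok_seq[OF HASH_ok[where X=X2]])
      show "env q'" "rg q' 40 = p + 2 * j" "rg q' 38 = walk M p j g" "p + 2 * j + 1 < 2 ^ W"
        using q' j p by (auto simp: I_def)
      fix q1 assume q1: "keeps 42 X2 q' q1 \<and> mm q1 = mm q' \<and> rg q1 42 = hsh (mm q') (p + 2 * j) (walk M p j g)"
      then have e1: "qenv q1" using qenv_keeps[OF q'] X_less by auto
      have h: "rg q1 42 = hsh M (p + 2 * j) (walk M p j g)" using q1 q' p by (simp add: hsh_def)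
      have k1: "keeps 41 X2 q' (setr 45 x q1)" using q1 by (simp add: keeps_def)
      show "ok W ev (shr 45 42 12 ;; GRP ;; mov 38 45 ;; add 40 40 7 ;; add 40 40 7) (B_grp + 4)
         (\<lambda>q''. rg q'' 41 = j \<and> rg q'' 7 = 1 \<and> I (Suc j) (setr 41 (Suc j) q'')) q1"
      proof (rule ok_seq[where ?B1.0=1 and R="\<lambda>q2. q2 = setr 45 x q1"])
        show "ok W ev (shr 45 42 12) 1 (\<lambda>q2. q2 = setr 45 x q1) q1"
          using e1 h by (simp add: ok_def x_def xv_def)
        fix q2 assume q2: "q2 = setr 45 x q1"
        show "ok W ev (GRP ;; mov 38 45 ;; add 40 40 7 ;; add 40 40 7) (B_grp + 3)
         (\<lambda>q''. rg q'' 41 = j \<and> rg q'' 7 = 1 \<and> I (Suc j) (setr 41 (Suc j) q'')) q2"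
        proof (rule ok_seq[OF GRP_ok])
          show "qenv q2" "rg q2 45 = x" "x < V" using q2 e1 by (simp_all add: x_def xv_less)
          fix q3 assume q3: "keeps 45 X2 q2 q3 \<and> rg q3 45 = G x"
          then have e3: "qenv q3" using qenv_keeps[of q2 45 X2 q3] \<open>qenv q2\<close> X_less by auto
          have kk: "keeps 41 X2 q' q3" "rg q3 41 = j" using k1 q3 q2 q1 j(2) by (auto simp: keeps_def)
          then have "rg q3 40 = p + 2 * j" "keeps 38 X2 q q3" "rg q3 39 = l"
            using j(3) by (auto simp: I_def keeps_def)
          then show "ok W ev (mov 38 45 ;; add 40 40 7 ;; add 40 40 7) 3
             (\<lambda>q''. rg q'' 41 = j \<and> rg q'' 7 = 1 \<and> I (Suc j) (setr 41 (Suc j) q'')) q3"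
            using e3 q3 p kk(2) by (simp add: ok_def I_def x_def)
        qed simp
      qed simp
    qed simp
  qed
  then show ?thesis by (rule ok_mono) (auto simp: I_def)
qed

end

section \<open>Collecting the boundary group\<close>

context query
begin

definition list_at :: "nat list \<Rightarrow> st \<Rightarrow> bool" where
  "list_at xs q \<longleftrightarrow> (\<forall>l<length xs. mm q (X3 + l) = xs ! l)"

lemma list_at_keeps: "list_at xs q \<Longrightarrow> keeps h X q q' \<Longrightarrow> X3 + length xs \<le> X \<Longrightarrow> list_at xs q'"
  by (simp add: list_at_def keeps_def)

lemma list_at_setr [simp]: "list_at xs (setr k v q) = list_at xs q"
  by (simp add: list_at_def)

text \<open>A linear scan is affordable: the list holds at most \<open>s\<close> elements of one
  group, and a probe walks about \<open>s\<close> steps anyway.\<close>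

lemma DEDUP_ok:
  assumes q: "qenv q" "rg q 36 = length xs" "rg q 37 = x" "list_at xs q" "length xs \<le> s"
  shows "ok W ev DEDUP B_dedup (\<lambda>q'. keeps 36 X3 q q' \<and>
           (let xs' = (if x \<in> set xs then xs else xs @ [x])
            in rg q' 36 = length xs' \<and> list_at xs' q')) q"
proof -
  define c where "c = length xs"
  define I where "I j q' \<longleftrightarrow> keeps 38 X2 q q' \<and> rg q' 38 = (if x \<in> set (take j xs) then 1 else 0)" for j q'
  have c: "c \<le> s" "X3 + c < 2 ^ W" "c < 2 ^ W" using q(5) X_less(11) by (auto simp: c_def)
  define body where "body = add 40 21 39 ;; load 41 40 ;; IfEq 41 37 (mov 38 7) Skip"
  have loop: "ok W ev (For 39 36 body) (c * 8 + 3) (I c) (setr 38 0 q)"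
  proof (rule ok_for)
    show "I 0 (setr 39 0 (setr 38 0 q))" using q by (simp add: I_def)
    show "c < 2 ^ W" by (rule c)
    show "c * (5 + 3) + 3 \<le> c * 8 + 3" by simp
  next
    fix j q' assume "I j q'"
    then have "qenv q'" using qenv_keeps[OF q(1)] X_less by (auto simp: I_def)
    then show "rg q' 36 = c \<and> rg q' 7 = 1" using \<open>I j q'\<close> q by (simp add: I_def keeps_def c_def)
  next
    fix j q' assume j: "j < c" "rg q' 39 = j" "I j q'"
    then have q': "qenv q'" using qenv_keeps[OF q(1)] X_less by (auto simp: I_def)
    have "rg q' 37 = x" using j q by (simp add: I_def keeps_def)
    moreover have "mm q' (X3 + j) = xs ! j"
      using list_at_keeps[OF q(4), of 38 X2 q'] j q(5) X_less(8) by (auto simp: I_def c_def list_at_def)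
    moreover have "X3 + j < 2 ^ W" using c j by simp
    moreover have "set (take (Suc j) xs) = insert (xs ! j) (set (take j xs))"
      using j by (simp add: take_Suc_conv_app_nth c_def)
    ultimately show "ok W ev body 5
       (\<lambda>s''. rg s'' 39 = j \<and> rg s'' 7 = 1 \<and> I (Suc j) (setr 39 (Suc j) s'')) q'"
      using j q' by (auto simp: ok_def body_def I_def)
  qed
  show ?thesis unfolding DEDUP_def body_def[symmetric]
  proof (rule ok_seq[where R="\<lambda>q'. q' = setr 38 0 q" and ?B1.0=1])
    show "ok W ev (const 38 0) 1 (\<lambda>q'. q' = setr 38 0 q) q" by (simp add: ok_def)
    show "ok W ev (For 39 36 body ;; IfEq 38 24 (add 40 21 36 ;; store 40 37 ;; add 36 36 7) Skip)
        (c * 8 + 8) (\<lambda>q'. keeps 36 X3 q q' \<and> (let xs' = (if x \<in> set xs then xs else xs @ [x])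
            in rg q' 36 = length xs' \<and> list_at xs' q')) q'" if "q' = setr 38 0 q" for q'
      unfolding that
    proof (rule ok_seq[OF loop])
      fix q1 assume q1: "I c q1"
      have e: "qenv q1" using qenv_keeps[OF q(1)] q1 X_less by (auto simp: I_def)
      have f: "rg q1 36 = c" "rg q1 37 = x" "rg q1 38 = (if x \<in> set xs then 1 else 0)" "list_at xs q1"
        "keeps 36 X3 q q1"
        using q1 q list_at_keeps[OF q(4), of 38 X2 q1] X_less
        by (auto simp: I_def keeps_def c_def keeps_def)
      show "ok W ev (IfEq 38 24 (add 40 21 36 ;; store 40 37 ;; add 36 36 7) Skip) 5
        (\<lambda>q'. keeps 36 X3 q q' \<and> (let xs' = (if x \<in> set xs then xs else xs @ [x])
            in rg q' 36 = length xs' \<and> list_at xs' q')) q1"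
      proof (cases "x \<in> set xs")
        case True
        then show ?thesis using f e by (simp add: ok_def c_def)
      next
        case False
        have "Suc c \<le> X3 + s" using c(1) X_less(1,9) pos_params(3) by linarith
        then have "Suc c < 2 ^ W" using X_less(11) by (rule order.strict_trans1)
        then show ?thesis using False f e c
          by (auto simp: ok_def keeps_def list_at_def nth_append c_def)
      qed
    qed simp
  next
    have "c * 8 \<le> s * 20" using c by simp
    then show "1 + (c * 8 + 8) \<le> B_dedup" by (simp add: B_dedup_def)
  qed
qed

lemma LESS_ok:
  assumes "qenv q" "rg q 60 = u" "rg q 61 = D" "rg q 62 = z"
  shows "ok W ev LESS B_less (\<lambda>q'. keeps 60 X1 q q' \<and> rg q' 60 = (if less u y z then 1 else 0)) q"
  unfolding ok_def using assms X_less y by (intro LESS_spec[where a=D]) auto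

definition target :: "nat \<Rightarrow> nat \<Rightarrow> nat set" where
  "target g z = {u. less u y z \<and> G u = g}"

text \<open>Hides the order of discovery. Confining \<open>S\<close> to one group keeps the list
  within the \<open>s\<close> cells reserved for it.\<close>

definition collected :: "nat \<Rightarrow> nat set \<Rightarrow> st \<Rightarrow> bool" where
  "collected g S q \<longleftrightarrow> (\<exists>xs. distinct xs \<and> set xs = S \<and> S \<subseteq> {u. u < V \<and> G u = g} \<and>
     rg q 36 = length xs \<and> list_at xs q)"

lemma length_le_s:
  assumes "distinct xs" "set xs \<subseteq> {u. u < V \<and> G u = g}" "g < Gs"
  shows "length xs \<le> s"
proof -
  have "card (set xs) \<le> card {u. u < V \<and> G u = g}"
    by (rule card_mono) (use assms in auto)
  then show ?thesis using assms G_fibre by (simp add: distinct_card)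
qed

lemma collected_keeps:
  assumes "collected g S q" "keeps h X q q'" "g < Gs" "X2 \<le> X" "36 < h"
  shows "collected g S q'"
proof -
  obtain xs where xs: "distinct xs" "set xs = S" "S \<subseteq> {u. u < V \<and> G u = g}"
    "rg q 36 = length xs" "list_at xs q"
    using assms(1) by (auto simp: collected_def)
  then have "length xs \<le> s" using length_le_s assms(3) by blast
  then have "list_at xs q'" using xs(5) assms X_less(8) by (auto intro: list_at_keeps)
  then show ?thesis using xs assms by (auto simp: collected_def keeps_def intro!: exI[of _ xs])
qed

lemma collected_setr [simp]: "k \<noteq> 36 \<Longrightarrow> collected g S (setr k v q) = collected g S q"
  by (simp add: collected_def)

text \<open>Probes may return arbitrary elements; checking the group and the bound keeps false
  alarms out of the list.\<close>

lemma TEST_ok: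
  assumes q: "qenv q" "rg q 29 = z" "rg q 30 = g" "g < Gs" "rg q 37 = x" "x < V" "collected g S q"
  shows "ok W ev TEST B_test (\<lambda>q'. keeps 36 X3 q q' \<and>
           collected g (S \<union> ({x} \<inter> target g z)) q') q"
  unfolding TEST_def
proof (rule ok_mono[OF ok_If])
  assume "\<not> rg q 37 < rg q 0"
  then show "ok W ev Skip (B_test - 2)
      (\<lambda>q'. keeps 36 X3 q q' \<and> collected g (S \<union> ({x} \<inter> target g z)) q') q"
    using q by (simp add: ok_def target_def less_def)
next
  assume xN: "rg q 37 < rg q 0"
  let ?Q = "\<lambda>q'. keeps 36 X3 q q' \<and> collected g (S \<union> ({x} \<inter> target g z)) q'"
  have B: "B_test - 2 = 1 + (B_grp + (B_less + B_dedup + 17))" by (simp add: B_test_def)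
  show "ok W ev (mov 45 37 ;; GRP ;; IfEq 45 30
        ((mov 60 37 ;; mov 61 4 ;; mov 62 29) ;; LESS ;; IfEq 60 7 DEDUP Skip) Skip) (B_test - 2) ?Q q"
    unfolding B
  proof (rule ok_seq[where R="\<lambda>q'. q' = setr 45 x q"])
    show "ok W ev (mov 45 37) 1 (\<lambda>q'. q' = setr 45 x q) q" using q by (simp add: ok_def)
    fix q1 assume q1: "q1 = setr 45 x q"
    then have e1: "qenv q1" using q by simp
    show "ok W ev (GRP ;; IfEq 45 30 ((mov 60 37 ;; mov 61 4 ;; mov 62 29) ;; LESS ;;
          IfEq 60 7 DEDUP Skip) Skip) (B_grp + (B_less + B_dedup + 17)) ?Q q1"
    proof (rule ok_seq[OF GRP_ok])
      show "qenv q1" "rg q1 45 = x" "x < V" using e1 q1 q by simp_all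
      fix q2 assume q2: "keeps 45 X2 q1 q2 \<and> rg q2 45 = G x"
      have e2: "qenv q2" using qenv_keeps[OF e1] q2 X_less by auto
      have r2: "rg q2 37 = x" "rg q2 29 = z" "rg q2 30 = g" "rg q2 45 = G x"
        using q2 q1 q by (simp_all add: keeps_def)
      have k2: "keeps 36 X3 q q2" using q1 q2 X_less by (auto simp: keeps_def)
      have c2: "collected g S q2" using collected_keeps[of g S q1 45 X2 q2] q1 q2 q by auto
      show "ok W ev (IfEq 45 30 ((mov 60 37 ;; mov 61 4 ;; mov 62 29) ;; LESS ;;
          IfEq 60 7 DEDUP Skip) Skip) (B_less + B_dedup + 17) ?Q q2"
      proof (rule ok_mono[OF ok_IfEq])
        assume "rg q2 45 \<noteq> rg q2 30"
        then show "ok W ev Skip (B_less + B_dedup + 10) ?Q q2"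
          using k2 c2 r2 by (simp add: ok_def target_def)
      next
        assume G: "rg q2 45 = rg q2 30"
        define q3 where "q3 = setr 62 z (setr 61 D (setr 60 x q2))"
        show "ok W ev ((mov 60 37 ;; mov 61 4 ;; mov 62 29) ;; LESS ;; IfEq 60 7 DEDUP Skip)
          (B_less + B_dedup + 10) ?Q q2"
        proof (rule ok_seq[where R="\<lambda>q'. q' = q3"])
          show "ok W ev (mov 60 37 ;; mov 61 4 ;; mov 62 29) 3 (\<lambda>q'. q' = q3) q2"
            using e2 r2 by (simp add: ok_def q3_def)
          show "ok W ev (LESS ;; IfEq 60 7 DEDUP Skip) (B_less + B_dedup + 3) ?Q q'" if "q' = q3" for q'
            unfolding that
          proof (rule ok_seq[OF LESS_ok])
            show "qenv q3" "rg q3 60 = x" "rg q3 61 = D" "rg q3 62 = z"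
              using e2 by (simp_all add: q3_def)
            fix q4 assume q4: "keeps 60 X1 q3 q4 \<and> rg q4 60 = (if less x y z then 1 else 0)"
            have e4: "qenv q4" using qenv_keeps[OF \<open>qenv q3\<close>] q4 X_less by auto
            have r4: "rg q4 37 = x" using r2 q4 by (simp add: q3_def keeps_def)
            have k4: "keeps 36 X3 q q4" using k2 q4 X_less by (auto simp: keeps_def q3_def)
            have c4: "collected g S q4"
              using collected_keeps[of g S q3 60 X1 q4] c2 q4 q X_less by (auto simp: q3_def)
            then obtain xs where xs: "distinct xs" "set xs = S" "S \<subseteq> {u. u < V \<and> G u = g}"
              "rg q4 36 = length xs" "list_at xs q4" by (auto simp: collected_def)
            show "ok W ev (IfEq 60 7 DEDUP Skip) (B_dedup + 2) ?Q q4"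
            proof (rule ok_IfEq)
              assume "rg q4 60 \<noteq> rg q4 7"
              moreover have "rg q4 7 = 1" using e4 by simp
              ultimately have "\<not> less x y z" using q4 by (simp split: if_splits)
              then show "ok W ev Skip B_dedup ?Q q4"
                using k4 c4 by (simp add: ok_def target_def)
            next
              assume "rg q4 60 = rg q4 7"
              moreover have "rg q4 7 = 1" using e4 by simp
              ultimately have "rg q4 60 = 1" by simp
              then have l: "less x y z" using q4 by (cases "less x y z") simp_all
              show "ok W ev DEDUP B_dedup ?Q q4"
              proof (rule ok_mono[OF DEDUP_ok])
                show "qenv q4" "rg q4 36 = length xs" "rg q4 37 = x" "list_at xs q4" by fact+
                show "length xs \<le> s" using length_le_s[of xs g] xs q by simp
                fix q5 assume q5: "keeps 36 X3 q4 q5 \<and> (let xs' = (if x \<in> set xs then xs else xs @ [x])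
                    in rg q5 36 = length xs' \<and> list_at xs' q5)"
                have "x \<in> target g z" using l G r2 by (simp add: target_def)
                moreover have "x < V" "G x = g" using q G r2 by auto
                ultimately have "collected g (S \<union> ({x} \<inter> target g z)) q5"
                  unfolding collected_def using q5 xs
                  by (intro exI[of _ "if x \<in> set xs then xs else xs @ [x]"]) (auto simp: Let_def)
                then show "?Q q5" using k4 q5 by (auto simp: keeps_def)
              qed simp
            qed
          qed simp
        qed simp
      qed simp_all
    qed simp
  qed simp
qed (simp_all add: B_test_def)

text \<open>The table contents are arbitrary here: a meaningless slot is just another start, whose
  chain still produces an element below \<open>V\<close> for \<open>TEST\<close> to judge.\<close>

lemma TRY_ok:
  assumes q: "qenv q" "rg q 29 = z" "rg q 30 = g" "g < Gs" "rg q 32 = Gs + i * cs"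
    "rg q 33 = aT + i * Kq" "rg q 35 = k" "i < r" "k < s" "collected g S q"
  shows "ok W ev TRY B_try (\<lambda>q'. keeps 36 X3 q q' \<and>
           collected g (S \<union> ({probe M i k g} \<inter> target g z)) q') q"
proof -
  let ?Q = "\<lambda>q'. keeps 36 X3 q q' \<and> collected g (S \<union> ({probe M i k g} \<inter> target g z)) q'"
  define p where "p = Gs + i * cs"
  have "Suc i * cs \<le> r * cs" using q(8) by (intro mult_le_mono1) simp
  then have p: "p + cs \<le> aT" "aT \<le> D" "D < 2 ^ W" using X_less by (auto simp: p_def)
  have pk: "p + 2 * s + 2 \<le> aT" using p(1) by (simp add: cs_def)
  have "Suc i * Kq \<le> r * Kq" using q(8) by (intro mult_le_mono1) simp
  then have t: "aT + i * Kq + Kq \<le> D" using X_less by auto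
  have bounds: "p + 2 * s + 2 \<le> D" "s + s < 2 ^ W" "s < 2 ^ W" "p < 2 ^ W" "\<And>v. v \<le> D \<Longrightarrow> v < 2 ^ W"
    using pk p by auto
  define p1 where "p1 = p + 2 * (k + 1)"
  define a where "a = walk M p1 (s - k - 1) g"
  define key where "key = kv M (p + 2 * s) a"
  define j where "j = M (aT + i * Kq + key)"
  define b where "b = walk M p k j"
  have pr: "probe M i k g = xv M (p + 2 * k) b"
    by (simp add: probe_def p_def p1_def a_def key_def j_def b_def Let_def)
  have key: "aT + i * Kq + key < D" using t kv_less[of M "p + 2 * s" a] by (simp add: key_def)
  \<comment> \<open>Completing the walk leads to the seeds behind the last column, which hash chain
    ends to slots.\<close>
  have ps: "p1 + 2 * (s - k - 1) = p + 2 * s" using q(9) by (simp add: p1_def)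
  have bl: "Suc k \<le> s" "Suc k < 2 ^ W" "Suc k + Suc k \<le> 2 * s" "2 * s < 2 ^ W" 
     "p + (Suc k + Suc k) < 2 ^ W" "k \<le> s"
    using q(9) bounds by auto
  define q1 where "q1 = setr 40 p1 (setr 39 (s - k - 1) (setr 38 g q))"
  have e1: "qenv q1" using q by (simp add: q1_def)
  have step1: "ok W ev (mov 38 30 ;; sub 39 10 35 ;; sub 39 39 7 ;; add 40 35 7 ;;
      add 40 40 40 ;; add 40 32 40) 6 (\<lambda>q'. q' = q1) q"
  proof -
    have "s - k < 2 ^ W" "Suc 0 \<le> s - k" using bounds bl by auto
    then show ?thesis using q bl bounds sub_word[of 1 "s - k"] sub_word[of k s]
      by (simp add: ok_def q1_def p1_def p_def setr_def fun_upd_twist mult_2)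
  qed
  show ?thesis unfolding TRY_def
  proof (rule ok_seq[OF step1, where ?B2.0="2 * B_walk + B_test + 16"], hypsubst)
    show "ok W ev (WALK ;; HASH ;; (shr 42 42 13 ;; add 42 33 42 ;; load 38 42 ;; mov 39 35 ;; mov 40 32) ;;
       WALK ;; HASH ;; shr 37 42 12 ;; TEST) (2 * B_walk + B_test + 16) ?Q q1"
    proof (rule ok_seq[OF WALK_ok, where ?B2.0="B_walk + B_test + 16"])
      show "qenv q1" "rg q1 38 = g" "rg q1 39 = s - k - 1" "rg q1 40 = p1" by (fact e1, simp_all add: q1_def)
      show "p1 + 2 * (s - k - 1) < D" "s - k - 1 \<le> s" using bounds ps by auto
      fix q2 assume q2: "keeps 38 X2 q1 q2 \<and> rg q2 38 = walk M p1 (s - k - 1) g \<and>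
           rg q2 40 = p1 + 2 * (s - k - 1)"
      have e2: "qenv q2" using qenv_keeps[OF e1] q2 X_less by auto
      show "ok W ev (HASH ;; (shr 42 42 13 ;; add 42 33 42 ;; load 38 42 ;; mov 39 35 ;; mov 40 32) ;;
       WALK ;; HASH ;; shr 37 42 12 ;; TEST) (B_walk + B_test + 16) ?Q q2"
      proof (rule ok_seq[OF HASH_ok, where ?B2.0="B_walk + B_test + 11"])
        show "env q2" "rg q2 40 = p + 2 * s" "rg q2 38 = a" "p + 2 * s + 1 < 2 ^ W"
          using e2 q2 ps bounds by (auto simp: a_def)
        fix q3 assume q3: "keeps 42 X2 q2 q3 \<and> mm q3 = mm q2 \<and> rg q3 42 = hsh (mm q2) (p + 2 * s) a"
        have e3: "qenv q3" using qenv_keeps[OF e2] q3 X_less by auto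
        have h3: "drop_bit (W - (n - 2 * sg)) (rg q3 42) = key"
          using q3 e2 bounds by (simp add: key_def kv_def hsh_def)
        have k3: "keeps 38 X2 q1 q3" using q2 q3 by (auto simp: keeps_def)
        then have r3: "rg q3 33 = aT + i * Kq" "rg q3 35 = k" "rg q3 32 = p"
          using q by (simp_all add: keeps_def q1_def p_def)
        define q4 where "q4 = setr 40 p (setr 39 k (setr 38 j (setr 42 (aT + i * Kq + key) q3)))"
        have e4: "qenv q4" using e3 by (simp add: q4_def)
        show "ok W ev ((shr 42 42 13 ;; add 42 33 42 ;; load 38 42 ;; mov 39 35 ;; mov 40 32) ;;
         WALK ;; HASH ;; shr 37 42 12 ;; TEST) (B_walk + B_test + 11) ?Q q3"
        proof (rule ok_seq[where R="\<lambda>q'. q' = q4" and ?B1.0=5 and ?B2.0="B_walk + B_test + 6"])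
          have "aT + i * Kq + key < 2 ^ W" using key bounds by simp
          then show "ok W ev (shr 42 42 13 ;; add 42 33 42 ;; load 38 42 ;; mov 39 35 ;; mov 40 32) 5
             (\<lambda>q'. q' = q4) q3"
            using e3 h3 r3 key by (simp add: ok_def q4_def j_def setr_def)
          show "ok W ev (WALK ;; HASH ;; shr 37 42 12 ;; TEST) (B_walk + B_test + 6) ?Q q'"
            if "q' = q4" for q' unfolding that
          proof (rule ok_seq[OF WALK_ok, where ?B2.0="B_test + 6"])
            show "qenv q4" "rg q4 38 = j" "rg q4 39 = k" "rg q4 40 = p" by (fact e4, simp_all add: q4_def)
            show "p + 2 * k < D" "k \<le> s" using bounds bl by auto
            fix q5 assume q5: "keeps 38 X2 q4 q5 \<and> rg q5 38 = walk M p k j \<and> rg q5 40 = p + 2 * k"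
            have e5: "qenv q5" using qenv_keeps[OF e4] q5 X_less by auto
            show "ok W ev (HASH ;; shr 37 42 12 ;; TEST) (B_test + 6) ?Q q5"
            proof (rule ok_seq[OF HASH_ok, where ?B2.0="B_test + 1"])
              show "env q5" "rg q5 40 = p + 2 * k" "rg q5 38 = b" "p + 2 * k + 1 < 2 ^ W"
                using e5 q5 bounds bl by (auto simp: b_def)
              fix q6 assume q6: "keeps 42 X2 q5 q6 \<and> mm q6 = mm q5 \<and> rg q6 42 = hsh (mm q5) (p + 2 * k) b"
              have e6: "qenv q6" using qenv_keeps[OF e5] q6 X_less by auto
              have h6: "drop_bit (W - n) (rg q6 42) = probe M i k g"
                using q6 e5 bounds bl by (simp add: pr xv_def hsh_def)
              have k6: "keeps 37 X2 q q6"
                using k3 q5 q6 by (auto simp: keeps_def q1_def q4_def)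
              define q7 where "q7 = setr 37 (probe M i k g) q6"
              have e7: "qenv q7" using e6 by (simp add: q7_def)
              have k7: "keeps 37 X2 q q7" using k6 by (simp add: q7_def)
              show "ok W ev (shr 37 42 12 ;; TEST) (B_test + 1) ?Q q6"
              proof (rule ok_seq[where R="\<lambda>q'. q' = q7" and ?B1.0=1 and ?B2.0=B_test])
                show "ok W ev (shr 37 42 12) 1 (\<lambda>q'. q' = q7) q6"
                  using e6 h6 by (simp add: ok_def q7_def)
                show "ok W ev TEST B_test ?Q q'" if "q' = q7" for q' unfolding that
                proof (rule ok_mono[OF TEST_ok])
                  show "qenv q7" "rg q7 29 = z" "rg q7 30 = g" "rg q7 37 = probe M i k g" "g < Gs"
                    using e7 k7 q by (simp_all add: keeps_def) (simp add: q7_def)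
                  show "probe M i k g < V" unfolding pr by (rule xv_less)
                  show "collected g S q7"
                    using collected_keeps[OF q(10) k7 q(4)] by simp
                  fix q8 assume "keeps 36 X3 q7 q8 \<and> collected g (S \<union> {probe M i k g} \<inter> target g z) q8"
                  then show "?Q q8" using k7 X_less by (auto simp: keeps_def)
                qed simp
              qed simp
            qed simp
          qed simp
        qed simp
      qed simp
    qed simp
  qed (simp add: B_try_def)
qed

definition found :: "nat \<Rightarrow> nat \<Rightarrow> nat \<Rightarrow> nat set" where
  "found g z i = (\<Union>i'<i. \<Union>k<s. {probe M i' k g} \<inter> target g z)"

lemma ROW_ok:
  assumes q: "qenv q" "rg q 29 = z" "rg q 30 = g" "g < Gs" "rg q 32 = Gs + i * cs"
    "rg q 33 = aT + i * Kq" "rg q 34 = i" "i < r" "collected g (found g z i) q"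
  shows "ok W ev (For 35 10 TRY) (s * (B_try + 3) + 3) (\<lambda>q'. keeps 35 X3 q q' \<and>
           collected g (found g z (Suc i)) q') q"
proof -
  define J where "J k q' \<longleftrightarrow> keeps 35 X3 q q' \<and>
     collected g (found g z i \<union> (\<Union>k'<k. {probe M i k' g} \<inter> target g z)) q'" for k q'
  have "ok W ev (For 35 10 TRY) (s * (B_try + 3) + 3) (J s) q"
  proof (rule ok_for)
    show "J 0 (setr 35 0 q)" using q
      by (simp add: J_def collected_def list_at_def)
    show "s < 2 ^ W" using X_less by auto
  next
    fix k q' assume "J k q'"
    then have "qenv q'" using qenv_keeps[OF q(1)] by (auto simp: J_def)
    then show "rg q' 10 = s \<and> rg q' 7 = 1" by simp
  next
    fix k q' assume k: "k < s" "rg q' 35 = k" "J k q'"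
    have q': "qenv q'" using qenv_keeps[OF q(1)] k by (auto simp: J_def)
    show "ok W ev TRY B_try
       (\<lambda>q''. rg q'' 35 = k \<and> rg q'' 7 = 1 \<and> J (Suc k) (setr 35 (Suc k) q'')) q'"
    proof (rule ok_mono[OF TRY_ok])
      show "qenv q'" "g < Gs" "rg q' 35 = k" "i < r" "k < s"
        "collected g (found g z i \<union> (\<Union>k'<k. {probe M i k' g} \<inter> target g z)) q'"
        using q' q k by (auto simp: J_def)
      show "rg q' 29 = z" "rg q' 30 = g" "rg q' 32 = Gs + i * cs" "rg q' 33 = aT + i * Kq"
        using k q by (auto simp: J_def keeps_def)
    next
      fix q'' assume q'': "keeps 36 X3 q' q'' \<and> collected g (found g z i \<union>
         (\<Union>k'<k. {probe M i k' g} \<inter> target g z) \<union> {probe M i k g} \<inter> target g z) q''"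
      have "(found g z i \<union> (\<Union>k'<Suc k. {probe M i k' g} \<inter> target g z)) =
         found g z i \<union> (\<Union>k'<k. {probe M i k' g} \<inter> target g z) \<union> {probe M i k g} \<inter> target g z"
        by (auto simp: lessThan_Suc)
      moreover have "qenv q''" using q'' qenv_keeps[OF q'] by auto
      ultimately show "rg q'' 35 = k \<and> rg q'' 7 = 1 \<and> J (Suc k) (setr 35 (Suc k) q'')"
        using q'' k by (auto simp: J_def keeps_def collected_def list_at_def)
    qed simp
  qed simp
  moreover have "found g z i \<union> (\<Union>k'<s. {probe M i k' g} \<inter> target g z) = found g z (Suc i)"
    by (auto simp: found_def lessThan_Suc)
  ultimately show ?thesis by (auto elim!: ok_mono simp: J_def)
qed

text \<open>Coverage is used here: it makes the probes find every pair of the boundary group below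
  \<open>(y, z)\<close>. As \<open>TEST\<close> admits nothing else, the length of the list is the
  summand missing in \<open>P_eq_loc\<close>.\<close>

lemma CNT_ok:
  assumes q: "qenv q" "rg q 29 = z" and good: "good M"
  shows "ok W ev CNT B_cnt (\<lambda>q'. keeps 28 X3 q q' \<and> rg q' 28 = P y z) q"
proof -
  let ?Q = "\<lambda>q'. keeps 28 X3 q q' \<and> rg q' 28 = P y z"
  define q1 where "q1 = setr 52 z (setr 51 D (setr 28 0 q))"
  have e1: "qenv q1" using q by (simp add: q1_def)
  let ?loop = "For 34 17 (For 35 10 TRY ;; add 32 32 18 ;; add 33 33 16)"
  have main: "ok W ev ((sub 30 50 7 ;; const 36 0 ;; mov 32 14 ;; mov 33 19) ;; ?loop ;;
       mul 28 30 10 ;; add 28 28 36) (r * (s * (B_try + 3) + 8) + 9) ?Q q2"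
    if q2: "keeps 50 X1 q1 q2" "rg q2 50 = loc y z" and pos: "0 < loc y z" for q2
  proof -
    define g where "g = loc y z - 1"
    have g: "g < Gs" "g < 2 ^ W" using pos loc_le[of y z] X_less by (auto simp: g_def)
    have e2: "qenv q2" using qenv_keeps[OF e1] q2 X_less by auto
    have r2: "rg q2 29 = z" "rg q2 28 = 0" using q2 q by (auto simp: q1_def keeps_def)
    have k2: "keeps 28 X3 q q2" using q2 X_less by (auto simp: q1_def keeps_def)
    define q3 where "q3 = setr 33 aT (setr 32 Gs (setr 36 0 (setr 30 g q2)))"
    have e3: "qenv q3" using e2 by (simp add: q3_def)
    define I where "I i q' \<longleftrightarrow> keeps 31 X3 q3 q' \<and> rg q' 32 = Gs + i * cs \<and> rg q' 33 = aT + i * Kq \<and>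
      collected g (found g z i) q'" for i q'
    have loop: "ok W ev ?loop (r * (s * (B_try + 3) + 8) + 3) (I r) q3"
    proof (rule ok_for)
      have "collected g {} q3" by (auto simp: collected_def q3_def list_at_def)
      then show "I 0 (setr 34 0 q3)"
        by (simp add: I_def q3_def found_def)
      show "r < 2 ^ W"
      proof -
        have "r * 1 \<le> r * cs" by (intro mult_le_mono2) (simp add: cs_def)
        then have "r \<le> D" using X_less(10,14) by linarith
        then show ?thesis using X_less(16) by (rule order.strict_trans1)
      qed
    next
      fix i q' assume "I i q'"
      then have "qenv q'" using qenv_keeps[OF e3] by (auto simp: I_def)
      then show "rg q' 17 = r \<and> rg q' 7 = 1" by simp
    next
      fix i q' assume i: "i < r" "rg q' 34 = i" "I i q'"
      have q': "qenv q'" using qenv_keeps[OF e3] i by (auto simp: I_def)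
      show "ok W ev (For 35 10 TRY ;; add 32 32 18 ;; add 33 33 16) (s * (B_try + 3) + 5)
         (\<lambda>s''. rg s'' 34 = i \<and> rg s'' 7 = 1 \<and> I (Suc i) (setr 34 (Suc i) s'')) q'"
      proof (rule ok_seq[OF ROW_ok, where ?B2.0=2])
        show "qenv q'" "g < Gs" "rg q' 32 = Gs + i * cs" "rg q' 33 = aT + i * Kq" "rg q' 34 = i" "i < r"
          "collected g (found g z i) q'"
          using q' g i by (auto simp: I_def)
        show "rg q' 29 = z" "rg q' 30 = g" using i r2 by (auto simp: I_def keeps_def q3_def)
        fix q'' assume q'': "keeps 35 X3 q' q'' \<and> collected g (found g z (Suc i)) q''"
        have e: "qenv q''" using qenv_keeps[OF q'] q'' by auto
        have r: "rg q'' 32 = Gs + i * cs" "rg q'' 33 = aT + i * Kq" "rg q'' 34 = i"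
          using q'' i by (auto simp: I_def keeps_def)
        have k: "keeps 31 X3 q3 q''" using q'' i by (auto simp: I_def keeps_def)
        have "Suc i * cs \<le> r * cs" "Suc i * Kq \<le> r * Kq" using i(1) by (intro mult_le_mono1; simp)+
        then have "Gs + i * cs + cs \<le> D" "aT + i * Kq + Kq \<le> D" using X_less by auto
        then have "Gs + i * cs + cs < 2 ^ W" "aT + i * Kq + Kq < 2 ^ W"
          using X_less(16) by (auto intro: order.strict_trans1)
        then show "ok W ev (add 32 32 18 ;; add 33 33 16) 2
           (\<lambda>s''. rg s'' 34 = i \<and> rg s'' 7 = 1 \<and> I (Suc i) (setr 34 (Suc i) s'')) q''"
          using e r k q'' by (simp add: ok_def I_def ac_simps)
      qed simp
    qed simp
    show ?thesis
    proof (rule ok_seq[where ?B1.0=4 and R="\<lambda>q'. q' = q3" and ?B2.0="r * (s * (B_try + 3) + 8) + 5"])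
      have "loc y z < 2 ^ W" using g pos loc_le[of y z] X_less(12) by (auto intro: order.strict_trans1)
      then show "ok W ev (sub 30 50 7 ;; const 36 0 ;; mov 32 14 ;; mov 33 19) 4 (\<lambda>q'. q' = q3) q2"
        using e2 q2 pos by (simp add: ok_def q3_def g_def Suc_le_eq)
      show "ok W ev (?loop ;; mul 28 30 10 ;; add 28 28 36) (r * (s * (B_try + 3) + 8) + 5) ?Q q'"
        if "q' = q3" for q' unfolding that
      proof (rule ok_seq[OF loop, where ?B2.0=2])
        fix q4 assume q4: "I r q4"
        have e4: "qenv q4" using qenv_keeps[OF e3] q4 by (auto simp: I_def)
        have "u \<in> found g z r" if u: "u \<in> target g z" for u
        proof -
          have "u < N" "G u = g" using u by (auto simp: target_def less_def)
          then obtain i k where "i < r" "k < s" "probe M i k g = u"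
            using good by (auto simp: good_def)
          then show ?thesis using u by (auto simp: found_def)
        qed
        then have "found g z r = target g z" by (auto simp: found_def)
        then have c: "rg q4 36 = card (target g z)"
          using q4 by (auto simp: I_def collected_def distinct_card[symmetric])
        have Peq: "P y z = g * s + card (target g z)"
          using P_eq_loc[OF pos] by (simp add: g_def target_def)
        have "P y z < 2 ^ W" using P_le[of y z] N_le_V X_less(15) by simp
        moreover from this have "g * s < 2 ^ W" by (simp add: Peq)
        moreover have "rg q4 30 = g" using q4 by (simp add: I_def q3_def keeps_def)
        moreover have "keeps 28 X3 q q4" using k2 q4 by (simp add: I_def q3_def keeps_def)
        ultimately show "ok W ev (mul 28 30 10 ;; add 28 28 36) 2 ?Q q4"
          using e4 c Peq by (simp add: ok_def)
      qed simp
    qed simp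
  qed
  show ?thesis unfolding CNT_def
  proof (rule ok_seq[where ?B1.0=3 and R="\<lambda>q'. q' = q1" and
      ?B2.0="B_loc + (r * (s * (B_try + 3) + 8) + 11)"])
    show "ok W ev (const 28 0 ;; mov 51 4 ;; mov 52 29) 3 (\<lambda>q'. q' = q1) q"
      using q by (simp add: ok_def q1_def)
    show "ok W ev (LOC ;; IfLess 24 50 ((sub 30 50 7 ;; const 36 0 ;; mov 32 14 ;; mov 33 19) ;; ?loop ;;
       mul 28 30 10 ;; add 28 28 36) Skip) (B_loc + (r * (s * (B_try + 3) + 8) + 11)) ?Q q'"
      if "q' = q1" for q' unfolding that
    proof (rule ok_seq[where R="\<lambda>q2. keeps 50 X1 q1 q2 \<and> rg q2 50 = loc y z" and ?B1.0=B_loc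
        and ?B2.0="r * (s * (B_try + 3) + 8) + 9 + 2"])
      show "ok W ev LOC B_loc (\<lambda>q2. keeps 50 X1 q1 q2 \<and> rg q2 50 = loc y z) q1"
        unfolding ok_def using q(1) e1 X_less y M_smp
        by (intro LOC_spec[where a=D]) (auto simp: q1_def)
      fix q2 assume q2: "keeps 50 X1 q1 q2 \<and> rg q2 50 = loc y z"
      have e2: "qenv q2" using qenv_keeps[OF e1] q2 X_less by auto
      show "ok W ev (IfLess 24 50 ((sub 30 50 7 ;; const 36 0 ;; mov 32 14 ;; mov 33 19) ;; ?loop ;;
       mul 28 30 10 ;; add 28 28 36) Skip) (r * (s * (B_try + 3) + 8) + 9 + 2) ?Q q2"
      proof (rule ok_If)
        assume "rg q2 24 < rg q2 50"
        then show "ok W ev ((sub 30 50 7 ;; const 36 0 ;; mov 32 14 ;; mov 33 19) ;; ?loop ;;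
           mul 28 30 10 ;; add 28 28 36) (r * (s * (B_try + 3) + 8) + 9) ?Q q2"
          using q2 e2 by (intro main) auto
      next
        assume "\<not> rg q2 24 < rg q2 50"
        then have "P y z = 0" using loc_eq_0 q2 e2 by simp
        then show "ok W ev Skip (r * (s * (B_try + 3) + 8) + 9) ?Q q2"
          using q2 X_less by (simp add: ok_def keeps_def q1_def)
      qed
    qed simp
  qed (simp add: B_cnt_def)
qed

end

text \<open>Doubling from 16 finds the least admissible \<open>n\<close>. Powers of 16 are compared
  with \<open>A + 1\<close> in register 27, which finds \<open>sg\<close> without extracting roots.
  The factor \<open>C\<close>, fixed by the failure probability, is built into the program.\<close>

definition INIT :: "nat \<Rightarrow> com" where
  "INIT C =
     (const 7 1 ;; const 24 0 ;; add 6 1 2 ;; sub 6 6 7 ;; Bas (Arith Div 6 6 2) ;;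
      const 8 16 ;; const 9 4) ;;
     While 8 0 (add 8 8 8 ;; add 9 9 7) ;;
     (const 10 1 ;; const 11 0 ;; const 25 16 ;; const 26 16 ;; add 27 3 7) ;;
     While 25 27 (mul 25 25 26 ;; add 10 10 10 ;; add 11 11 7) ;;
     (sub 12 2 9 ;; add 28 11 11 ;; sub 27 9 28 ;; sub 13 2 27) ;;
     (shr 14 8 11 ;; shr 16 8 28 ;; add 29 7 7 ;; shr 15 16 29) ;;
     (const 25 C ;; mul 17 25 10 ;; mul 17 17 9 ;; add 18 10 7 ;; add 18 18 18) ;;
     mul 19 17 18 ;; add 19 14 19 ;; mul 20 17 16 ;; add 20 19 20"

definition CLAMP :: com where
  "CLAMP =
     (add 26 4 6 ;; load 29 26 ;; IfLess 29 0 Skip (mov 29 0)) ;;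
     For 27 6 (add 25 26 27 ;; load 25 25 ;; IfLess 24 25 (IfLess 24 27 (mov 29 0) Skip) Skip)"

definition FIND :: com where
  "FIND =
     (const 26 0 ;; mov 27 8) ;;
     While 24 27
      (add 29 26 27 ;; CNT ;; IfLess 28 25 (add 26 26 27) Skip ;; shr 27 27 7)"

definition QSET :: com where
  "QSET = add 21 4 6 ;; add 21 21 6 ;; add 22 21 10 ;; add 23 22 6"

definition RANK :: "nat \<Rightarrow> com" where
  "RANK C = INIT C ;; QSET ;; CLAMP ;; CNT ;; (mov 26 28 ;; mov 29 24) ;; CNT ;; sub 0 26 28"

definition HILO :: com where
  "HILO = mov 29 0 ;; CNT ;; (mov 26 28 ;; mov 29 24) ;; CNT ;; sub 27 26 28"

definition SELECT :: "nat \<Rightarrow> com" where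
  "SELECT C = INIT C ;; QSET ;; HILO ;;
     IfLess 5 27 (sub 25 26 5 ;; FIND ;; (mov 1 26 ;; mov 0 7)) (mov 0 24)"

definition MEDIAN :: "nat \<Rightarrow> com" where
  "MEDIAN C = INIT C ;; QSET ;; HILO ;;
     IfLess 24 27
      ((sub 27 27 7 ;; shr 27 27 7 ;; add 25 28 27 ;; add 25 25 7) ;; FIND ;; (mov 1 26 ;; mov 0 7))
      (mov 0 24)"

section \<open>Computing the parameters\<close>

context machine
begin

definition "B_init = 20 * n + 60"

definition "B_sel = B_init + 2 * B_cnt + B_find + 40"

definition "B_rank = B_init + 12 * nw + 2 * B_cnt + 40"

lemma setr_same: "setr k v (setr k v' q) = setr k v q"
  by (simp add: setr_def)

lemma INIT_ok:
  assumes q: "rg q 0 = N" "rg q 1 = w" "rg q 2 = W" "rg q 3 = A"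
    and n: "\<And>k. 4 \<le> k \<Longrightarrow> N \<le> 2 ^ k \<Longrightarrow> n \<le> k"
    and A: "16 ^ sg \<le> A" "A < 16 ^ Suc sg" "A \<le> N"
  shows "ok W ev (INIT C) B_init (\<lambda>q'. env q' \<and> rg q' 4 = rg q 4 \<and> rg q' 5 = rg q 5 \<and>
           mm q' = mm q \<and> rnd q' = rnd q) q"
proof -
  define R where "R q' \<longleftrightarrow> rg q' 0 = N \<and> rg q' 1 = w \<and> rg q' 2 = W \<and> rg q' 3 = A \<and>
    rg q' 4 = rg q 4 \<and> rg q' 5 = rg q 5 \<and> rg q' 6 = nw \<and> rg q' 7 = 1 \<and> rg q' 24 = 0 \<and>
    mm q' = mm q \<and> rnd q' = rnd q" for q' :: st
  have V: "V \<le> 2 ^ W" "64 * V \<le> 2 ^ W" "w + W < 2 ^ W" "W < 2 ^ W" "0 < V" "A \<le> V" "D < 2 ^ W"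
    using big pos_params N_le_V A by simp_all
  have nV: "n < V" by (simp add: V_def)
  define I1 where "I1 k q' \<longleftrightarrow> R q' \<and> k \<le> n - 4 \<and> rg q' 9 = n - k \<and> rg q' 8 = 2 ^ (n - k)" for k q'
  have loop1: "ok W ev (While 8 0 (add 8 8 8 ;; add 9 9 7)) ((n - 4) * 4 + 2) (I1 0) q1"
    if q1: "I1 (n - 4) q1" for q1
    unfolding ok_def
  proof (rule wp_mono[OF wp_while[where I=I1 and k="n - 4" and B=2]])
    show "I1 (n - 4) q1" by (rule q1)
  next
    fix k q' assume k: "I1 (Suc k) q'"
    \<comment> \<open>Minimality of \<open>n\<close> keeps the loop running: a smaller exponent that
      is at least 4 cannot reach \<open>N\<close>.\<close>
    then have lt: "2 ^ (n - Suc k) < N" 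
      using n[of "n - Suc k"] n_ge by (force simp: I1_def not_less)
    have "Suc k \<le> n - 4" using k by (simp add: I1_def)
    then have sk: "n - k = Suc (n - Suc k)" by linarith
    have "(2::nat) ^ (n - k) = 2 * 2 ^ (n - Suc k)" by (simp add: sk)
    then show "rg q' 8 < rg q' 0 \<and> wp W ev (add 8 8 8 ;; add 9 9 7) (\<lambda>t s'. t \<le> 2 \<and> I1 k s') q'"
      using k lt V nV N_le_V n_ge sk[symmetric] by (simp add: I1_def R_def)
  next
    fix q' assume "I1 0 q'"
    then show "\<not> rg q' 8 < rg q' 0" using N_le_V by (simp add: I1_def R_def V_def)
  qed auto
  define I2 where "I2 k q' \<longleftrightarrow> R q' \<and> rg q' 9 = n \<and> rg q' 8 = V \<and> k \<le> sg \<and> rg q' 11 = sg - k \<and>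
      rg q' 10 = 2 ^ (sg - k) \<and> rg q' 25 = 16 ^ Suc (sg - k) \<and> rg q' 26 = 16 \<and> rg q' 27 = Suc A" for k q'
  have loop2: "ok W ev (While 25 27 (mul 25 25 26 ;; add 10 10 10 ;; add 11 11 7)) (sg * 5 + 2) (I2 0) q1"
    if q1: "I2 sg q1" for q1
    unfolding ok_def
  proof (rule wp_mono[OF wp_while[where I=I2 and k=sg and B=3]])
    show "I2 sg q1" by (rule q1)
  next
    fix k q' assume k: "I2 (Suc k) q'"
    have sk: "Suc (sg - Suc k) = sg - k" using k by (simp add: I2_def Suc_diff_Suc)
    have "(16::nat) ^ (sg - k) \<le> 16 ^ sg" by (intro power_increasing) auto
    from order.trans[OF this A(1)] have lt: "(16::nat) ^ (sg - k) \<le> A" .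
    have p: "(2::nat) ^ (sg - k) = 2 * 2 ^ (sg - Suc k)" "(16::nat) ^ Suc (sg - k) = 16 ^ (sg - k) * 16"
      by (simp_all add: sk[symmetric])
    have "(2::nat) ^ (sg - k) \<le> 16 ^ (sg - k)" by (intro power_mono) auto
    then have le: "(2::nat) ^ (sg - k) \<le> V" "(16::nat) ^ (sg - k) \<le> V" using lt V(6) by auto
    \<comment> \<open>The headroom of \<open>64 * V\<close> in \<open>big\<close> absorbs the last
      multiplication by 16.\<close>
    have "V < 2 ^ W" "V * 16 < 2 ^ W" using V by simp_all
    then have "2 ^ (sg - k) < (2::nat) ^ W" "16 ^ (sg - k) * 16 < (2::nat) ^ W"
      using le by (blast intro: order.strict_trans1 mult_le_mono1)+
    moreover have "sg - k < 2 ^ W"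
      using sg_le nV V by simp
    ultimately show "rg q' 25 < rg q' 27 \<and> wp W ev (mul 25 25 26 ;; add 10 10 10 ;; add 11 11 7)
        (\<lambda>t s'. t \<le> 3 \<and> I2 k s') q'"
      using k lt p by (simp add: I2_def R_def sk)
  next
    fix q' assume "I2 0 q'"
    then show "\<not> rg q' 25 < rg q' 27" using A by (simp add: I2_def R_def)
  qed auto
  have nwW: "(w + W - Suc 0) div W = nw"
    using num_words_eq[of W w] by (simp add: nw_def)
  show ?thesis unfolding INIT_def
  proof (rule ok_seq[where ?B1.0=7 and R="I1 (n - 4)" and ?B2.0="20 * n + 53"])
    show "ok W ev (const 7 1 ;; const 24 0 ;; add 6 1 2 ;; sub 6 6 7 ;; Bas (Arith Div 6 6 2) ;;
      const 8 16 ;; const 9 4) 7 (I1 (n - 4)) q"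
      using q V sub_word[of 1 "w + W"] nwW n_ge by (simp add: ok_def I1_def R_def Suc_le_eq)
    fix q1 assume q1: "I1 (n - 4) q1"
    show "ok W ev (While 8 0 (add 8 8 8 ;; add 9 9 7) ;;
     (const 10 1 ;; const 11 0 ;; const 25 16 ;; const 26 16 ;; add 27 3 7) ;;
     While 25 27 (mul 25 25 26 ;; add 10 10 10 ;; add 11 11 7) ;;
     (sub 12 2 9 ;; add 28 11 11 ;; sub 27 9 28 ;; sub 13 2 27) ;;
     (shr 14 8 11 ;; shr 16 8 28 ;; add 29 7 7 ;; shr 15 16 29) ;;
     (const 25 C ;; mul 17 25 10 ;; mul 17 17 9 ;; add 18 10 7 ;; add 18 18 18) ;;
     mul 19 17 18 ;; add 19 14 19 ;; mul 20 17 16 ;; add 20 19 20) (20 * n + 53)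
      (\<lambda>q'. env q' \<and> rg q' 4 = rg q 4 \<and> rg q' 5 = rg q 5 \<and> mm q' = mm q \<and> rnd q' = rnd q) q1"
    proof (rule ok_seq[OF loop1[OF q1], where ?B2.0="sg * 5 + 40"])
      fix q2 assume q2: "I1 0 q2"
      show "ok W ev ((const 10 1 ;; const 11 0 ;; const 25 16 ;; const 26 16 ;; add 27 3 7) ;;
     While 25 27 (mul 25 25 26 ;; add 10 10 10 ;; add 11 11 7) ;;
     (sub 12 2 9 ;; add 28 11 11 ;; sub 27 9 28 ;; sub 13 2 27) ;;
     (shr 14 8 11 ;; shr 16 8 28 ;; add 29 7 7 ;; shr 15 16 29) ;;
     (const 25 C ;; mul 17 25 10 ;; mul 17 17 9 ;; add 18 10 7 ;; add 18 18 18) ;;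
     mul 19 17 18 ;; add 19 14 19 ;; mul 20 17 16 ;; add 20 19 20) (sg * 5 + 40)
      (\<lambda>q'. env q' \<and> rg q' 4 = rg q 4 \<and> rg q' 5 = rg q 5 \<and> mm q' = mm q \<and> rnd q' = rnd q) q2"
      proof (rule ok_seq[where R="I2 sg" and ?B1.0=5 and ?B2.0="sg * 5 + 2 + 30"])
        have "Suc A < 2 ^ W" using V by simp
        then show "ok W ev (const 10 1 ;; const 11 0 ;; const 25 16 ;; const 26 16 ;; add 27 3 7) 5 (I2 sg) q2"
          using q2 by (simp add: ok_def I1_def I2_def R_def V_def)
        fix q3 assume q3: "I2 sg q3"
        show "ok W ev (While 25 27 (mul 25 25 26 ;; add 10 10 10 ;; add 11 11 7) ;;
     (sub 12 2 9 ;; add 28 11 11 ;; sub 27 9 28 ;; sub 13 2 27) ;;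
     (shr 14 8 11 ;; shr 16 8 28 ;; add 29 7 7 ;; shr 15 16 29) ;;
     (const 25 C ;; mul 17 25 10 ;; mul 17 17 9 ;; add 18 10 7 ;; add 18 18 18) ;;
     mul 19 17 18 ;; add 19 14 19 ;; mul 20 17 16 ;; add 20 19 20) (sg * 5 + 2 + 30)
      (\<lambda>q'. env q' \<and> rg q' 4 = rg q 4 \<and> rg q' 5 = rg q 5 \<and> mm q' = mm q \<and> rnd q' = rnd q) q3"
        proof (rule ok_seq[OF loop2[OF q3], where ?B2.0=30])
          fix q4 assume q4: "I2 0 q4"
          have r4: "rg q4 0 = N" "rg q4 (Suc 0) = w" "rg q4 2 = W" "rg q4 4 = rg q 4" "rg q4 5 = rg q 5"
            "rg q4 6 = nw" "rg q4 7 = 1" "rg q4 8 = V" "rg q4 9 = n" "rg q4 10 = s" "rg q4 11 = sg"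
            "rg q4 24 = 0" "mm q4 = mm q" "rnd q4 = rnd q"
            using q4 by (simp_all add: I2_def R_def s_def)
          have d: "drop_bit sg V = Gs" "drop_bit (sg + sg) V = Kq" "drop_bit (Suc (Suc (sg + sg))) V = m"
          proof -
            have "drop_bit k ((2::nat) ^ l) = 2 ^ (l - k)" if "k \<le> l" for k l
              using that by (simp add: drop_bit_eq_div power_diff)
            then show "drop_bit sg V = Gs" "drop_bit (sg + sg) V = Kq" "drop_bit (Suc (Suc (sg + sg))) V = m"
              using sg_le n_ge by (simp_all add: V_def Gs_def Kq_def m_def mult_2)
          qed
          \<comment> \<open>Every intermediate product is bounded by \<open>D\<close>, so none of
            them overflows.\<close>
          have "C * s * 1 \<le> C * s * n" "C * 1 \<le> C * s" "r * 1 \<le> r * cs" "cs * 1 \<le> cs * r"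
            using n_ge pos_params by (intro mult_le_mono2; simp add: cs_def Suc_le_eq)+
          moreover have "r * cs \<le> aT" "aT \<le> D" "r * Kq \<le> D" by (simp_all add: aT_def D_def)
          moreover have "C * s * n = r" "cs * r = r * cs" by (simp_all add: r_def)
          ultimately have le: "C \<le> D" "C * s \<le> D" "r \<le> D" "cs \<le> D" "r * cs \<le> D" "aT \<le> D" "r * Kq \<le> D"
            by linarith+
          then have lt: "C < 2 ^ W" "C * s < 2 ^ W" "r < 2 ^ W" "cs < 2 ^ W" "r * cs < 2 ^ W" "aT < 2 ^ W"
             "r * Kq < 2 ^ W"
            using V(7) order.strict_trans1 by blast+
          have e: "C * s * n = r" "aT = Gs + r * cs" "D = aT + r * Kq" "Suc s + Suc s = cs"
            by (simp_all add: r_def aT_def D_def cs_def)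
          have "Suc s < 2 ^ W" using lt(4) by (simp add: e(4)[symmetric])
          moreover have "n < 2 ^ W" "n \<le> W" "sg + sg \<le> n" "sg + sg < 2 ^ W" "n - (sg + sg) \<le> W"
            using nV V n_le_W sg_le by simp_all
          ultimately have b: "n < 2 ^ W" "n \<le> W" "sg + sg \<le> n" "sg + sg < 2 ^ W" "n - (sg + sg) \<le> W"
            "Suc s < 2 ^ W" by auto
          define p12 where "p12 = W - n"
          define p28 where "p28 = sg + sg"
          define p27 where "p27 = n - (sg + sg)"
          define p13 where "p13 = W - (n - (sg + sg))"
          define q5 where "q5 = setr 13 p13 (setr 27 p27 (setr 28 p28 (setr 12 p12 q4)))"
          define q6 where "q6 = setr 15 m (setr 29 2 (setr 16 Kq (setr 14 Gs q5)))"
          define q7 where "q7 = setr 18 cs (setr 17 r (setr 25 C q6))"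
          have r5: "rg q5 11 = sg" "rg q5 28 = sg + sg" "rg q5 8 = V" "rg q5 7 = 1"
            by (simp_all add: q5_def r4 p28_def)
          have r6: "rg q6 10 = s" "rg q6 9 = n" "rg q6 7 = 1"
            by (simp_all add: q5_def q6_def r4)
          have r7: "rg q7 18 = cs" "rg q7 17 = r" "rg q7 14 = Gs" "rg q7 16 = Kq"
            by (simp_all add: q5_def q6_def q7_def)
          have f: "(\<lambda>q'. env q' \<and> rg q' 4 = rg q 4 \<and> rg q' 5 = rg q 5 \<and> mm q' = mm q \<and> rnd q' = rnd q)
              (setr 20 D (setr 19 aT q7))"
            by (simp add: env_def q5_def q6_def q7_def r4 mult_2 p12_def p13_def del: env_simps)
          show "ok W ev ((sub 12 2 9 ;; add 28 11 11 ;; sub 27 9 28 ;; sub 13 2 27) ;;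
            (shr 14 8 11 ;; shr 16 8 28 ;; add 29 7 7 ;; shr 15 16 29) ;;
            (const 25 C ;; mul 17 25 10 ;; mul 17 17 9 ;; add 18 10 7 ;; add 18 18 18) ;;
            mul 19 17 18 ;; add 19 14 19 ;; mul 20 17 16 ;; add 20 19 20) 30
            (\<lambda>q'. env q' \<and> rg q' 4 = rg q 4 \<and> rg q' 5 = rg q 5 \<and> mm q' = mm q \<and> rnd q' = rnd q) q4"
          proof (rule ok_seq[where ?B1.0=4 and R="\<lambda>q'. q' = q5" and ?B2.0=26])
            show "ok W ev (sub 12 2 9 ;; add 28 11 11 ;; sub 27 9 28 ;; sub 13 2 27) 4 (\<lambda>q'. q' = q5) q4"
            proof -
              have "(sg + sg) mod 2 ^ W = p28" using b(4) unfolding p28_def by (rule mod_less)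
              moreover have "(W + 2 ^ W - n) mod 2 ^ W = p12" using b V(4) unfolding p12_def by (intro sub_word)
              moreover have "(n + 2 ^ W - p28) mod 2 ^ W = p27"
                using b unfolding p28_def p27_def by (intro sub_word)
              moreover have "(W + 2 ^ W - p27) mod 2 ^ W = p13"
                using b V(4) unfolding p27_def p13_def by (intro sub_word)
              ultimately show ?thesis
                unfolding ok_def q5_def wp_Seq wp_simps eval_binop.simps setr_sel
                by (simp add: r4)
            qed
            show "ok W ev ((shr 14 8 11 ;; shr 16 8 28 ;; add 29 7 7 ;; shr 15 16 29) ;;
              (const 25 C ;; mul 17 25 10 ;; mul 17 17 9 ;; add 18 10 7 ;; add 18 18 18) ;;
              mul 19 17 18 ;; add 19 14 19 ;; mul 20 17 16 ;; add 20 19 20) 26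
              (\<lambda>q'. env q' \<and> rg q' 4 = rg q 4 \<and> rg q' 5 = rg q 5 \<and> mm q' = mm q \<and> rnd q' = rnd q) q'"
              if "q' = q5" for q' unfolding that
            proof (rule ok_seq[where ?B1.0=4 and R="\<lambda>q'. q' = q6" and ?B2.0=22])
              have "Suc (Suc 0) mod 2 ^ W = 2" using small[of 2] by (simp add: numeral_2_eq_2)
              then show "ok W ev (shr 14 8 11 ;; shr 16 8 28 ;; add 29 7 7 ;; shr 15 16 29) 4 (\<lambda>q'. q' = q6) q5"
                by (simp add: ok_def q6_def r5 d numeral_2_eq_2)
              show "ok W ev ((const 25 C ;; mul 17 25 10 ;; mul 17 17 9 ;; add 18 10 7 ;; add 18 18 18) ;;
                mul 19 17 18 ;; add 19 14 19 ;; mul 20 17 16 ;; add 20 19 20) 22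
                (\<lambda>q'. env q' \<and> rg q' 4 = rg q 4 \<and> rg q' 5 = rg q 5 \<and> mm q' = mm q \<and> rnd q' = rnd q) q'"
                if "q' = q6" for q' unfolding that
              proof (rule ok_seq[where ?B1.0=5 and R="\<lambda>q'. q' = q7" and ?B2.0=4])
                have "Suc (Suc (s + s)) = cs" using e(4) by simp
                then show "ok W ev (const 25 C ;; mul 17 25 10 ;; mul 17 17 9 ;; add 18 10 7 ;; add 18 18 18) 5
                  (\<lambda>q'. q' = q7) q6"
                  using lt(1-4) b(6) by (simp add: ok_def q7_def r6 e(1))
                show "ok W ev (mul 19 17 18 ;; add 19 14 19 ;; mul 20 17 16 ;; add 20 19 20) 4
                  (\<lambda>q'. env q' \<and> rg q' 4 = rg q 4 \<and> rg q' 5 = rg q 5 \<and> mm q' = mm q \<and> rnd q' = rnd q) q'"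
                  if "q' = q7" for q' unfolding that
                  using lt(5-7) V(7) f by (simp add: ok_def r7 e(2,3)[symmetric] setr_same)
              qed simp
            qed simp
          qed simp
        qed simp
      qed simp
    next
      have "sg * 5 + (n - 4) * 4 \<le> 20 * n" using sg_le by simp
      then show "(n - 4) * 4 + 2 + (sg * 5 + 40) \<le> 20 * n + 53" by simp
    qed
  qed (simp add: B_init_def)
qed

end

text \<open>In a strictly increasing enumeration the entries before an element are exactly the
  smaller elements.\<close>

lemma sorted_list_of_set_nth_card:
  fixes x :: nat
  assumes "finite A" "x \<in> A"
  shows "sorted_list_of_set A ! card {u \<in> A. u < x} = x" "card {u \<in> A. u < x} < card A"
proof -
  let ?xs = "sorted_list_of_set A"
  obtain i where i: "i < length ?xs" "?xs ! i = x"
    using assms by (metis in_set_conv_nth set_sorted_list_of_set)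
  have s: "sorted_wrt (<) ?xs" by (rule strict_sorted_list_of_set)
  have "{u \<in> A. u < x} = set (take i ?xs)"
  proof (rule set_eqI)
    fix u
    have "u \<in> A \<and> u < x \<longleftrightarrow> (\<exists>j<length ?xs. ?xs ! j = u \<and> u < x)"
      using assms by (metis in_set_conv_nth set_sorted_list_of_set)
    also have "\<dots> \<longleftrightarrow> (\<exists>j<i. ?xs ! j = u)"
      using i s by (metis less_trans linorder_cases order_less_irrefl sorted_wrt_nth_less)
    also have "\<dots> \<longleftrightarrow> u \<in> set (take i ?xs)"
      using i by (auto simp: in_set_conv_nth)
    finally show "u \<in> {u \<in> A. u < x} \<longleftrightarrow> u \<in> set (take i ?xs)" by simp
  qed
  then have "card {u \<in> A. u < x} = i"
    using i by (simp add: distinct_card)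
  then show "sorted_list_of_set A ! card {u \<in> A. u < x} = x" "card {u \<in> A. u < x} < card A"
    using i by simp_all
qed

section \<open>Ranks of preimages\<close>

context inversion
begin

text \<open>Pairs with a value below \<open>y\<close> are common to both bounds, so ranks among
  preimages are differences of global ranks.\<close>

lemma P_diff: "P y z = P y 0 + card {x. x < N \<and> f x = y \<and> x < z}"
proof -
  have "{u. less u y z} = {u. less u y 0} \<union> {x. x < N \<and> f x = y \<and> x < z}"
    by (auto simp: less_def)
  moreover have "{u. less u y 0} \<inter> {x. x < N \<and> f x = y \<and> x < z} = {}"
    by (auto simp: less_def)
  ultimately show ?thesis unfolding P_def
    by (simp add: card_Un_disjoint)
qed

lemma P_total: "P y N = P y 0 + card (preimages N f y)"
proof -
  have "{x. x < N \<and> f x = y \<and> x < N} = preimages N f y" by (auto simp: preimages_def)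
  then show ?thesis using P_diff[of y N] by simp
qed

text \<open>The rank crosses the threshold between \<open>x\<close> and \<open>x + 1\<close>, which
  happens only if \<open>x\<close> itself is a preimage of \<open>y\<close> with exactly
  \<open>j\<close> smaller ones.\<close>

lemma rank_select:
  assumes "P y x < P y 0 + Suc j" "P y 0 + Suc j \<le> P y (Suc x)"
  shows "x < N" "j < card (preimages N f y)" "sorted_list_of_set (preimages N f y) ! j = x"
proof -
  have A: "{u. u < N \<and> f u = y \<and> u < z} = {u \<in> preimages N f y. u < z}" for z
    by (auto simp: preimages_def)
  have 1: "card {u \<in> preimages N f y. u < x} \<le> j" "Suc j \<le> card {u \<in> preimages N f y. u < Suc x}"
    using assms P_diff[of y x] P_diff[of y "Suc x"] by (simp_all add: A)
  have fin: "finite (preimages N f y)" by (simp add: preimages_def)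
  have x: "x \<in> preimages N f y"
  proof (rule ccontr)
    assume "x \<notin> preimages N f y"
    then have "{u \<in> preimages N f y. u < Suc x} = {u \<in> preimages N f y. u < x}"
      by (auto simp: less_Suc_eq)
    then show False using 1 by simp
  qed
  then have "{u \<in> preimages N f y. u < Suc x} = insert x {u \<in> preimages N f y. u < x}"
    by auto
  then have "card {u \<in> preimages N f y. u < x} = j" using 1 fin by simp
  then show "x < N" "j < card (preimages N f y)" "sorted_list_of_set (preimages N f y) ! j = x"
    using sorted_list_of_set_nth_card[OF fin x] x by (auto simp: preimages_def)
qed

end

section \<open>Correctness of the query programs\<close>

context query
begin

text \<open>The invariant brackets the target between the ranks at \<open>x\<close> and at
  \<open>x + 2 ^ k\<close>; for \<open>k = 0\<close> this is the jump that
  \<open>rank_select\<close> asks for.\<close>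

lemma FIND_ok:
  assumes q: "qenv q" "rg q 25 = tg" and good: "good M"
    and tg: "P y 0 < tg" "tg \<le> P y N"
  shows "ok W ev FIND B_find (\<lambda>q'. keeps 25 X3 q q' \<and>
           P y (rg q' 26) < tg \<and> tg \<le> P y (Suc (rg q' 26))) q"
proof -
  define I where "I k q' \<longleftrightarrow> keeps 26 X3 q q' \<and> rg q' 27 = (if k = 0 then 0 else 2 ^ (k - 1)) \<and>
     P y (rg q' 26) < tg \<and> tg \<le> P y (rg q' 26 + 2 ^ k) \<and> rg q' 26 + 2 ^ k \<le> 2 * V" for k q'
  let ?body = "add 29 26 27 ;; CNT ;; IfLess 28 25 (add 26 26 27) Skip ;; shr 27 27 7"
  define q1 where "q1 = setr 27 V (setr 26 0 q)"
  have e1: "qenv q1" using q by (simp add: q1_def)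
  have loop: "ok W ev (While 24 27 ?body) ((n + 1) * (B_cnt + 6 + 2) + 2) (I 0) q1"
    unfolding ok_def
  proof (rule wp_while)
    \<comment> \<open>The first bracket ends at \<open>2 * V\<close>, where the rank has long
      reached its final value.\<close>
    have "P y (2 * V) = P y N" using N_le_V by (intro P_ge_N) simp
    then show "I (n + 1) q1" using tg by (simp add: I_def q1_def V_def)
  next
    fix k q' assume k: "I (Suc k) q'"
    have q': "qenv q'" using k qenv_keeps[OF q(1)] by (auto simp: I_def)
    have le: "2 ^ k \<le> (2::nat) * 2 ^ k" by simp
    have "rg q' 26 + 2 ^ k \<le> 2 * V" using k by (simp add: I_def)
    then have lt: "rg q' 26 + 2 ^ k < 2 ^ W" using big pos_params(1) by simp
    have r: "rg q' 27 = 2 ^ k" "rg q' 25 = tg" using k q by (simp_all add: I_def keeps_def)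
    define x where "x = rg q' 26"
    have "ok W ev ?body (B_cnt + 6) (I k) q'"
    proof (rule ok_seq[where ?B1.0=1 and ?B2.0="B_cnt + 5" and R="\<lambda>q''. q'' = setr 29 (x + 2 ^ k) q'"])
      show "ok W ev (add 29 26 27) 1 (\<lambda>q''. q'' = setr 29 (x + 2 ^ k) q') q'"
        using lt r by (simp add: ok_def x_def)
      show "ok W ev (CNT ;; IfLess 28 25 (add 26 26 27) Skip ;; shr 27 27 7) (B_cnt + 5) (I k) q2"
        if q2: "q2 = setr 29 (x + 2 ^ k) q'" for q2
      proof (rule ok_seq[OF CNT_ok, where ?B2.0=5])
        show "qenv q2" "rg q2 29 = x + 2 ^ k" using q2 q' by simp_all
        show "good M" by (rule good)
        fix q3 assume q3: "keeps 28 X3 q2 q3 \<and> rg q3 28 = P y (x + 2 ^ k)"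
        have e3: "qenv q3" using qenv_keeps[OF \<open>qenv q2\<close>] q3 by auto
        have r3: "rg q3 25 = tg" "rg q3 26 = x" "rg q3 27 = 2 ^ k" "keeps 26 X3 q q3"
          using q3 q2 r k by (auto simp: x_def I_def keeps_def)
        have "I k (setr 27 (drop_bit (Suc 0) (2 ^ k)) (if P y (x + 2 ^ k) < tg
            then setr 26 (x + 2 ^ k) q3 else q3))"
          using r3 k by (simp add: I_def drop_bit_pow x_def add.assoc mult_2)
        then show "ok W ev (IfLess 28 25 (add 26 26 27) Skip ;; shr 27 27 7) 5 (I k) q3"
          using q3 e3 r3 lt by (auto simp: ok_def x_def split: if_splits)
      qed simp
    qed simp
    moreover have "rg q' 24 = 0" using q' by simp
    ultimately show "rg q' 24 < rg q' 27 \<and> wp W ev ?body (\<lambda>t q''. t \<le> B_cnt + 6 \<and> I k q'') q'"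
      using r by (simp add: ok_def)
  next
    fix q' assume "I 0 q'" then show "\<not> rg q' 24 < rg q' 27" by (simp add: I_def)
  qed
  show ?thesis unfolding FIND_def
  proof (rule ok_seq[where ?B1.0=2 and R="\<lambda>q'. q' = q1" and ?B2.0="(n + 1) * (B_cnt + 8) + 2"])
    show "ok W ev (const 26 0 ;; mov 27 8) 2 (\<lambda>q'. q' = q1) q"
      using q by (simp add: ok_def q1_def)
    show "ok W ev (While 24 27 ?body) ((n + 1) * (B_cnt + 8) + 2) (\<lambda>q'. keeps 25 X3 q q' \<and>
           P y (rg q' 26) < tg \<and> tg \<le> P y (Suc (rg q' 26))) q'" if "q' = q1" for q'
      unfolding that
      by (rule ok_mono[OF loop]) (auto simp: I_def keeps_def)
    have "(n + 1) * (B_cnt + 8) \<le> (n + 1) * (B_cnt + 10)" by (intro mult_le_mono2) simp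
    then show "2 + ((n + 1) * (B_cnt + 8) + 2) \<le> B_find" by (simp add: B_find_def)
  qed
qed

definition qpre :: "st \<Rightarrow> bool" where
  "qpre q \<longleftrightarrow> env q \<and> rg q 4 = D \<and> (\<forall>a<D. mm q a = M a) \<and> num_at D y q"

lemma QSET_ok:
  assumes "qpre q"
  shows "ok W ev QSET 4 (\<lambda>q'. qenv q' \<and> mm q' = mm q \<and> rg q' 5 = rg q 5) q"
proof -
  have "D + nw < 2 ^ W" "D + nw + nw < 2 ^ W" "D + nw + nw + s < 2 ^ W" "D + nw + nw + s + nw < 2 ^ W"
    using X_less by (auto simp: X3_def X2_def X1_def intro: order.strict_trans1[OF _ X_less(7)])
  moreover have "env q" using assms by (simp add: qpre_def)
  moreover have "D + nw + nw = X3" "X3 + s = X2" "X2 + nw = X1"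
    by (simp_all add: X1_def X2_def X3_def)
  ultimately have "ok W ev QSET 4 (\<lambda>q'. q' = setr 23 X1 (setr 22 X2 (setr 21 X3 q))) q"
    using assms by (simp add: ok_def QSET_def qpre_def)
  moreover have "qenv (setr 23 X1 (setr 22 X2 (setr 21 X3 q)))"
    using assms by (simp add: qenv_def qpre_def env_def num_at_def del: env_simps qenvD)
  ultimately show ?thesis by (auto elim!: ok_mono)
qed

lemma HILO_ok:
  assumes q: "qenv q" and good: "good M"
  shows "ok W ev HILO (2 * B_cnt + 4) (\<lambda>q'. qenv q' \<and> rg q' 5 = rg q 5 \<and> rg q' 26 = P y N \<and>
     rg q' 28 = P y 0 \<and> rg q' 27 = card (preimages N f y)) q"
  unfolding HILO_def
proof (rule ok_seq[where ?B1.0=1 and R="\<lambda>q'. q' = setr 29 N q" and ?B2.0="2 * B_cnt + 3"])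
  show "ok W ev (mov 29 0) 1 (\<lambda>q'. q' = setr 29 N q) q" using q by (simp add: ok_def)
  show "ok W ev (CNT ;; (mov 26 28 ;; mov 29 24) ;; CNT ;; sub 27 26 28) (2 * B_cnt + 3)
     (\<lambda>q'. qenv q' \<and> rg q' 5 = rg q 5 \<and> rg q' 26 = P y N \<and>
     rg q' 28 = P y 0 \<and> rg q' 27 = card (preimages N f y)) q1" if q1: "q1 = setr 29 N q" for q1
  proof (rule ok_seq[OF CNT_ok, where ?B2.0="B_cnt + 3"])
    show "qenv q1" "rg q1 29 = N" using q q1 by simp_all
    show "good M" by (rule good)
    fix q2 assume q2: "keeps 28 X3 q1 q2 \<and> rg q2 28 = P y N"
    have e2: "qenv q2" using qenv_keeps[OF \<open>qenv q1\<close>] q2 by auto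
    define q3 where "q3 = setr 29 0 (setr 26 (P y N) q2)"
    show "ok W ev ((mov 26 28 ;; mov 29 24) ;; CNT ;; sub 27 26 28) (B_cnt + 3)
     (\<lambda>q'. qenv q' \<and> rg q' 5 = rg q 5 \<and> rg q' 26 = P y N \<and>
     rg q' 28 = P y 0 \<and> rg q' 27 = card (preimages N f y)) q2"
    proof (rule ok_seq[where ?B1.0=2 and R="\<lambda>q'. q' = q3" and ?B2.0="B_cnt + 1"])
      show "ok W ev (mov 26 28 ;; mov 29 24) 2 (\<lambda>q'. q' = q3) q2"
        using e2 q2 by (simp add: ok_def q3_def)
      show "ok W ev (CNT ;; sub 27 26 28) (B_cnt + 1) (\<lambda>q'. qenv q' \<and> rg q' 5 = rg q 5 \<and>
        rg q' 26 = P y N \<and> rg q' 28 = P y 0 \<and> rg q' 27 = card (preimages N f y)) q'"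
        if "q' = q3" for q' unfolding that
      proof (rule ok_seq[OF CNT_ok, where ?B2.0=1])
        show "qenv q3" "rg q3 29 = 0" using e2 by (simp_all add: q3_def)
        show "good M" by (rule good)
        fix q4 assume q4: "keeps 28 X3 q3 q4 \<and> rg q4 28 = P y 0"
        have e4: "qenv q4" using qenv_keeps[OF \<open>qenv q3\<close>] q4 by auto
        have "P y N < 2 ^ W" using P_le[of y N] N_le_V X_less(15) by simp
        moreover have "P y 0 \<le> P y N" by (rule P_mono) simp
        moreover have "P y N - P y 0 = card (preimages N f y)" by (simp add: P_total)
        moreover have "rg q4 26 = P y N" "rg q4 5 = rg q 5"
          using q4 q2 q1 by (auto simp: q3_def keeps_def)
        ultimately show "ok W ev (sub 27 26 28) 1 (\<lambda>q'. qenv q' \<and> rg q' 5 = rg q 5 \<and>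
           rg q' 26 = P y N \<and> rg q' 28 = P y 0 \<and> rg q' 27 = card (preimages N f y)) q4"
          using e4 q4 by (simp add: ok_def)
      qed simp
    qed simp
  qed simp
qed simp

definition result :: "st \<Rightarrow> nat option" where
  "result q = (if rg q 0 = 0 then None else Some (rg q 1))"

lemma finish_ok:
  assumes q: "qenv q" "rg q 25 = P y 0 + Suc j" and good: "good M" and j: "j < card (preimages N f y)"
  shows "ok W ev (FIND ;; (mov 1 26 ;; mov 0 7)) (B_find + 2)
     (\<lambda>q'. result q' = Some (sorted_list_of_set (preimages N f y) ! j)) q"
proof (rule ok_seq[OF FIND_ok, where ?B2.0=2])
  show "qenv q" "rg q 25 = P y 0 + Suc j" "good M" by fact+
  show "P y 0 < P y 0 + Suc j" "P y 0 + Suc j \<le> P y N" using j by (simp_all add: P_total)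
  fix q' assume q': "keeps 25 X3 q q' \<and> P y (rg q' 26) < P y 0 + Suc j \<and>
     P y 0 + Suc j \<le> P y (Suc (rg q' 26))"
  have "qenv q'" using qenv_keeps[OF q(1)] q' by auto
  moreover have "sorted_list_of_set (preimages N f y) ! j = rg q' 26"
    using rank_select q' by blast
  ultimately show "ok W ev (mov 1 26 ;; mov 0 7) 2
     (\<lambda>q'. result q' = Some (sorted_list_of_set (preimages N f y) ! j)) q'"
    by (simp add: ok_def result_def)
qed simp

lemma SELECT_ok:
  assumes init: "ok W ev (INIT C) B_init (\<lambda>q'. qpre q' \<and> rg q' 5 = k) q" and good: "good M"
  shows "ok W ev (SELECT C) B_sel (\<lambda>q'. result q' = kth_largest k (preimages N f y)) q"
  unfolding SELECT_def
proof (rule ok_seq[OF init, where ?B2.0="2 * B_cnt + B_find + 40"])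
  fix q1 assume q1: "qpre q1 \<and> rg q1 5 = k"
  show "ok W ev (QSET ;; HILO ;; IfLess 5 27 (sub 25 26 5 ;; FIND ;; (mov 1 26 ;; mov 0 7)) (mov 0 24))
    (2 * B_cnt + B_find + 40) (\<lambda>q'. result q' = kth_largest k (preimages N f y)) q1"
  proof (rule ok_seq[OF QSET_ok, where ?B2.0="2 * B_cnt + 4 + (B_find + 30)"])
    show "qpre q1" using q1 by simp
    fix q2 assume q2: "qenv q2 \<and> mm q2 = mm q1 \<and> rg q2 5 = rg q1 5"
    show "ok W ev (HILO ;; IfLess 5 27 (sub 25 26 5 ;; FIND ;; (mov 1 26 ;; mov 0 7)) (mov 0 24))
      (2 * B_cnt + 4 + (B_find + 30)) (\<lambda>q'. result q' = kth_largest k (preimages N f y)) q2"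
    proof (rule ok_seq[OF HILO_ok, where ?B2.0="B_find + 30"])
      show "qenv q2" "good M" using q2 good by auto
      fix q3 assume q3: "qenv q3 \<and> rg q3 5 = rg q2 5 \<and> rg q3 26 = P y N \<and>
         rg q3 28 = P y 0 \<and> rg q3 27 = card (preimages N f y)"
      have r3: "rg q3 5 = k" using q1 q2 q3 by simp
      show "ok W ev (IfLess 5 27 (sub 25 26 5 ;; FIND ;; (mov 1 26 ;; mov 0 7)) (mov 0 24))
        (B_find + 30) (\<lambda>q'. result q' = kth_largest k (preimages N f y)) q3"
      proof (rule ok_mono[OF ok_If])
        assume "rg q3 5 < rg q3 27"
        then have k: "k < card (preimages N f y)" using r3 q3 by simp
        \<comment> \<open>Counting from 0, the \<open>k\<close>th largest preimage is the
          \<open>j\<close>th smallest.\<close>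
        define j where "j = card (preimages N f y) - 1 - k"
        have target: "P y N - k = P y 0 + Suc j" using k by (simp add: P_total j_def)
        show "ok W ev (sub 25 26 5 ;; FIND ;; (mov 1 26 ;; mov 0 7)) (B_find + 3)
          (\<lambda>q'. result q' = kth_largest k (preimages N f y)) q3"
        proof (rule ok_seq[where ?B1.0=1 and ?B2.0="B_find + 2" and R="\<lambda>q'. q' = setr 25 (P y 0 + Suc j) q3"])
          have "P y N < 2 ^ W" using P_le[of y N] N_le_V X_less(15) by simp
          moreover have "k \<le> P y N" using k by (simp add: P_total)
          ultimately show "ok W ev (sub 25 26 5) 1 (\<lambda>q'. q' = setr 25 (P y 0 + Suc j) q3) q3"
            using r3 q3 target by (simp add: ok_def)
          show "ok W ev (FIND ;; (mov 1 26 ;; mov 0 7)) (B_find + 2)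
            (\<lambda>q'. result q' = kth_largest k (preimages N f y)) q'"
            if "q' = setr 25 (P y 0 + Suc j) q3" for q' unfolding that
          proof (rule ok_mono[OF finish_ok])
            show "qenv (setr 25 (P y 0 + Suc j) q3)" "rg (setr 25 (P y 0 + Suc j) q3) 25 = P y 0 + Suc j"
              "good M" "j < card (preimages N f y)"
              using q3 good k by (simp_all add: j_def)
            fix q4 assume "result q4 = Some (sorted_list_of_set (preimages N f y) ! j)"
            then show "result q4 = kth_largest k (preimages N f y)"
              using k by (simp add: kth_largest_def rev_nth j_def)
          qed simp
        qed simp
      next
        assume "\<not> rg q3 5 < rg q3 27"
        then show "ok W ev (mov 0 24) (B_find + 3) (\<lambda>q'. result q' = kth_largest k (preimages N f y)) q3"
          using r3 q3 by (simp add: ok_def result_def kth_largest_def)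
      qed simp_all
    qed simp
  qed simp
qed (simp add: B_sel_def)

lemma MEDIAN_ok:
  assumes init: "ok W ev (INIT C) B_init (\<lambda>q'. qpre q' \<and> rg q' 5 = k) q" and good: "good M"
  shows "ok W ev (MEDIAN C) B_sel (\<lambda>q'. result q' = median (preimages N f y)) q"
  unfolding MEDIAN_def
proof (rule ok_seq[OF init, where ?B2.0="2 * B_cnt + B_find + 40"])
  let ?post = "\<lambda>q'. result q' = median (preimages N f y)"
  let ?set = "sub 27 27 7 ;; shr 27 27 7 ;; add 25 28 27 ;; add 25 25 7"
  fix q1 assume q1: "qpre q1 \<and> rg q1 5 = k"
  show "ok W ev (QSET ;; HILO ;; IfLess 24 27 ((?set) ;; FIND ;; (mov 1 26 ;; mov 0 7)) (mov 0 24))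
    (2 * B_cnt + B_find + 40) ?post q1"
  proof (rule ok_seq[OF QSET_ok, where ?B2.0="2 * B_cnt + 4 + (B_find + 30)"])
    show "qpre q1" using q1 by simp
    fix q2 assume q2: "qenv q2 \<and> mm q2 = mm q1 \<and> rg q2 5 = rg q1 5"
    show "ok W ev (HILO ;; IfLess 24 27 ((?set) ;; FIND ;; (mov 1 26 ;; mov 0 7)) (mov 0 24))
      (2 * B_cnt + 4 + (B_find + 30)) ?post q2"
    proof (rule ok_seq[OF HILO_ok, where ?B2.0="B_find + 30"])
      show "qenv q2" "good M" using q2 good by auto
      fix q3 assume q3: "qenv q3 \<and> rg q3 5 = rg q2 5 \<and> rg q3 26 = P y N \<and>
         rg q3 28 = P y 0 \<and> rg q3 27 = card (preimages N f y)"
      define c where "c = card (preimages N f y)"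
      show "ok W ev (IfLess 24 27 ((?set) ;; FIND ;; (mov 1 26 ;; mov 0 7)) (mov 0 24))
        (B_find + 30) ?post q3"
      proof (rule ok_mono[OF ok_If])
        assume "rg q3 24 < rg q3 27"
        then have c: "0 < c" using q3 by (simp add: c_def)
        then have ne: "preimages N f y \<noteq> {}" by (auto simp: c_def)
        \<comment> \<open>Index of the lower median, counted from 0; \<open>FIND\<close> expects a
          rank counted from 1, hence \<open>Suc j\<close> in its target.\<close>
        define j where "j = (c - 1) div 2"
        have j: "j < c" using c by (simp add: j_def)
        show "ok W ev ((?set) ;; FIND ;; (mov 1 26 ;; mov 0 7)) (B_find + 6) ?post q3"
        proof (rule ok_seq[where ?B1.0=4 and ?B2.0="B_find + 2"
              and R="\<lambda>q'. q' = setr 25 (P y 0 + Suc j) (setr 27 j q3)"])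
          have "P y N < 2 ^ W" using P_le[of y N] N_le_V X_less(15) by simp
          then have "P y 0 + Suc j < 2 ^ W" "c < 2 ^ W"
            using j by (simp_all add: P_total c_def[symmetric])
          then show "ok W ev ?set 4 (\<lambda>q'. q' = setr 25 (P y 0 + Suc j) (setr 27 j q3)) q3"
            using q3 c by (simp add: ok_def c_def[symmetric] j_def drop_bit_eq_div Suc_le_eq setr_def)
          show "ok W ev (FIND ;; (mov 1 26 ;; mov 0 7)) (B_find + 2) ?post q'"
            if "q' = setr 25 (P y 0 + Suc j) (setr 27 j q3)" for q' unfolding that
          proof (rule ok_mono[OF finish_ok])
            show "qenv (setr 25 (P y 0 + Suc j) (setr 27 j q3))"
              "rg (setr 25 (P y 0 + Suc j) (setr 27 j q3)) 25 = P y 0 + Suc j"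
              "good M" "j < card (preimages N f y)"
              using q3 good j by (simp_all add: c_def)
            fix q4 assume "result q4 = Some (sorted_list_of_set (preimages N f y) ! j)"
            then show "?post q4" using ne by (simp add: median_def j_def c_def)
          qed simp
        qed simp
      next
        assume "\<not> rg q3 24 < rg q3 27"
        then have "preimages N f y = {}" using q3 by (simp add: preimages_def)
        then show "ok W ev (mov 0 24) (B_find + 6) ?post q3"
          using q3 by (simp add: ok_def result_def median_def)
      qed simp_all
    qed simp
  qed simp
qed (simp add: B_sel_def)

text \<open>For \<open>w = 0\<close> the arguments occupy no words, and the cell that
  \<open>CLAMP\<close> reads instead is a 0 behind the input.\<close>

definition zpre :: "nat \<Rightarrow> st \<Rightarrow> bool" where
  "zpre z q \<longleftrightarrow> num_at (D + nw) z q \<and> (nw = 0 \<longrightarrow> mm q D = 0)"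

text \<open>\<open>CNT\<close> takes its bound in a single register. A nonzero word beyond the first
  one means \<open>z \<ge> 2 ^ W > N\<close>, and ranks do not change when \<open>z\<close> is cut
  down to \<open>N\<close>.\<close>

lemma CLAMP_ok:
  assumes q: "qenv q" and z: "z < 2 ^ w" "zpre z q"
  shows "ok W ev CLAMP (nw * 12 + 10) (\<lambda>q'. qenv q' \<and> rg q' 29 = min z N) q"
proof -
  define dg where "dg i = z div 2 ^ (W * i) mod 2 ^ W" for i
  define d0 where "d0 = mm q (D + nw)"
  have d0: "0 < nw \<Longrightarrow> d0 = z mod 2 ^ W" using z(2) by (auto simp: zpre_def num_at_def d0_def)
  define big_digit where "big_digit j \<longleftrightarrow> (\<exists>i. 1 \<le> i \<and> i < j \<and> dg i \<noteq> 0)" for j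
  define I where "I j q' \<longleftrightarrow> keeps 25 X1 q q' \<and> rg q' 26 = D + nw \<and>
    rg q' 29 = (if big_digit j then N else min d0 N)" for j q'
  define q1 where "q1 = setr 29 (min d0 N) (setr 26 (D + nw) q)"
  let ?body = "add 25 26 27 ;; load 25 25 ;; IfLess 24 25 (IfLess 24 27 (mov 29 0) Skip) Skip"
  have loop: "ok W ev (For 27 6 ?body) (nw * 10 + 3) (I nw) q1"
  proof (rule ok_for[where B=7])
    show "I 0 (setr 27 0 q1)" by (simp add: I_def q1_def big_digit_def)
    show "nw < 2 ^ W" using X_less by simp
  next
    fix j q' assume "I j q'"
    then have "qenv q'" using qenv_keeps[OF q] X_less by (auto simp: I_def)
    then show "rg q' 6 = nw \<and> rg q' 7 = 1" by simp
  next
    fix j q' assume j: "j < nw" "rg q' 27 = j" "I j q'"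
    have q': "qenv q'" using qenv_keeps[OF q] j X_less by (auto simp: I_def)
    have le: "D + nw + j < X3" using j by (simp add: X3_def)
    then have lt: "D + nw + j < 2 ^ W" using X_less(11) by (auto intro: order.strict_trans1)
    have m: "mm q' (D + nw + j) = dg j"
      using j z(2) le X_less by (simp add: I_def keeps_def zpre_def num_at_def dg_def)
    have "big_digit (Suc j) \<longleftrightarrow> big_digit j \<or> (0 < j \<and> dg j \<noteq> 0)"
      unfolding big_digit_def by (metis One_nat_def Suc_leI less_Suc_eq not_less_eq_eq zero_less_Suc)
    then show "ok W ev ?body 7
       (\<lambda>s''. rg s'' 27 = j \<and> rg s'' 7 = 1 \<and> I (Suc j) (setr 27 (Suc j) s'')) q'"
      using q' j m lt by (auto simp: ok_def I_def)
  qed simp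
  have fin: "(if big_digit nw then N else min d0 N) = min z N"
  proof (cases "big_digit nw")
    case True
    then obtain i where i: "1 \<le> i" "dg i \<noteq> 0" by (auto simp: big_digit_def)
    then have zi: "2 ^ (W * i) \<le> z" by (metis div_less dg_def mod_0 not_less)
    have "N < 2 ^ W" using N_le_V X_less(15) by (rule order.strict_trans1)
    also have "(2::nat) ^ W \<le> 2 ^ (W * i)" using i by (intro power_increasing) auto
    also note zi
    finally show ?thesis using True by simp
  next
    case False
    have "d0 = z"
    proof (cases "nw = 0")
      case True
      then have "z = 0" using mod_words[OF z(1)] by simp
      then show ?thesis using True z(2) by (simp add: zpre_def d0_def)
    next
      case nz: False
      have "z mod 2 ^ (W * Suc j) = z mod 2 ^ W" if "j < nw" for j
        using that
      proof (induction j)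
        case (Suc j)
        then have "dg (Suc j) = 0" using False by (auto simp: big_digit_def)
        then show ?case using Suc mod_Suc_word[of z W "Suc j"] by (simp add: dg_def)
      qed simp
      from this[of "nw - 1"] nz have "z mod 2 ^ (W * nw) = z mod 2 ^ W" by simp
      then show ?thesis using d0 nz mod_words[OF z(1)] by simp
    qed
    then show ?thesis using False by simp
  qed
  have lt: "D + nw < 2 ^ W" using X_less by (auto intro: order.strict_trans1[OF _ X_less(11)])
  show ?thesis unfolding CLAMP_def
  proof (rule ok_seq[where ?B1.0=5 and R="\<lambda>q'. q' = q1" and ?B2.0="nw * 10 + 3"])
    show "ok W ev (add 26 4 6 ;; load 29 26 ;; IfLess 29 0 Skip (mov 29 0)) 5 (\<lambda>q'. q' = q1) q"
      using q lt by (auto simp: ok_def q1_def d0_def min_def setr_def)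
    show "ok W ev (For 27 6 ?body) (nw * 10 + 3) (\<lambda>q'. qenv q' \<and> rg q' 29 = min z N) q'"
      if "q' = q1" for q' unfolding that
    proof (rule ok_mono[OF loop])
      fix q' assume q': "I nw q'"
      then have "qenv q'" using qenv_keeps[OF q] X_less by (auto simp: I_def)
      then show "qenv q' \<and> rg q' 29 = min z N" using q' fin by (simp add: I_def)
    qed simp
  qed simp
qed

lemma RANK_ok:
  assumes init: "ok W ev (INIT C) B_init (\<lambda>q'. qpre q' \<and> zpre z q') q" and good: "good M"
    and z: "z < 2 ^ w"
  shows "ok W ev (RANK C) B_rank (\<lambda>q'. rg q' 0 = card {x. x < N \<and> f x = y \<and> x < z}) q"
  unfolding RANK_def
proof (rule ok_seq[OF init, where ?B2.0="12 * nw + 2 * B_cnt + 40"])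
  let ?Q = "\<lambda>q'. rg q' 0 = card {x. x < N \<and> f x = y \<and> x < z}"
  fix q1 assume q1: "qpre q1 \<and> zpre z q1"
  show "ok W ev (QSET ;; CLAMP ;; CNT ;; (mov 26 28 ;; mov 29 24) ;; CNT ;; sub 0 26 28)
    (12 * nw + 2 * B_cnt + 40) ?Q q1"
  proof (rule ok_seq[OF QSET_ok, where ?B2.0="12 * nw + 2 * B_cnt + 30"])
    show "qpre q1" using q1 by simp
    fix q2 assume q2: "qenv q2 \<and> mm q2 = mm q1 \<and> rg q2 5 = rg q1 5"
    show "ok W ev (CLAMP ;; CNT ;; (mov 26 28 ;; mov 29 24) ;; CNT ;; sub 0 26 28)
      (12 * nw + 2 * B_cnt + 30) ?Q q2"
    proof (rule ok_seq[OF CLAMP_ok, where ?B2.0="2 * B_cnt + 3"])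
      show "qenv q2" "zpre z q2" "z < 2 ^ w"
        using q1 q2 z by (auto simp: zpre_def num_at_def)
      fix q3 assume q3: "qenv q3 \<and> rg q3 29 = min z N"
      show "ok W ev (CNT ;; (mov 26 28 ;; mov 29 24) ;; CNT ;; sub 0 26 28) (2 * B_cnt + 3) ?Q q3"
      proof (rule ok_seq[OF CNT_ok, where ?B2.0="B_cnt + 3"])
        show "qenv q3" "rg q3 29 = min z N" "good M" using q3 good by auto
        fix q4 assume q4: "keeps 28 X3 q3 q4 \<and> rg q4 28 = P y (min z N)"
        have e4: "qenv q4" using qenv_keeps[of q3 28 X3 q4] q3 q4 by auto
        have Pz: "P y (min z N) = P y z" using P_ge_N[of z y] by (simp add: min_def)
        define q5 where "q5 = setr 29 0 (setr 26 (P y z) q4)"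
        show "ok W ev ((mov 26 28 ;; mov 29 24) ;; CNT ;; sub 0 26 28) (B_cnt + 3) ?Q q4"
        proof (rule ok_seq[where ?B1.0=2 and R="\<lambda>q'. q' = q5" and ?B2.0="B_cnt + 1"])
          show "ok W ev (mov 26 28 ;; mov 29 24) 2 (\<lambda>q'. q' = q5) q4"
            using e4 q4 Pz by (simp add: ok_def q5_def)
          show "ok W ev (CNT ;; sub 0 26 28) (B_cnt + 1) ?Q q'" if "q' = q5" for q' unfolding that
          proof (rule ok_seq[OF CNT_ok, where ?B2.0=1])
            show "qenv q5" "rg q5 29 = 0" "good M" using e4 good by (simp_all add: q5_def)
            fix q6 assume q6: "keeps 28 X3 q5 q6 \<and> rg q6 28 = P y 0"
            have "rg q6 26 = P y z" using q6 by (simp add: keeps_def q5_def)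
            moreover have "P y z < 2 ^ W" using P_le[of y z] N_le_V X_less(15) by simp
            moreover have "P y 0 \<le> P y z" by (rule P_mono) simp
            moreover have "P y z - P y 0 = card {x. x < N \<and> f x = y \<and> x < z}"
              using P_diff[of y z] by simp
            ultimately show "ok W ev (sub 0 26 28) 1 ?Q q6" using q6 by (simp add: ok_def)
          qed simp
        qed simp
      qed simp
    qed simp
  qed simp
qed (simp add: B_rank_def)

end

section \<open>Construction\<close>

definition SEEDS :: com where
  "SEEDS =
     (mov 21 20 ;; add 22 20 8 ;; add 23 22 8 ;; add 25 23 8 ;; mul 27 17 18) ;;
     For 26 27 (Rnd 28 ;; add 29 14 26 ;; store 29 28)"

definition PASS :: "nat \<Rightarrow> com" where
  "PASS v =
     For 30 0
      (add 31 21 30 ;; load 32 31 ;; Ev 25 32 ;; add 31 25 27 ;; load 31 31 ;; shr 31 31 28 ;;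
       Bas (Arith And 31 31 7) ;; IfEq 31 v (store 29 32 ;; add 29 29 7) Skip)"

definition COPY :: com where
  "COPY = For 30 0 (add 31 22 30 ;; load 32 31 ;; add 31 21 30 ;; store 31 32)"

text \<open>Radix sort from the least significant bit, with \<open>w\<close> stable partitions;
  values of \<open>f\<close> are evaluated anew in each pass rather than stored. Registers 24 and 7
  supply the bits 0 and 1.\<close>

definition SORT :: com where
  "SORT =
     For 26 8 (add 27 21 26 ;; store 27 26) ;;
     For 26 1
      ((Bas (Arith Div 27 26 2) ;; Bas (Arith Mod 28 26 2) ;; mov 29 22) ;;
       PASS 24 ;; PASS 7 ;; COPY)"

definition POS :: com where
  "POS = For 26 8 (add 27 21 26 ;; load 27 27 ;; add 27 23 27 ;; store 27 26)"

definition SMP :: com where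
  "SMP = For 26 14 (mul 27 26 10 ;; add 27 21 27 ;; load 27 27 ;; store 26 27)"

text \<open>The construction has all positions tabulated, so a chain step looks \<open>pos\<close>
  up instead of evaluating \<open>f\<close> and searching.\<close>

definition CHAIN :: com where
  "CHAIN =
     (mov 38 27 ;; mov 40 32) ;;
     For 41 10 (HASH ;; (shr 42 42 12 ;; add 42 23 42 ;; load 42 42 ;; shr 38 42 11 ;;
       add 40 40 7 ;; add 40 40 7)) ;;
     HASH ;; (shr 42 42 13 ;; add 42 33 42 ;; store 42 27)"

definition TABLES :: com where
  "TABLES =
     (mov 32 14 ;; mov 33 19) ;;
     For 26 17 (For 27 15 CHAIN ;; add 32 32 18 ;; add 33 33 16)"

definition BUILD :: "nat \<Rightarrow> com" where
  "BUILD C = INIT C ;; SEEDS ;; SORT ;; POS ;; SMP ;; TABLES ;; mov 0 20"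

section \<open>Radix sort and the coverage criterion\<close>

context inversion
begin

text \<open>The invariant of the radix sort: \<open>b\<close> bits have been processed, and ties are
  ordered by the elements themselves.\<close>

definition srt :: "nat \<Rightarrow> nat list \<Rightarrow> bool" where
  "srt b xs \<longleftrightarrow> set xs = {..<N} \<and>
     sorted_wrt (\<lambda>u v. f u mod 2 ^ b < f v mod 2 ^ b \<or> f u mod 2 ^ b = f v mod 2 ^ b \<and> u < v) xs"

lemma srt_length: "srt b xs \<Longrightarrow> length xs = N"
proof -
  assume *: "srt b xs"
  then have "distinct xs"
    unfolding srt_def distinct_conv_nth sorted_wrt_iff_nth_less
    by (metis less_irrefl nat_neq_iff)
  then show ?thesis using * distinct_card[of xs] by (simp add: srt_def)
qed

lemma mod_Suc_bit: "(a::nat) mod 2 ^ Suc b = a mod 2 ^ b + 2 ^ b * (a div 2 ^ b mod 2)"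
  using mod_mult2_eq[of a "2 ^ b" 2] by (simp add: mult.commute)

text \<open>Filtering preserves the old order within each half, and bit \<open>b\<close> outweighs
  all lower bits.\<close>

lemma srt_Suc:
  assumes "srt b xs"
  shows "srt (Suc b) (filter (\<lambda>x. f x div 2 ^ b mod 2 = 0) xs @ filter (\<lambda>x. f x div 2 ^ b mod 2 = 1) xs)"
proof -
  let ?lt = "\<lambda>b u v. f u mod 2 ^ b < f v mod 2 ^ b \<or> f u mod 2 ^ b = f v mod 2 ^ b \<and> u < v"
  let ?bit = "\<lambda>u. f u div 2 ^ b mod 2"
  have lt: "?lt (Suc b) u v \<longleftrightarrow> ?bit u < ?bit v \<or> ?bit u = ?bit v \<and> ?lt b u v" for u v
    unfolding mod_Suc_bit by (subst lex_less lex_eq, simp, simp)+ auto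
  have s: "sorted_wrt (?lt b) xs" using assms by (simp add: srt_def)
  have f: "sorted_wrt (?lt (Suc b)) (filter (\<lambda>x. ?bit x = c) xs)" for c
    by (rule sorted_wrt_mono_rel[OF _ sorted_wrt_filter[OF s]]) (simp add: lt del: power_Suc)
  have "\<And>u v. ?bit u = 0 \<Longrightarrow> ?bit v = 1 \<Longrightarrow> ?lt (Suc b) u v" by (simp add: lt del: power_Suc)
  then have "sorted_wrt (?lt (Suc b)) (filter (\<lambda>x. ?bit x = 0) xs @ filter (\<lambda>x. ?bit x = 1) xs)"
    unfolding sorted_wrt_append using f by auto
  moreover have "set (filter (\<lambda>x. ?bit x = 0) xs @ filter (\<lambda>x. ?bit x = 1) xs) = set xs"
    by auto
  ultimately show ?thesis using assms by (simp only: srt_def)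
qed

lemma srt_0: "srt 0 [0..<N]"
  by (auto simp: srt_def atLeast0LessThan sorted_wrt_iff_nth_less)

text \<open>Exactly the \<open>i\<close> entries before \<open>xs ! i\<close> are lexicographically
  smaller, so the index is the rank.\<close>

lemma srt_pos:
  assumes "srt w xs" "i < N"
  shows "pos (xs ! i) = i"
proof -
  let ?lt = "\<lambda>u v. f u < f v \<or> f u = f v \<and> u < v"
  have len: "length xs = N" using srt_length assms(1) .
  have set: "set xs = {..<N}" using assms by (simp add: srt_def)
  have "sorted_wrt ?lt xs"
    by (rule sorted_wrt_mono_rel[where P="\<lambda>u v. f u mod 2 ^ w < f v mod 2 ^ w \<or> f u mod 2 ^ w = f v mod 2 ^ w \<and> u < v"])
       (use assms f_less set in \<open>auto simp: srt_def\<close>)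
  then have s: "a < b \<Longrightarrow> b < N \<Longrightarrow> ?lt (xs ! a) (xs ! b)" for a b
    by (simp add: sorted_wrt_iff_nth_less len)
  define u where "u = xs ! i"
  have u: "u < N" using set assms(2) len nth_mem[of i xs] by (auto simp: u_def)
  have inj: "inj_on (\<lambda>j. xs ! j) {..<i}"
    using s assms(2) by (intro linorder_inj_onI) (fastforce, auto)
  have "{v. less v (f u) u} = (\<lambda>j. xs ! j) ` {..<i}"
  proof (rule set_eqI)
    fix v
    show "v \<in> {v. less v (f u) u} \<longleftrightarrow> v \<in> (\<lambda>j. xs ! j) ` {..<i}"
    proof
      assume v: "v \<in> {v. less v (f u) u}"
      then have "v \<in> set xs" by (auto simp: set less_def)
      then obtain j where j: "j < N" "xs ! j = v" by (auto simp: in_set_conv_nth len)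
      have "\<not> ?lt u v" "v \<noteq> u" using v by (auto simp: less_def)
      then have "j < i" using s[of i j] j by (metis linorder_neqE_nat u_def)
      then show "v \<in> (\<lambda>j. xs ! j) ` {..<i}" using j by auto
    next
      assume "v \<in> (\<lambda>j. xs ! j) ` {..<i}"
      then obtain j where j: "j < i" "v = xs ! j" by auto
      then have "v < N" using set len assms(2) nth_mem[of j xs] by auto
      then show "v \<in> {v. less v (f u) u}" using s[of j i] j assms(2) by (auto simp: less_def u_def)
    qed
  qed
  then show ?thesis using u inj by (simp add: pos_def P_def card_image u_def)
qed

lemma bit_word:
  "drop_bit (b mod W) (v div 2 ^ (W * (b div W)) mod 2 ^ W) AND 1 = (v div 2 ^ b mod 2 :: nat)"
proof -
  have "b mod W < W" using pos_params(7) by simp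
  then have "drop_bit (b mod W) (take_bit W (drop_bit (W * (b div W)) v)) AND 1 = of_bool (bit v b)"
    by (simp add: and_one_eq bit_iff_odd_drop_bit[symmetric] mod_2_eq_odd bit_take_bit_iff bit_drop_bit_eq)
  moreover have "v div 2 ^ b mod 2 = of_bool (bit v b)"
    by (simp add: bit_iff_odd mod_2_eq_odd)
  ultimately show ?thesis by (simp add: take_bit_eq_mod drop_bit_eq_div)
qed

definition ckey :: "(nat \<Rightarrow> nat) \<Rightarrow> nat \<Rightarrow> nat \<Rightarrow> nat" where
  "ckey M i j = kv M (Gs + i * cs + 2 * s) (walk M (Gs + i * cs) s j)"

text \<open>A condition on the seeds alone. A key that no other chain of the table shares makes the
  contents of its slot independent of the order in which chains are stored.\<close>

definition covering :: "(nat \<Rightarrow> nat) \<Rightarrow> bool" where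
  "covering M \<longleftrightarrow> (\<forall>x<N. \<exists>i<r. \<exists>j<m. \<exists>k<s.
     xv M (Gs + i * cs + 2 * k) (walk M (Gs + i * cs) k j) = x \<and>
     (\<forall>j'<m. j' \<noteq> j \<longrightarrow> ckey M i j' \<noteq> ckey M i j))"

lemma walk_add: "walk M p (a + b) g = walk M (p + 2 * a) b (walk M p a g)"
  by (induction b) (simp_all add: algebra_simps)

text \<open>From \<open>G x\<close> on, the walk follows the chain of \<open>j\<close> that passes
  through \<open>x\<close>; it reaches the same end and thus the slot in which \<open>j\<close> is
  stored.\<close>

lemma good_if_covering:
  assumes smp: "\<And>g. g < Gs \<Longrightarrow> M g = smp g" and cov: "covering M"
    and tab: "\<And>i j. i < r \<Longrightarrow> j < m \<Longrightarrow> (\<And>j'. j' < m \<Longrightarrow> j' \<noteq> j \<Longrightarrow> ckey M i j' \<noteq> ckey M i j) \<Longrightarrow>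
      M (aT + i * Kq + ckey M i j) = j"
  shows "good M"
  unfolding good_def
proof (intro conjI allI impI)
  fix x assume "x < N"
  then obtain i j k where *: "i < r" "j < m" "k < s"
    "xv M (Gs + i * cs + 2 * k) (walk M (Gs + i * cs) k j) = x"
    "\<And>j'. j' < m \<Longrightarrow> j' \<noteq> j \<Longrightarrow> ckey M i j' \<noteq> ckey M i j"
    using cov unfolding covering_def by metis
  define p where "p = Gs + i * cs"
  have "walk M p s j = walk M p (Suc k + (s - k - 1)) j" using *(3) by simp
  also have "\<dots> = walk M (p + 2 * (k + 1)) (s - k - 1) (G x)"
    using *(4) by (simp only: walk_add p_def) simp
  finally have "kv M (p + 2 * s) (walk M (p + 2 * (k + 1)) (s - k - 1) (G x)) = ckey M i j"
    by (simp add: ckey_def p_def)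
  then have "probe M i k (G x) = x"
    using tab[OF *(1,2,5)] *(4) by (simp add: probe_def Let_def p_def)
  then show "\<exists>i<r. \<exists>k<s. probe M i k (G x) = x" using * by auto
qed (rule smp)

lemma walk_cong:
  "(\<And>a. p \<le> a \<Longrightarrow> a < p + 2 * k \<Longrightarrow> M a = M' a) \<Longrightarrow> walk M p k g = walk M' p k g"
proof (induction k)
  case (Suc k)
  then show ?case by (simp add: xv_def hsh_def)
qed simp

lemma ckey_cong:
  assumes "i < r" "\<And>a. Gs \<le> a \<Longrightarrow> a < aT \<Longrightarrow> M a = M' a"
  shows "ckey M i j = ckey M' i j"
proof -
  have "Suc i * cs \<le> r * cs" using assms(1) by (intro mult_le_mono1) simp
  then have "Gs + i * cs + 2 * s + 2 \<le> aT" by (simp add: aT_def cs_def)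
  then show ?thesis using walk_cong[of "Gs + i * cs" s M M' j] assms(2)
    by (simp add: ckey_def kv_def hsh_def)
qed

text \<open>Coverage is estimated for the bare list of seeds but used for the final memory; the two
  agree on the seed region.\<close>

lemma covering_cong:
  assumes "\<And>a. Gs \<le> a \<Longrightarrow> a < aT \<Longrightarrow> M a = M' a" and cov: "covering M"
  shows "covering M'"
  unfolding covering_def
proof (intro allI impI)
  fix x assume "x < N"
  then obtain i j k where *: "i < r" "j < m" "k < s"
    "xv M (Gs + i * cs + 2 * k) (walk M (Gs + i * cs) k j) = x"
    "\<And>j'. j' < m \<Longrightarrow> j' \<noteq> j \<Longrightarrow> ckey M i j' \<noteq> ckey M i j"
    using cov unfolding covering_def by metis
  have "Suc i * cs \<le> r * cs" using *(1) by (intro mult_le_mono1) simp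
  then have "Gs + i * cs + 2 * k + 2 \<le> aT" using *(3) by (simp add: aT_def cs_def)
  then have "xv M' (Gs + i * cs + 2 * k) (walk M' (Gs + i * cs) k j) = x"
    using *(4) walk_cong[of "Gs + i * cs" k M M' j] assms(1) by (simp add: xv_def hsh_def)
  moreover have "ckey M' i j' \<noteq> ckey M' i j" if "j' < m" "j' \<noteq> j" for j'
    using *(5)[OF that] ckey_cong[OF *(1) assms(1)] by simp
  ultimately show "\<exists>i<r. \<exists>j<m. \<exists>k<s.
     xv M' (Gs + i * cs + 2 * k) (walk M' (Gs + i * cs) k j) = x \<and>
     (\<forall>j'<m. j' \<noteq> j \<longrightarrow> ckey M' i j' \<noteq> ckey M' i j)"
    using *(1-3) by blast
qed

end

section \<open>Correctness of the construction\<close>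

context machine
begin

text \<open>Work areas behind the data structure: three arrays of \<open>V\<close> cells for the
  sorted elements, the output of the passes and the positions, followed by a buffer for values of
  \<open>f\<close>.\<close>

definition benv :: "st \<Rightarrow> bool" where
  "benv q \<longleftrightarrow> env q \<and> rg q 21 = D \<and> rg q 22 = D + V \<and> rg q 23 = D + 2 * V \<and> rg q 25 = D + 3 * V"

lemma benv_setr [simp]: "benv q \<Longrightarrow> 26 \<le> k \<Longrightarrow> benv (setr k v q)"
  by (simp add: benv_def)

lemma benv_set_mem [simp]: "benv (setblk a ws q) = benv q" "benv (setm a v q) = benv q"
  by (simp_all add: benv_def)

lemma benv_keeps: "benv q \<Longrightarrow> keeps h X q q' \<Longrightarrow> 26 \<le> h \<Longrightarrow> benv q'"
  using env_keeps[of q h X q'] by (simp add: benv_def keeps_def)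

lemma benvD [simp]:
  assumes "benv q"
  shows "env q" "rg q 21 = D" "rg q 22 = D + V" "rg q 23 = D + 2 * V" "rg q 25 = D + 3 * V"
  using assms by (simp_all add: benv_def)

lemma lt_W: "a \<le> D + 4 * V + nw \<Longrightarrow> a < 2 ^ W" "a \<le> D + 4 * V \<Longrightarrow> a < 2 ^ W" "a \<le> D \<Longrightarrow> a < 2 ^ W"
  "a \<le> V \<Longrightarrow> a < 2 ^ W"
  using big by simp_all

definition arr :: "nat \<Rightarrow> nat list \<Rightarrow> st \<Rightarrow> bool" where
  "arr a xs q \<longleftrightarrow> (\<forall>i<length xs. mm q (a + i) = xs ! i)"

lemma arr_setr [simp]: "arr a xs (setr k v q) = arr a xs q"
  by (simp add: arr_def)

definition "B_pass = N * (\<tau> + nw + 20) + 3"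

lemma PASS_ok:
  assumes q: "benv q" "rg q 27 = b div W" "rg q 28 = b mod W" "b < w"
    and v: "rg q vr = v" "vr < 26"
    and xs: "length xs = N" "set xs \<subseteq> {..<N}" "arr D xs q"
    and ys: "arr (D + V) ys q" "rg q 29 = D + V + length ys"
      "length ys + length (filter (\<lambda>x. f x div 2 ^ b mod 2 = v) xs) \<le> N"
  shows "ok W ev (PASS vr) B_pass (\<lambda>q'. keeps 29 (D + V) q q' \<and>
     arr (D + V) (ys @ filter (\<lambda>x. f x div 2 ^ b mod 2 = v) xs) q' \<and>
     rg q' 29 = D + V + length (ys @ filter (\<lambda>x. f x div 2 ^ b mod 2 = v) xs)) q"
proof -
  define F where "F j = ys @ filter (\<lambda>x. f x div 2 ^ b mod 2 = v) (take j xs)" for j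
  define I where "I j q' \<longleftrightarrow> keeps 29 (D + V) q q' \<and> arr (D + V) (F j) q' \<and>
    rg q' 29 = D + V + length (F j)" for j q'
  have "ok W ev (PASS vr) B_pass (I N) q"
    unfolding PASS_def
  proof (rule ok_for[where B="\<tau> + nw + 17"])
    show "I 0 (setr 30 0 q)" using ys by (simp add: I_def F_def)
    show "N < 2 ^ W" using lt_W(4) N_le_V .
    show "N * (\<tau> + nw + 17 + 3) + 3 \<le> B_pass" by (simp add: B_pass_def)
  next
    fix j q' assume "I j q'"
    then have "benv q'" using benv_keeps[OF q(1)] by (auto simp: I_def)
    then show "rg q' 0 = N \<and> rg q' 7 = 1" by simp
  next
    fix j q' assume j: "j < N" "rg q' 30 = j" "I j q'"
    have q': "benv q'" using benv_keeps[OF q(1)] j by (auto simp: I_def)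
    have r': "rg q' 27 = b div W" "rg q' 28 = b mod W" "rg q' vr = v" "rg q' 29 = D + V + length (F j)"
      using j q v by (auto simp: I_def keeps_def)
    define x where "x = xs ! j"
    have "x \<in> set xs" using xs(1) j(1) by (simp add: x_def)
    then have x: "x < N" using xs(2) by auto
    then obtain t where t: "t \<le> \<tau>" "ev x = Some (t, encode W w (f x))" using ev by blast
    have mx: "mm q' (D + j) = x"
      using xs(1,3) j N_le_V by (simp add: I_def keeps_def arr_def x_def)
    have bw: "b div W < nw"
    proof -
      have "b < W * nw" using q(4) num_words_ge[of W w] by (simp add: nw_def)
      then show ?thesis by (simp add: div_less_iff_less_mult mult.commute)
    qed
    \<comment> \<open>What has been written never exceeds the final length, so the output array is
      not overrun.\<close>
    have l: "length (F j) + (if f x div 2 ^ b mod 2 = v then 1 else 0) \<le> N"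
    proof -
      have "length (F (Suc j)) \<le> length (F N)"
      proof -
        have "filter P xs = filter P (take (Suc j) xs) @ filter P (drop (Suc j) xs)" for P
          by (metis append_take_drop_id filter_append)
        from this[of "\<lambda>x. f x div 2 ^ b mod 2 = v"] show ?thesis using xs(1) by (simp add: F_def)
      qed
      also have "\<dots> \<le> N" using ys(3) xs(1) by (simp add: F_def)
      finally show ?thesis using j xs(1) by (simp add: F_def take_Suc_conv_app_nth x_def split: if_splits)
    qed
    have FS: "F (Suc j) = F j @ (if f x div 2 ^ b mod 2 = v then [x] else [])"
      using j xs(1) by (simp add: F_def take_Suc_conv_app_nth x_def)
    define q1 where "q1 = setblk (D + 3 * V) (encode W w (f x)) (setr 32 x (setr 31 (D + j) q'))"
    have b1: "benv q1" using q' by (simp add: q1_def)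
    have m1: "mm q1 (D + 3 * V + b div W) = f x div 2 ^ (W * (b div W)) mod 2 ^ W"
      using bw by (simp add: q1_def nw_def[symmetric] encode_nth)
    have lts: "D + j < 2 ^ W" "D + 3 * V + b div W < 2 ^ W" "D + V + length (F j) + 1 < 2 ^ W"
      using j(1) N_le_V bw l pos_params(1) by (intro lt_W(1); simp split: if_splits)+
    have k1: "keeps 29 (D + V) q q1" using j(3) by (auto simp: I_def keeps_def q1_def)
    have a1: "arr (D + V) (F j) q1" using j(3) l N_le_V
      by (auto simp: I_def q1_def arr_def split: if_splits)
    have r1: "rg q1 27 = b div W" "rg q1 28 = b mod W" "rg q1 vr = v" "rg q1 29 = D + V + length (F j)"
      "rg q1 30 = j" "rg q1 32 = x"
      using r' v(2) j(2) by (simp_all add: q1_def)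
    have "ok W ev (add 31 25 27 ;; load 31 31 ;; shr 31 31 28 ;;
       Bas (Arith And 31 31 7) ;; IfEq 31 vr (store 29 32 ;; add 29 29 7) Skip) 8
       (\<lambda>s''. rg s'' 30 = j \<and> rg s'' 7 = 1 \<and> I (Suc j) (setr 30 (Suc j) s'')) q1"
    proof -
      have bit: "drop_bit (b mod W) (f x div 2 ^ (W * (b div W)) mod 2 ^ W) AND Suc 0 = f x div 2 ^ b mod 2"
        using bit_word[of b "f x"] by simp
      show ?thesis
        unfolding ok_def wp_Seq wp_simps wp_If eval_binop.simps setr_sel
        using b1 r1 lts m1 bit v(2) k1 a1 N_le_V
        by (auto simp: I_def FS keeps_def arr_def nth_append)
    qed
    then have "wp W ev (add 31 25 27 ;; load 31 31 ;; shr 31 31 28 ;;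
       Bas (Arith And 31 31 7) ;; IfEq 31 vr (store 29 32 ;; add 29 29 7) Skip)
       (\<lambda>t' s''. 3 + t + nw + t' \<le> \<tau> + nw + 17 \<and> rg s'' 30 = j \<and> rg s'' 7 = 1 \<and>
          I (Suc j) (setr 30 (Suc j) s'')) q1"
      unfolding ok_def by (rule wp_mono) (use t(1) in auto)
    then have "wp W ev (Ev 25 32 ;; add 31 25 27 ;; load 31 31 ;; shr 31 31 28 ;;
       Bas (Arith And 31 31 7) ;; IfEq 31 vr (store 29 32 ;; add 29 29 7) Skip)
       (\<lambda>t' s''. 2 + t' \<le> \<tau> + nw + 17 \<and> rg s'' 30 = j \<and> rg s'' 7 = 1 \<and>
          I (Suc j) (setr 30 (Suc j) s'')) (setr 32 x (setr 31 (D + j) q'))"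
      unfolding wp_Seq[of _ _ "Ev 25 32"]
      by (intro wp_Ev[of ev _ _ t "encode W w (f x)"])
         (use t(2) q' in \<open>auto simp: q1_def nw_def[symmetric] elim!: wp_mono\<close>)
    then show "ok W ev (add 31 21 30 ;; load 32 31 ;; Ev 25 32 ;; add 31 25 27 ;; load 31 31 ;; shr 31 31 28 ;;
       Bas (Arith And 31 31 7) ;; IfEq 31 vr (store 29 32 ;; add 29 29 7) Skip) (\<tau> + nw + 17)
       (\<lambda>s''. rg s'' 30 = j \<and> rg s'' 7 = 1 \<and> I (Suc j) (setr 30 (Suc j) s'')) q'"
      unfolding ok_def wp_Seq[of _ _ "add 31 21 30"] wp_Seq[of _ _ "load 32 31"] wp_simps
        eval_binop.simps
      using q' j(2) mx lts(1) by (auto elim!: wp_mono simp del: wp_Seq wp_simps)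
  qed
  then show ?thesis by (rule ok_mono) (use xs(1) in \<open>auto simp: I_def F_def\<close>)
qed

definition "B_copy = N * 7 + 3"

lemma COPY_ok:
  assumes q: "benv q" "length zs = N" "arr (D + V) zs q"
  shows "ok W ev COPY B_copy (\<lambda>q'. keeps 30 D q q' \<and> arr D zs q' \<and>
     (\<forall>a\<ge>D + N. mm q' a = mm q a)) q"
proof -
  define I where "I j q' \<longleftrightarrow> keeps 30 D q q' \<and> (\<forall>i<j. mm q' (D + i) = zs ! i) \<and>
     (\<forall>a\<ge>D + N. mm q' a = mm q a)" for j q'
  have "ok W ev COPY B_copy (I N) q"
    unfolding COPY_def
  proof (rule ok_for[where B=4])
    show "I 0 (setr 30 0 q)" by (simp add: I_def)
    show "N < 2 ^ W" using lt_W(4) N_le_V .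
    show "N * (4 + 3) + 3 \<le> B_copy" by (simp add: B_copy_def)
  next
    fix j q' assume "I j q'"
    then have "benv q'" using benv_keeps[OF q(1)] by (auto simp: I_def)
    then show "rg q' 0 = N \<and> rg q' 7 = 1" by simp
  next
    fix j q' assume j: "j < N" "rg q' 30 = j" "I j q'"
    have q': "benv q'" using benv_keeps[OF q(1)] j by (auto simp: I_def)
    have "mm q' (D + V + j) = zs ! j" using j q(2,3) N_le_V by (simp add: I_def arr_def)
    moreover have "D + V + j < 2 ^ W" "D + j < 2 ^ W" using j N_le_V by (intro lt_W(2); simp)+
    ultimately show "ok W ev (add 31 22 30 ;; load 32 31 ;; add 31 21 30 ;; store 31 32) 4
       (\<lambda>s''. rg s'' 30 = j \<and> rg s'' 7 = 1 \<and> I (Suc j) (setr 30 (Suc j) s'')) q'"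
      using q' j by (auto simp: ok_def I_def keeps_def less_Suc_eq)
  qed
  then show ?thesis by (rule ok_mono) (use q(2) in \<open>auto simp: I_def arr_def\<close>)
qed

text \<open>Only the first \<open>N\<close> cells are permuted; the identity on the other cells is
  the order of the padding.\<close>

definition sorted_upto :: "nat \<Rightarrow> st \<Rightarrow> bool" where
  "sorted_upto b q \<longleftrightarrow> (\<exists>xs. srt b xs \<and> arr D xs q) \<and> (\<forall>i. N \<le> i \<and> i < V \<longrightarrow> mm q (D + i) = i)"

definition "B_bit = 2 * B_pass + B_copy + 3"

lemma BIT_ok:
  assumes q: "benv q" "rg q 26 = b" "b < w" "sorted_upto b q"
  shows "ok W ev ((Bas (Arith Div 27 26 2) ;; Bas (Arith Mod 28 26 2) ;; mov 29 22) ;;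
       PASS 24 ;; PASS 7 ;; COPY) B_bit (\<lambda>q'. keeps 27 D q q' \<and> sorted_upto (Suc b) q') q"
proof -
  obtain xs where xs: "srt b xs" "arr D xs q" using q by (auto simp: sorted_upto_def)
  have len: "length xs = N" and set: "set xs \<subseteq> {..<N}"
    using srt_length[OF xs(1)] xs(1) by (auto simp: srt_def)
  define z0 where "z0 = filter (\<lambda>x. f x div 2 ^ b mod 2 = 0) xs"
  define z1 where "z1 = filter (\<lambda>x. f x div 2 ^ b mod 2 = 1) xs"
  have s: "srt (Suc b) (z0 @ z1)" using srt_Suc[OF xs(1)] by (simp add: z0_def z1_def)
  have l: "length (z0 @ z1) = N" using srt_length[OF s] .
  define q1 where "q1 = setr 29 (D + V) (setr 28 (b mod W) (setr 27 (b div W) q))"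
  have b1: "benv q1" using q by (simp add: q1_def)
  show ?thesis
  proof (rule ok_seq[where ?B1.0=3 and R="\<lambda>q'. q' = q1" and ?B2.0="B_pass + (B_pass + B_copy)"])
    show "ok W ev (Bas (Arith Div 27 26 2) ;; Bas (Arith Mod 28 26 2) ;; mov 29 22) 3 (\<lambda>q'. q' = q1) q"
      using q by (simp add: ok_def q1_def)
    show "ok W ev (PASS 24 ;; PASS 7 ;; COPY) (B_pass + (B_pass + B_copy))
      (\<lambda>q'. keeps 27 D q q' \<and> sorted_upto (Suc b) q') q'" if "q' = q1" for q' unfolding that
    proof (rule ok_seq[OF PASS_ok[where b=b and v=0 and xs=xs and ys="[]"]])
      show "benv q1" "rg q1 27 = b div W" "rg q1 28 = b mod W" "b < w" "rg q1 24 = 0" "(24::nat) < 26"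
        "length xs = N" "set xs \<subseteq> {..<N}" "arr D xs q1" "arr (D + V) [] q1"
        "rg q1 29 = D + V + length []"
        "length [] + length (filter (\<lambda>x. f x div 2 ^ b mod 2 = 0) xs) \<le> N"
        using b1 q(1,3) len set xs(2) l by (simp_all add: z0_def q1_def arr_def)
      fix q2 assume q2: "keeps 29 (D + V) q1 q2 \<and>
         arr (D + V) ([] @ filter (\<lambda>x. f x div 2 ^ b mod 2 = 0) xs) q2 \<and>
         rg q2 29 = D + V + length ([] @ filter (\<lambda>x. f x div 2 ^ b mod 2 = 0) xs)"
      have b2: "benv q2" using benv_keeps[OF b1] q2 by auto
      show "ok W ev (PASS 7 ;; COPY) (B_pass + B_copy) (\<lambda>q'. keeps 27 D q q' \<and> sorted_upto (Suc b) q') q2"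
      proof (rule ok_seq[OF PASS_ok[where b=b and v=1 and xs=xs and ys=z0]])
        show "benv q2" "rg q2 27 = b div W" "rg q2 28 = b mod W" "b < w" "rg q2 7 = 1" "(7::nat) < 26"
          "length xs = N" "set xs \<subseteq> {..<N}" "arr D xs q2" "arr (D + V) z0 q2"
          "rg q2 29 = D + V + length z0"
          "length z0 + length (filter (\<lambda>x. f x div 2 ^ b mod 2 = 1) xs) \<le> N"
          using b2 q(3) len set xs(2) l q2 N_le_V
          by (simp_all add: z0_def z1_def q1_def arr_def keeps_def)
        fix q3 assume q3: "keeps 29 (D + V) q2 q3 \<and>
           arr (D + V) (z0 @ filter (\<lambda>x. f x div 2 ^ b mod 2 = 1) xs) q3 \<and>
           rg q3 29 = D + V + length (z0 @ filter (\<lambda>x. f x div 2 ^ b mod 2 = 1) xs)"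
        have b3: "benv q3" using benv_keeps[OF b2] q3 by auto
        show "ok W ev COPY B_copy (\<lambda>q'. keeps 27 D q q' \<and> sorted_upto (Suc b) q') q3"
        proof (rule ok_mono[OF COPY_ok[where zs="z0 @ z1"]])
          show "benv q3" "length (z0 @ z1) = N" "arr (D + V) (z0 @ z1) q3"
            using b3 l q3 by (simp_all add: z1_def)
          fix q4 assume q4: "keeps 30 D q3 q4 \<and> arr D (z0 @ z1) q4 \<and> (\<forall>a\<ge>D + N. mm q4 a = mm q3 a)"
          have k: "keeps 27 (D + V) q q3" using q2 q3 by (auto simp: keeps_def q1_def)
          have "\<forall>i. N \<le> i \<and> i < V \<longrightarrow> mm q4 (D + i) = i"
            using q4 k q(4) by (auto simp: keeps_def sorted_upto_def)
          then show "keeps 27 D q q4 \<and> sorted_upto (Suc b) q4"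
            using s q4 k by (auto simp: sorted_upto_def keeps_def)
        qed simp
      qed simp
    qed simp
  qed (simp add: B_bit_def)
qed

definition sorted_mem :: "st \<Rightarrow> bool" where
  "sorted_mem q \<longleftrightarrow> (\<forall>i<V. mm q (D + i) < V \<and> pos (mm q (D + i)) = i)"

lemma sorted_mem:
  assumes "sorted_upto w q"
  shows "sorted_mem q"
  unfolding sorted_mem_def
proof (intro allI impI)
  fix i assume i: "i < V"
  obtain xs where xs: "srt w xs" "arr D xs q" using assms by (auto simp: sorted_upto_def)
  show "mm q (D + i) < V \<and> pos (mm q (D + i)) = i"
  proof (cases "i < N")
    case True
    then have e: "mm q (D + i) = xs ! i" using xs srt_length[OF xs(1)] by (simp add: arr_def)
    have "xs ! i \<in> set xs" using True srt_length[OF xs(1)] by simp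
    then have "xs ! i < N" using xs(1) by (simp add: srt_def)
    then show ?thesis using e srt_pos[OF xs(1) True] N_le_V by simp
  next
    case False
    then show ?thesis using assms i by (simp add: sorted_upto_def pos_def)
  qed
qed

definition "B_sort = V * 5 + w * (B_bit + 3) + 6"

lemma SORT_ok:
  assumes q: "benv q"
  shows "ok W ev SORT B_sort (\<lambda>q'. keeps 26 D q q' \<and> sorted_mem q') q"
  unfolding SORT_def
proof (rule ok_seq[where ?B1.0="V * 5 + 3" and ?B2.0="w * (B_bit + 3) + 3" and
    R="\<lambda>q'. keeps 26 D q q' \<and> (\<forall>i<V. mm q' (D + i) = i)"])
  show "ok W ev (For 26 8 (add 27 21 26 ;; store 27 26)) (V * 5 + 3)
    (\<lambda>q'. keeps 26 D q q' \<and> (\<forall>i<V. mm q' (D + i) = i)) q"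
  proof (rule ok_for[where B=2 and n=V and
      I="\<lambda>j q'. keeps 26 D q q' \<and> (\<forall>i<j. mm q' (D + i) = i)"])
    show "V < 2 ^ W" using lt_W(4) by simp
  next
    fix j q' assume "keeps 26 D q q' \<and> (\<forall>i<j. mm q' (D + i) = i)"
    then have "benv q'" using benv_keeps[OF q] by auto
    then show "rg q' 8 = V \<and> rg q' 7 = 1" by simp
  next
    fix j q' assume j: "j < V" "rg q' 26 = j" "keeps 26 D q q' \<and> (\<forall>i<j. mm q' (D + i) = i)"
    have q': "benv q'" using benv_keeps[OF q] j by auto
    moreover have "D + j < 2 ^ W" using j by (intro lt_W(2)) simp
    ultimately show "ok W ev (add 27 21 26 ;; store 27 26) 2 (\<lambda>s''. rg s'' 26 = j \<and> rg s'' 7 = 1 \<and>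
      keeps 26 D q (setr 26 (Suc j) s'') \<and> (\<forall>i<Suc j. mm (setr 26 (Suc j) s'') (D + i) = i)) q'"
      using j by (auto simp: ok_def keeps_def less_Suc_eq)
  qed simp_all
next
  fix q1 assume q1: "keeps 26 D q q1 \<and> (\<forall>i<V. mm q1 (D + i) = i)"
  have b1: "benv q1" using benv_keeps[OF q] q1 by auto
  let ?body = "(Bas (Arith Div 27 26 2) ;; Bas (Arith Mod 28 26 2) ;; mov 29 22) ;;
       PASS 24 ;; PASS 7 ;; COPY"
  define I where "I j q' \<longleftrightarrow> keeps 26 D q1 q' \<and> sorted_upto j q'" for j q'
  have "ok W ev (For 26 1 ?body) (w * (B_bit + 3) + 3) (I w) q1"
  proof (rule ok_for[where B=B_bit])
    have "arr D [0..<N] q1" using q1 N_le_V by (simp add: arr_def)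
    then have "sorted_upto 0 q1" using q1 srt_0 by (auto simp: sorted_upto_def)
    then show "I 0 (setr 26 0 q1)" by (simp add: I_def sorted_upto_def)
    show "w < 2 ^ W" using big by simp
  next
    fix j q' assume "I j q'"
    then have "benv q'" using benv_keeps[OF b1] by (auto simp: I_def)
    then show "rg q' 1 = w \<and> rg q' 7 = 1" by simp
  next
    fix j q' assume j: "j < w" "rg q' 26 = j" "I j q'"
    have q': "benv q'" using benv_keeps[OF b1] j by (auto simp: I_def)
    show "ok W ev ?body B_bit (\<lambda>s''. rg s'' 26 = j \<and> rg s'' 7 = 1 \<and> I (Suc j) (setr 26 (Suc j) s'')) q'"
    proof (rule ok_mono[OF BIT_ok])
      show "benv q'" "rg q' 26 = j" "j < w" "sorted_upto j q'" using q' j by (auto simp: I_def)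
      fix q2 assume q2: "keeps 27 D q' q2 \<and> sorted_upto (Suc j) q2"
      have "benv q2" using benv_keeps[OF q'] q2 by auto
      then show "rg q2 26 = j \<and> rg q2 7 = 1 \<and> I (Suc j) (setr 26 (Suc j) q2)"
        using q2 j by (auto simp: I_def keeps_def sorted_upto_def)
    qed simp
  qed simp
  then show "ok W ev (For 26 1 ?body) (w * (B_bit + 3) + 3) (\<lambda>q'. keeps 26 D q q' \<and> sorted_mem q') q1"
    by (rule ok_mono) (use q1 sorted_mem in \<open>auto simp: I_def keeps_def\<close>)
qed (simp add: B_sort_def)

definition pos_mem :: "st \<Rightarrow> bool" where
  "pos_mem q \<longleftrightarrow> (\<forall>u<V. mm q (D + 2 * V + u) = pos u)"

lemma pos_inj: "u < V \<Longrightarrow> v < V \<Longrightarrow> pos u = pos v \<Longrightarrow> u = v"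
  using pos_bij by (auto simp: bij_betw_def inj_on_def)

text \<open>Writing \<open>j\<close> at the element found in cell \<open>j\<close> inverts the
  permutation. The invariant speaks of elements with position below \<open>j\<close>, and
  injectivity of \<open>pos\<close> excludes overwriting.\<close>

lemma POS_ok:
  assumes q: "benv q" "sorted_mem q"
  shows "ok W ev POS (V * 7 + 3) (\<lambda>q'. keeps 26 (D + 2 * V) q q' \<and> pos_mem q') q"
proof -
  define I where "I j q' \<longleftrightarrow> keeps 26 (D + 2 * V) q q' \<and>
     (\<forall>u<V. pos u < j \<longrightarrow> mm q' (D + 2 * V + u) = pos u)" for j q'
  have "ok W ev POS (V * 7 + 3) (I V) q"
    unfolding POS_def
  proof (rule ok_for[where B=4])
    show "I 0 (setr 26 0 q)" by (simp add: I_def)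
    show "V < 2 ^ W" using lt_W(4) by simp
  next
    fix j q' assume "I j q'"
    then have "benv q'" using benv_keeps[OF q(1)] by (auto simp: I_def)
    then show "rg q' 8 = V \<and> rg q' 7 = 1" by simp
  next
    fix j q' assume j: "j < V" "rg q' 26 = j" "I j q'"
    have q': "benv q'" using benv_keeps[OF q(1)] j by (auto simp: I_def)
    define u where "u = mm q (D + j)"
    have u: "u < V" "pos u = j" using q(2) j by (auto simp: sorted_mem_def u_def)
    have m: "mm q' (D + j) = u" using j by (simp add: I_def keeps_def u_def)
    have step: "((mm q')(D + 2 * V + u := j)) (D + 2 * V + v) = pos v" if "v < V" "pos v < Suc j" for v
    proof (cases "v = u")
      case False
      then have "pos v < j" using that u pos_inj[of v u] by (auto simp: less_Suc_eq)
      then show ?thesis using that(1) j False by (simp add: I_def)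
    qed (simp add: u)
    have "D + j < 2 ^ W" "D + 2 * V + u < 2 ^ W" using j u by (intro lt_W(2); simp)+
    moreover have "I (Suc j) (setr 26 (Suc j) (setm (D + 2 * V + u) j (setr 27 (D + 2 * V + u) (setr 27 u (setr 27 (D + j) q')))))"
      using j step by (simp add: I_def keeps_def)
    ultimately show "ok W ev (add 27 21 26 ;; load 27 27 ;; add 27 23 27 ;; store 27 26) 4
       (\<lambda>s''. rg s'' 26 = j \<and> rg s'' 7 = 1 \<and> I (Suc j) (setr 26 (Suc j) s'')) q'"
      using q' j(2) m by (simp add: ok_def)
  qed simp
  moreover have "pos u < V" if "u < V" for u using that pos_bij by (auto simp: bij_betw_def)
  ultimately show ?thesis by (auto elim!: ok_mono simp: I_def pos_mem_def)
qed

text \<open>Cell \<open>g * s\<close> of the sorted array holds the only element with that position.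
  The samples are written from address 0 on, hence \<open>keeps\<close> with memory bound 0.\<close>

lemma SMP_ok:
  assumes q: "benv q" "sorted_mem q"
  shows "ok W ev SMP (Gs * 7 + 3) (\<lambda>q'. keeps 26 0 q q' \<and> (\<forall>g<Gs. mm q' g = smp g) \<and>
     (\<forall>a\<ge>Gs. mm q' a = mm q a)) q"
proof -
  define I where "I j q' \<longleftrightarrow> keeps 26 0 q q' \<and> (\<forall>g<j. mm q' g = smp g) \<and>
     (\<forall>a\<ge>Gs. mm q' a = mm q a)" for j q'
  have "ok W ev SMP (Gs * 7 + 3) (I Gs) q"
    unfolding SMP_def
  proof (rule ok_for[where B=4])
    show "I 0 (setr 26 0 q)" by (simp add: I_def)
    show "Gs < 2 ^ W" using lt_W(4) Gs_le_V(1) .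
  next
    fix j q' assume "I j q'"
    then have "benv q'" using benv_keeps[OF q(1)] by (auto simp: I_def)
    then show "rg q' 14 = Gs \<and> rg q' 7 = 1" by simp
  next
    fix j q' assume j: "j < Gs" "rg q' 26 = j" "I j q'"
    have q': "benv q'" using benv_keeps[OF q(1)] j by (auto simp: I_def)
    have js: "j * s < V" using j Gs_s pos_params by (metis mult_less_cancel2)
    then have "pos (mm q (D + j * s)) = j * s" "mm q (D + j * s) < V"
      using q(2) by (auto simp: sorted_mem_def)
    then have "mm q (D + j * s) = smp j" using smp[OF j(1)] pos_inj by simp
    moreover have "mm q' (D + j * s) = mm q (D + j * s)"
      using j by (simp add: I_def D_def aT_def)
    moreover have "D + j * s < 2 ^ W" "j * s < 2 ^ W" using js by (intro lt_W(2); simp)+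
    ultimately show "ok W ev (mul 27 26 10 ;; add 27 21 27 ;; load 27 27 ;; store 26 27) 4
       (\<lambda>s''. rg s'' 26 = j \<and> rg s'' 7 = 1 \<and> I (Suc j) (setr 26 (Suc j) s'')) q'"
      using q' j by (auto simp: ok_def I_def keeps_def less_Suc_eq)
  qed simp
  then show ?thesis by (auto elim!: ok_mono simp: I_def)
qed

lemma SEEDS_ok:
  assumes q: "env q" "rnd q = \<omega>" "r * cs \<le> length \<omega>"
  shows "ok W ev SEEDS (r * cs * 6 + 8) (\<lambda>q'. benv q' \<and> (\<forall>i<r * cs. mm q' (Gs + i) = \<omega> ! i)) q"
  unfolding SEEDS_def
proof -
  let ?K = "r * cs"
  let ?blk = "mov 21 20 ;; add 22 20 8 ;; add 23 22 8 ;; add 25 23 8 ;; mul 27 17 18"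
  let ?body = "Rnd 28 ;; add 29 14 26 ;; store 29 28"
  have K: "Gs + ?K \<le> D" by (simp add: D_def aT_def)
  define q1 where "q1 = setr 27 ?K (setr 25 (D + 3 * V) (setr 23 (D + 2 * V) (setr 22 (D + V) (setr 21 D q))))"
  have b1: "benv q1" using q(1)
    by (simp add: benv_def q1_def env_def del: env_simps benvD)
  define I where "I j q' \<longleftrightarrow> keeps 26 0 q1 q' \<and> rg q' 27 = ?K \<and> rnd q' = drop j \<omega> \<and>
     (\<forall>i<j. mm q' (Gs + i) = \<omega> ! i)" for j q'
  have loop: "ok W ev (For 26 27 ?body) (?K * 6 + 3) (I ?K) q1"
  proof (rule ok_for[where B=3])
    show "I 0 (setr 26 0 q1)" using q by (simp add: I_def q1_def)
    show "?K < 2 ^ W" using K by (intro lt_W(3)) simp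
  next
    fix j q' assume "I j q'"
    then show "rg q' 27 = ?K \<and> rg q' 7 = 1" using benv_keeps[OF b1, of 26 0 q'] by (simp add: I_def)
  next
    fix j q' assume j: "j < ?K" "rg q' 26 = j" "I j q'"
    have q': "benv q'" using benv_keeps[OF b1] j by (auto simp: I_def)
    have rn: "rnd q' = \<omega> ! j # drop (Suc j) \<omega>" using j q(3) by (simp add: I_def Cons_nth_drop_Suc)
    have "Gs + j < 2 ^ W" using j K by (intro lt_W(3)) simp
    moreover have "rg q' 14 = Gs" "rg q' 7 = 1" using q' by simp_all
    ultimately show "ok W ev ?body 3
       (\<lambda>s''. rg s'' 26 = j \<and> rg s'' 7 = 1 \<and> I (Suc j) (setr 26 (Suc j) s'')) q'"
      unfolding ok_def wp_Seq[of _ _ "Rnd 28"] using j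
      by (intro wp_Rnd[OF rn]) (auto simp: I_def keeps_def less_Suc_eq)
  qed simp
  show "ok W ev ((?blk) ;; For 26 27 ?body) (r * cs * 6 + 8)
    (\<lambda>q'. benv q' \<and> (\<forall>i<r * cs. mm q' (Gs + i) = \<omega> ! i)) q"
  proof (rule ok_seq[where ?B1.0=5 and R="\<lambda>q'. q' = q1" and ?B2.0="?K * 6 + 3"])
    have "?K < 2 ^ W" using K by (intro lt_W(3)) simp
    moreover have "D + V < 2 ^ W" "D + V + V < 2 ^ W" "D + V + V + V < 2 ^ W" by (intro lt_W(2); simp)+
    moreover have e: "D + V + V = D + 2 * V" "D + V + V + V = D + 3 * V" by simp_all
    ultimately show "ok W ev ?blk 5 (\<lambda>q'. q' = q1) q"
      unfolding q1_def ok_def wp_Seq wp_simps eval_binop.simps setr_sel e[symmetric]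
      using q(1) by simp
    show "ok W ev (For 26 27 ?body) (?K * 6 + 3) (\<lambda>q'. benv q' \<and> (\<forall>i<r * cs. mm q' (Gs + i) = \<omega> ! i)) q'"
      if "q' = q1" for q' unfolding that
      by (rule ok_mono[OF loop]) (use benv_keeps[OF b1] in \<open>auto simp: I_def\<close>)
  qed simp
qed

definition "B_chain = s * 14 + 13"

text \<open>\<open>M\<close> has to agree with the memory on the seeds only, so it can stay fixed
  while the tables fill up.\<close>

lemma CHAIN_ok:
  assumes q: "benv q" "pos_mem q" "rg q 32 = Gs + i * cs" "rg q 33 = aT + i * Kq" "rg q 27 = j" "i < r"
    and M: "\<And>a. Gs \<le> a \<Longrightarrow> a < aT \<Longrightarrow> mm q a = M a"
  shows "ok W ev CHAIN B_chain (\<lambda>q'. keeps 38 0 q q' \<and>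
     mm q' = (mm q)(aT + i * Kq + ckey M i j := j)) q"
proof -
  define p where "p = Gs + i * cs"
  have "Suc i * cs \<le> r * cs" using q(6) by (intro mult_le_mono1) simp
  then have p: "p + 2 * s + 2 \<le> aT" by (simp add: aT_def cs_def p_def)
  have "Suc i * Kq \<le> r * Kq" using q(6) by (intro mult_le_mono1) simp
  moreover have "ckey M i j < Kq" by (simp add: ckey_def kv_less)
  ultimately have t: "aT + i * Kq + ckey M i j < D" by (simp add: D_def)
  have aD: "aT \<le> D" by (simp add: D_def)
  define I where "I l q' \<longleftrightarrow> keeps 38 0 q q' \<and> mm q' = mm q \<and> rg q' 38 = walk M p l j \<and>
    rg q' 40 = p + 2 * l" for l q'
  define q1 where "q1 = setr 40 p (setr 38 j q)"
  let ?blk = "shr 42 42 12 ;; add 42 23 42 ;; load 42 42 ;; shr 38 42 11 ;; add 40 40 7 ;; add 40 40 7"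
  have loop: "ok W ev (For 41 10 (HASH ;; (?blk))) (s * 14 + 3) (I s) q1"
  proof (rule ok_for[where B=11])
    show "I 0 (setr 41 0 q1)" by (simp add: I_def q1_def)
    show "s < 2 ^ W" using lt_W(4) Gs_le_V(2) .
  next
    fix l q' assume "I l q'"
    then have "benv q'" using benv_keeps[OF q(1)] by (auto simp: I_def)
    then show "rg q' 10 = s \<and> rg q' 7 = 1" by simp
  next
    fix l q' assume l: "l < s" "rg q' 41 = l" "I l q'"
    have q': "benv q'" using benv_keeps[OF q(1)] l by (auto simp: I_def)
    have bl: "p + 2 * l + 2 \<le> D" "p + 2 * l + 2 < aT" using l p aD by auto
    define x where "x = xv M (p + 2 * l) (walk M p l j)"
    show "ok W ev (HASH ;; (?blk)) 11
       (\<lambda>s''. rg s'' 41 = l \<and> rg s'' 7 = 1 \<and> I (Suc l) (setr 41 (Suc l) s'')) q'"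
    proof (rule ok_seq[OF HASH_ok[where X=0], where ?B2.0=6])
      show "env q'" "rg q' 40 = p + 2 * l" "rg q' 38 = walk M p l j"
        using q' l by (auto simp: I_def)
      show "p + 2 * l + 1 < 2 ^ W" using bl by (intro lt_W(3)) simp
      fix q2 assume q2: "keeps 42 0 q' q2 \<and> mm q2 = mm q' \<and> rg q2 42 = hsh (mm q') (p + 2 * l) (walk M p l j)"
      have b2: "benv q2" using benv_keeps[OF q'] q2 by auto
      have "rg q2 42 = hsh M (p + 2 * l) (walk M p l j)"
        using q2 l M bl by (simp add: I_def hsh_def p_def)
      then have x: "drop_bit (W - n) (rg q2 42) = x" by (simp add: x_def xv_def)
      have xV: "x < V" by (simp add: x_def xv_less)
      have mx: "mm q2 (D + 2 * V + x) = pos x" using q(2) l q2 xV by (simp add: I_def pos_mem_def)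
      have lt: "D + 2 * V + x < 2 ^ W" "p + 2 * l + 1 < 2 ^ W" "p + 2 * l + 2 < 2 ^ W"
        using xV bl by (intro lt_W(2); simp)+
      have r2: "rg q2 40 = p + 2 * l" "rg q2 41 = l" "keeps 38 0 q q2" "mm q2 = mm q"
        using q2 l by (auto simp: I_def keeps_def)
      have g: "drop_bit sg (pos x) = G x" by (simp add: G_def s_def drop_bit_eq_div)
      show "ok W ev ?blk 6
         (\<lambda>s''. rg s'' 41 = l \<and> rg s'' 7 = 1 \<and> I (Suc l) (setr 41 (Suc l) s'')) q2"
        unfolding ok_def wp_Seq wp_simps eval_binop.simps setr_sel
        using b2 x mx lt r2 g by (simp add: I_def x_def[symmetric] keeps_def)
    qed simp
  qed simp
  show ?thesis unfolding CHAIN_def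
  proof (rule ok_seq[where ?B1.0=2 and R="\<lambda>q'. q' = q1" and ?B2.0="s * 14 + 11"])
    show "ok W ev (mov 38 27 ;; mov 40 32) 2 (\<lambda>q'. q' = q1) q"
      using q by (simp add: ok_def q1_def p_def)
    show "ok W ev (For 41 10 (HASH ;; (?blk)) ;; HASH ;; (shr 42 42 13 ;; add 42 33 42 ;; store 42 27))
      (s * 14 + 11) (\<lambda>q'. keeps 38 0 q q' \<and> mm q' = (mm q)(aT + i * Kq + ckey M i j := j)) q'"
      if "q' = q1" for q' unfolding that
    proof (rule ok_seq[OF loop, where ?B2.0=8])
      fix q2 assume q2: "I s q2"
      have b2: "benv q2" using benv_keeps[OF q(1)] q2 by (auto simp: I_def)
      show "ok W ev (HASH ;; (shr 42 42 13 ;; add 42 33 42 ;; store 42 27)) 8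
         (\<lambda>q'. keeps 38 0 q q' \<and> mm q' = (mm q)(aT + i * Kq + ckey M i j := j)) q2"
      proof (rule ok_seq[OF HASH_ok[where X=0], where ?B2.0=3])
        show "env q2" "rg q2 40 = p + 2 * s" "rg q2 38 = walk M p s j" using b2 q2 by (auto simp: I_def)
        show "p + 2 * s + 1 < 2 ^ W" using p aD by (intro lt_W(3)) simp
        fix q3 assume q3: "keeps 42 0 q2 q3 \<and> mm q3 = mm q2 \<and> rg q3 42 = hsh (mm q2) (p + 2 * s) (walk M p s j)"
        have b3: "benv q3" using benv_keeps[OF b2] q3 by auto
        have "rg q3 42 = hsh M (p + 2 * s) (walk M p s j)"
          using q3 q2 M p by (simp add: I_def hsh_def p_def)
        then have "drop_bit (W - (n - 2 * sg)) (rg q3 42) = ckey M i j"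
          by (simp add: ckey_def kv_def p_def)
        moreover have "aT + i * Kq + ckey M i j < 2 ^ W" using t by (intro lt_W(3)) simp
        moreover have "rg q3 33 = aT + i * Kq" "rg q3 27 = j" "mm q3 = mm q" "keeps 38 0 q q3"
          using q3 q2 q by (auto simp: I_def keeps_def)
        ultimately show "ok W ev (shr 42 42 13 ;; add 42 33 42 ;; store 42 27) 3
           (\<lambda>q'. keeps 38 0 q q' \<and> mm q' = (mm q)(aT + i * Kq + ckey M i j := j)) q3"
          using b3 by (simp add: ok_def keeps_def)
      qed simp
    qed simp
  qed (simp add: B_chain_def)
qed

end

definition (in inversion) seed_mem :: "nat list \<Rightarrow> nat \<Rightarrow> nat" where
  "seed_mem \<omega> a = \<omega> ! (a - Gs)"

context machine
begin

text \<open>Slots whose key is shared by several of the \<open>m\<close> chains are left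
  unspecified, as later chains overwrite them.\<close>

definition row_ok :: "(nat \<Rightarrow> nat) \<Rightarrow> nat \<Rightarrow> nat \<Rightarrow> st \<Rightarrow> bool" where
  "row_ok M i l q \<longleftrightarrow> (\<forall>j<l. (\<forall>j'<m. j' \<noteq> j \<longrightarrow> ckey M i j' \<noteq> ckey M i j) \<longrightarrow>
     mm q (aT + i * Kq + ckey M i j) = j)"

lemma row_ok_setr [simp]: "row_ok M i l (setr k v q) = row_ok M i l q"
  by (simp add: row_ok_def)

definition "B_tables = r * (m * (B_chain + 3) + 8) + 5"

lemma TABLES_ok:
  assumes q: "benv q" "pos_mem q"
  shows "ok W ev TABLES B_tables (\<lambda>q'. keeps 26 aT q q' \<and> (\<forall>i<r. row_ok (mm q) i m q')) q"
proof -
  define M where "M = mm q"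
  define q1 where "q1 = setr 33 aT (setr 32 Gs q)"
  define J where "J i j q' \<longleftrightarrow> keeps 26 aT q q' \<and> (\<forall>a\<ge>D. mm q' a = mm q a) \<and> rg q' 32 = Gs + i * cs \<and>
     rg q' 33 = aT + i * Kq \<and> (\<forall>i'<i. row_ok M i' m q') \<and> row_ok M i j q'" for i j q'
  have J_D: "benv q'" "pos_mem q'" "\<And>a. a < aT \<Longrightarrow> mm q' a = M a" if "J i j q'" for i j q'
    using that benv_keeps[OF q(1)] q(2) by (auto simp: J_def pos_mem_def keeps_def M_def)
  have J_setr: "J i j q' \<Longrightarrow> 26 \<le> k \<Longrightarrow> k \<noteq> 32 \<Longrightarrow> k \<noteq> 33 \<Longrightarrow> J i j (setr k v q')" for i j q' k v
    by (simp add: J_def)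
  have row: "ok W ev (For 27 15 CHAIN) (m * (B_chain + 3) + 3) (\<lambda>q'. J i m q' \<and> rg q' 26 = i) q2"
    if i: "i < r" and q2: "J i 0 q2" "rg q2 26 = i" for i q2
  proof (rule ok_for[where B=B_chain and n=m and I="\<lambda>j q'. J i j q' \<and> rg q' 26 = i"])
    show "J i 0 (setr 27 0 q2) \<and> rg (setr 27 0 q2) 26 = i" using q2 by (simp add: J_setr)
    have "m \<le> V" by (simp add: m_def V_def)
    then show "m < 2 ^ W" by (rule lt_W(4))
  next
    fix j q' assume "J i j q' \<and> rg q' 26 = i"
    then have "benv q'" using J_D(1) by blast
    then show "rg q' 15 = m \<and> rg q' 7 = 1" by simp
  next
    fix j q' assume j: "j < m" "rg q' 27 = j" and J: "J i j q' \<and> rg q' 26 = i"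
    have q': "benv q'" "pos_mem q'" using J J_D by blast+
    show "ok W ev CHAIN B_chain (\<lambda>s''. rg s'' 27 = j \<and> rg s'' 7 = 1 \<and>
        J i (Suc j) (setr 27 (Suc j) s'') \<and> rg (setr 27 (Suc j) s'') 26 = i) q'"
    proof (rule ok_mono[OF CHAIN_ok[where M=M and i=i and j=j]])
      show "benv q'" "pos_mem q'" "rg q' 32 = Gs + i * cs" "rg q' 33 = aT + i * Kq" "rg q' 27 = j" "i < r"
        using q' J j i by (auto simp: J_def)
      show "\<And>a. Gs \<le> a \<Longrightarrow> a < aT \<Longrightarrow> mm q' a = M a" using J_D(3) J by blast
      fix q3 assume q3: "keeps 38 0 q' q3 \<and> mm q3 = (mm q')(aT + i * Kq + ckey M i j := j)"
      have kl: "ckey M i' j' < Kq" for i' j' by (simp add: ckey_def kv_less)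
      have "Suc i * Kq \<le> r * Kq" using i by (intro mult_le_mono1) simp
      then have lt: "aT + i * Kq + ckey M i j < D" using kl[of i j] by (simp add: D_def)
      \<comment> \<open>Slots of earlier tables lie in disjoint address ranges.\<close>
      have old: "row_ok M i' m q3" if i': "i' < i" for i'
      proof -
        have "Suc i' * Kq \<le> i * Kq" using i' by (intro mult_le_mono1) simp
        then have "aT + i' * Kq + ckey M i' j' \<noteq> aT + i * Kq + ckey M i j" for j'
          using kl[of i' j'] by simp
        then show ?thesis using J i' q3 by (simp add: J_def row_ok_def)
      qed
      \<comment> \<open>Chain \<open>j\<close> can hit an earlier entry only if the keys agree, and
        such entries are exempt.\<close>
      have new: "row_ok M i (Suc j) q3"
        unfolding row_ok_def
      proof (intro allI impI)
        fix j0 assume j0: "j0 < Suc j" "\<forall>j'<m. j' \<noteq> j0 \<longrightarrow> ckey M i j' \<noteq> ckey M i j0"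
        show "mm q3 (aT + i * Kq + ckey M i j0) = j0"
        proof (cases "j0 = j")
          case False
          then have "ckey M i j \<noteq> ckey M i j0" using j0 j(1) by auto
          then show ?thesis using J q3 j0 False by (auto simp: J_def row_ok_def)
        qed (use q3 in simp)
      qed
      have "benv q3" using benv_keeps[OF q'(1)] q3 by auto
      then show "rg q3 27 = j \<and> rg q3 7 = 1 \<and>
        J i (Suc j) (setr 27 (Suc j) q3) \<and> rg (setr 27 (Suc j) q3) 26 = i"
        using old new q3 J j lt by (auto simp: J_def keeps_def)
    qed simp
  qed simp
  have loop: "ok W ev (For 26 17 (For 27 15 CHAIN ;; add 32 32 18 ;; add 33 33 16))
     (r * (m * (B_chain + 3) + 8) + 3) (J r 0) q1"
  proof (rule ok_for[where B="m * (B_chain + 3) + 5" and I="\<lambda>i. J i 0" and n=r])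
    show "J 0 0 (setr 26 0 q1)" by (simp add: J_def q1_def row_ok_def)
    have "r * 1 \<le> r * cs" by (intro mult_le_mono2) (simp add: cs_def)
    then have "r \<le> D" unfolding D_def aT_def by linarith
    then show "r < 2 ^ W" by (rule lt_W(3))
  next
    fix i q' assume "J i 0 q'"
    then have "benv q'" using J_D(1) by blast
    then show "rg q' 17 = r \<and> rg q' 7 = 1" by simp
  next
    fix i q' assume i: "i < r" "rg q' 26 = i" "J i 0 q'"
    show "ok W ev (For 27 15 CHAIN ;; add 32 32 18 ;; add 33 33 16) (m * (B_chain + 3) + 5)
       (\<lambda>s''. rg s'' 26 = i \<and> rg s'' 7 = 1 \<and> J (Suc i) 0 (setr 26 (Suc i) s'')) q'"
    proof (rule ok_seq[OF row[OF i(1,3,2)], where ?B2.0=2])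
      fix q2 assume q2: "J i m q2 \<and> rg q2 26 = i"
      have b2: "benv q2" using q2 J_D(1) by blast
      have "Suc i * cs \<le> r * cs" "Suc i * Kq \<le> r * Kq" using i(1) by (intro mult_le_mono1; simp)+
      then have "Gs + i * cs + cs < 2 ^ W" "aT + i * Kq + Kq < 2 ^ W"
        by (intro lt_W(3); simp add: D_def aT_def)+
      moreover have "rg q2 32 = Gs + i * cs" "rg q2 33 = aT + i * Kq" using q2 by (simp_all add: J_def)
      moreover have "J (Suc i) 0 (setr 33 (aT + i * Kq + Kq) (setr 32 (Gs + i * cs + cs) q2))"
        using q2 by (auto simp: J_def less_Suc_eq row_ok_def ac_simps)
      ultimately show "ok W ev (add 32 32 18 ;; add 33 33 16) 2
         (\<lambda>s''. rg s'' 26 = i \<and> rg s'' 7 = 1 \<and> J (Suc i) 0 (setr 26 (Suc i) s'')) q2"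
        using b2 q2 by (simp add: ok_def J_setr)
    qed simp
  qed simp
  show ?thesis unfolding TABLES_def
  proof (rule ok_seq[where ?B1.0=2 and R="\<lambda>q'. q' = q1" and ?B2.0="r * (m * (B_chain + 3) + 8) + 3"])
    show "ok W ev (mov 32 14 ;; mov 33 19) 2 (\<lambda>q'. q' = q1) q"
      using q by (simp add: ok_def q1_def)
    show "ok W ev (For 26 17 (For 27 15 CHAIN ;; add 32 32 18 ;; add 33 33 16))
     (r * (m * (B_chain + 3) + 8) + 3) (\<lambda>q'. keeps 26 aT q q' \<and> (\<forall>i<r. row_ok (mm q) i m q')) q'"
      if "q' = q1" for q' unfolding that
      by (rule ok_mono[OF loop]) (auto simp: J_def M_def)
  qed (simp add: B_tables_def)
qed

definition "B_build = B_init + r * cs * 6 + B_sort + V * 14 + B_tables + 30"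

text \<open>Conditional on the seeds: the program does not check coverage, and unlucky seeds are
  paid for by the failure probability.\<close>

lemma BUILD_ok:
  assumes init: "ok W ev (INIT C) B_init (\<lambda>q'. env q' \<and> rnd q' = \<omega>) q" and len: "r * cs \<le> length \<omega>"
    and cov: "covering (seed_mem \<omega>)"
  shows "ok W ev (BUILD C) B_build (\<lambda>q'. rg q' 0 = D \<and> good (mm q')) q"
  unfolding BUILD_def
proof (rule ok_seq[OF init, where ?B2.0="r * cs * 6 + B_sort + V * 14 + B_tables + 30"])
  let ?Q = "\<lambda>q'. rg q' 0 = D \<and> good (mm q')"
  fix q1 assume q1: "env q1 \<and> rnd q1 = \<omega>"
  show "ok W ev (SEEDS ;; SORT ;; POS ;; SMP ;; TABLES ;; mov 0 20)
     (r * cs * 6 + B_sort + V * 14 + B_tables + 30) ?Q q1"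
  proof (rule ok_seq[OF SEEDS_ok[where \<omega>=\<omega>], where ?B2.0="B_sort + (V * 14 + B_tables + 20)"])
    show "env q1" "rnd q1 = \<omega>" "r * cs \<le> length \<omega>" using q1 len by auto
    fix q2 assume q2: "benv q2 \<and> (\<forall>i<r * cs. mm q2 (Gs + i) = \<omega> ! i)"
    show "ok W ev (SORT ;; POS ;; SMP ;; TABLES ;; mov 0 20) (B_sort + (V * 14 + B_tables + 20)) ?Q q2"
    proof (rule ok_seq[OF SORT_ok])
      show b2: "benv q2" using q2 by simp
      fix q3 assume q3: "keeps 26 D q2 q3 \<and> sorted_mem q3"
      have b3: "benv q3" using benv_keeps[OF b2] q3 by auto
      show "ok W ev (POS ;; SMP ;; TABLES ;; mov 0 20) (V * 14 + B_tables + 20) ?Q q3"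
      proof (rule ok_seq[OF POS_ok, where ?B2.0="V * 7 + B_tables + 10"])
        show "benv q3" "sorted_mem q3" using b3 q3 by auto
        fix q4 assume q4: "keeps 26 (D + 2 * V) q3 q4 \<and> pos_mem q4"
        have b4: "benv q4" using benv_keeps[OF b3] q4 by auto
        have s4: "sorted_mem q4" using q3 q4 by (auto simp: sorted_mem_def keeps_def)
        show "ok W ev (SMP ;; TABLES ;; mov 0 20) (V * 7 + B_tables + 10) ?Q q4"
        proof (rule ok_seq[OF SMP_ok, where ?B2.0="B_tables + 1"])
          show "benv q4" "sorted_mem q4" by fact+
          fix q5 assume q5: "keeps 26 0 q4 q5 \<and> (\<forall>g<Gs. mm q5 g = smp g) \<and> (\<forall>a\<ge>Gs. mm q5 a = mm q4 a)"
          have b5: "benv q5" using benv_keeps[OF b4] q5 by auto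
          have p5: "pos_mem q5" using q4 q5 by (simp add: pos_mem_def D_def aT_def)
          show "ok W ev (TABLES ;; mov 0 20) (B_tables + 1) ?Q q5"
          proof (rule ok_seq[OF TABLES_ok])
            show "benv q5" "pos_mem q5" by fact+
            fix q6 assume q6: "keeps 26 aT q5 q6 \<and> (\<forall>i<r. row_ok (mm q5) i m q6)"
            have b6: "benv q6" using benv_keeps[OF b5] q6 by auto
            have agree: "mm q5 a = mm q6 a" if "a < aT" for a
              using q6 that by (simp add: keeps_def)
            have seeds: "seed_mem \<omega> a = mm q6 a" if a: "Gs \<le> a" "a < aT" for a
            proof -
              have "a - Gs < r * cs" using a by (simp add: aT_def)
              then have "mm q2 (Gs + (a - Gs)) = \<omega> ! (a - Gs)" using q2 by blast
              then have "mm q2 a = \<omega> ! (a - Gs)" using a by simp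
              moreover have "a < D" using a by (simp add: D_def)
              ultimately show ?thesis using a q3 q4 q5 q6 by (simp add: seed_mem_def keeps_def)
            qed
            have "good (mm q6)"
            proof (rule good_if_covering)
              show "mm q6 g = smp g" if "g < Gs" for g
                using q5 that agree[of g] by (simp add: aT_def)
              show "covering (mm q6)" by (rule covering_cong[OF seeds cov])
              show "mm q6 (aT + i * Kq + ckey (mm q6) i j) = j"
                if "i < r" "j < m" "\<And>j'. j' < m \<Longrightarrow> j' \<noteq> j \<Longrightarrow> ckey (mm q6) i j' \<noteq> ckey (mm q6) i j" for i j
              proof -
                have e: "ckey (mm q5) i j' = ckey (mm q6) i j'" for j'
                  using ckey_cong[OF that(1), of "mm q5" "mm q6"] agree by blast
                have "\<forall>j'<m. j' \<noteq> j \<longrightarrow> ckey (mm q5) i j' \<noteq> ckey (mm q5) i j"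
                  using that(3) by (simp add: e)
                moreover have "row_ok (mm q5) i m q6" using q6 that(1) by simp
                ultimately have "mm q6 (aT + i * Kq + ckey (mm q5) i j) = j"
                  using that(2) unfolding row_ok_def by blast
                then show ?thesis by (simp add: e)
              qed
            qed
            then show "ok W ev (mov 0 20) 1 ?Q q6" using b6 by (simp add: ok_def)
          qed simp
        next
          show "Gs * 7 + 3 + (B_tables + 1) \<le> V * 7 + B_tables + 10" using Gs_le_V by simp
        qed
      qed simp
    qed simp
  qed simp
qed (simp add: B_build_def)

end

section \<open>From structured programs to the word RAM\<close>

lemma dstep_halted: "halted P (fst x) \<Longrightarrow> (dstep W ev P ^^ k) x = x"
  by (induction k) (simp_all add: dstep_def)

text \<open>Every step takes at least one unit of time, so \<open>T\<close> steps reach the halt,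
  after which the configuration no longer changes.\<close>

lemma dstep_ok:
  assumes ok: "ok W ev c B Q \<lparr>rg = regs c0, mm = mem c0, rnd = \<omega>\<rparr>"
    and "B \<le> T" "pc c0 = 0" "time c0 = 0"
  shows "halts_within (comp 0 c) T (fst ((dstep W ev (comp 0 c) ^^ T) (c0, \<omega>))) \<and>
    (\<exists>q. Q q \<and> regs (fst ((dstep W ev (comp 0 c) ^^ T) (c0, \<omega>))) = rg q \<and>
      mem (fst ((dstep W ev (comp 0 c) ^^ T) (c0, \<omega>))) = mm q)"
proof -
  let ?s = "\<lparr>rg = regs c0, mm = mem c0, rnd = \<omega>\<rparr>"
  obtain t q where q: "exec W ev c ?s t q" "t \<le> B" "Q q" using ok by (auto simp: ok_def wp_def)
  have "code_at (comp 0 c) 0 (comp 0 c)" by (simp add: code_at_def)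
  from reach_comp[OF q(1) this] obtain k T' where
    k: "(dstep W ev (comp 0 c) ^^ k) (conf 0 ?s 0) = conf (csize c) q T'" "k \<le> T'" "T' \<le> t"
    unfolding reach_def by (metis add_0)
  have c0: "(c0, \<omega>) = conf 0 ?s 0" using assms(3,4) by (simp add: conf_def)
  have "k \<le> T" using k q(2) assms(2) by simp
  then have "(dstep W ev (comp 0 c) ^^ T) (c0, \<omega>) =
      (dstep W ev (comp 0 c) ^^ (T - k)) ((dstep W ev (comp 0 c) ^^ k) (c0, \<omega>))"
    by (metis comp_apply funpow_add le_add_diff_inverse2)
  also have "\<dots> = conf (csize c) q T'"
    unfolding c0 k(1) by (rule dstep_halted) (simp add: halted_def conf_def)
  finally show ?thesis using k(3) q assms(2)
    by (auto simp: conf_def halts_within_def halted_def)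
qed

text \<open>Correctness for every supply of words covers every outcome in the support.
  \<open>out\<close> must not inspect the program counter or the clock, which the structured state
  lacks.\<close>

lemma answers_ok:
  assumes "\<And>\<omega>. ok W ev c B (\<lambda>q :: st. out (\<lparr>pc = 0, regs = rg q, mem = mm q, time = 0\<rparr>) = r)
      \<lparr>rg = regs c0, mm = mem c0, rnd = \<omega>\<rparr>"
    and "B \<le> T" "pc c0 = 0" "time c0 = 0"
    and out: "\<And>c. out c = out (c\<lparr>pc := 0, time := 0\<rparr>)"
  shows "answers W ev (comp 0 c) T c0 out r"
  unfolding answers_def run_conv_unif_words[OF order.refl] set_map_pmf
proof safe
  fix \<omega>
  let ?c = "fst ((dstep W ev (comp 0 c) ^^ T) (c0, \<omega>))"
  from dstep_ok[OF assms(1) assms(2-4), of \<omega>] obtain q :: st where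
    q: "halts_within (comp 0 c) T ?c" "out (\<lparr>pc = 0, regs = rg q, mem = mm q, time = 0\<rparr>) = r"
       "regs ?c = rg q" "mem ?c = mm q" by blast
  show "halts_within (comp 0 c) T ?c" by (rule q)
  have "?c\<lparr>pc := 0, time := 0\<rparr> = \<lparr>pc = 0, regs = rg q, mem = mm q, time = 0\<rparr>"
    using q(3,4) by simp
  then show "out ?c = r" using out[of ?c] q(2) by simp
qed

section \<open>Averages over random words\<close>

text \<open>The expectation over \<open>L\<close> uniform words as iterated averages; recursion on
  the first word fits inductions that peel off the first column of a table.\<close>

fun avg :: "nat \<Rightarrow> nat \<Rightarrow> (nat list \<Rightarrow> real) \<Rightarrow> real" where
  "avg W 0 F = F []"
| "avg W (Suc L) F = (\<Sum>a<2 ^ W. avg W L (\<lambda>v. F (a # v))) / 2 ^ W"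

lemma avg_mono: "(\<And>v. length v = L \<Longrightarrow> F v \<le> F' v) \<Longrightarrow> avg W L F \<le> avg W L F'"
  by (induction L arbitrary: F F') (auto intro!: divide_right_mono sum_mono)

lemma avg_cong: "(\<And>v. length v = L \<Longrightarrow> F v = F' v) \<Longrightarrow> avg W L F = avg W L F'"
  by (intro order.antisym avg_mono) auto

lemma avg_const [simp]: "avg W L (\<lambda>_. c) = c"
  by (induction L) auto

lemma avg_cmult: "avg W L (\<lambda>v. c * F v) = c * avg W L F"
  by (induction L arbitrary: F) (simp_all add: sum_distrib_left)

lemma avg_sum: "avg W L (\<lambda>v. \<Sum>i\<in>A. F i v) = (\<Sum>i\<in>A. avg W L (F i))"
  by (induction L arbitrary: F) (simp_all add: sum.swap[of _ A] sum_divide_distrib)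

lemma avg_diff: "avg W L (\<lambda>v. F v - F' v) = avg W L F - avg W L F'"
  by (induction L arbitrary: F F') (simp_all add: sum_subtractf diff_divide_distrib)

lemma avg_append: "avg W (L + L') F = avg W L (\<lambda>u. avg W L' (\<lambda>v. F (u @ v)))"
  by (induction L arbitrary: F) simp_all

text \<open>A column consumes two words, a multiplier and an offset.\<close>

lemma avg_2:
  "avg W (Suc (Suc L)) F =
     (\<Sum>a<2 ^ W. \<Sum>b<2 ^ W. avg W L (\<lambda>v. F (a # b # v))) / (2 ^ W * 2 ^ W)"
  by (simp add: sum_divide_distrib)

lemma finite_set_unif_words: "finite (set_pmf (unif_words W L))"
proof -
  let ?A = "set_pmf (pmf_of_set {..<(2::nat) ^ W})"
  have "finite ?A" by (subst set_pmf_of_set) (auto simp: lessThan_empty_iff)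
  then have "finite {xs. set xs \<subseteq> ?A \<and> length xs = L}" by (rule finite_lists_length_eq)
  then show ?thesis by (rule rev_finite_subset) (auto simp: set_replicate_pmf)
qed

lemma expectation_unif_words: "measure_pmf.expectation (unif_words W L) F = avg W L F"
proof (induction L arbitrary: F)
  case (Suc L)
  have fin: "finite {..<(2::nat) ^ W}" "{..<(2::nat) ^ W} \<noteq> {}" by (auto simp: lessThan_empty_iff)
  have "measure_pmf.expectation (unif_words W (Suc L)) F =
      (\<Sum>a<2 ^ W. pmf (pmf_of_set {..<2 ^ W}) a *\<^sub>R
         measure_pmf.expectation (map_pmf (\<lambda>xs. a # xs) (unif_words W L)) F)"
    unfolding replicate_pmf.simps map_pmf_def[symmetric]
    by (rule pmf_expectation_bind) (use fin finite_set_unif_words in auto)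
  also have "\<dots> = (\<Sum>a<2 ^ W. avg W L (\<lambda>v. F (a # v)) / 2 ^ W)"
    using fin by (intro sum.cong) (auto simp: Suc)
  finally show ?case by (simp add: sum_divide_distrib)
qed simp

lemma prob_unif_words:
  "measure_pmf.prob (unif_words W L) {v. Q v} = avg W L (\<lambda>v. of_bool (Q v))"
proof -
  have "measure_pmf.prob (unif_words W L) {v. Q v} =
      measure_pmf.expectation (unif_words W L) (indicat_real {v. Q v})" by simp
  also have "indicat_real {v. Q v} = (\<lambda>v. of_bool (Q v))" by (auto simp: indicator_def)
  finally show ?thesis by (simp add: expectation_unif_words)
qed


section \<open>Multiply-shift hashing\<close>

lemma add_mod_inj:
  fixes x b b' :: nat
  assumes "(x + b) mod M = (x + b') mod M" "b < M" "b' < M"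
  shows "b = b'"
proof -
  have "int M dvd int (x + b) - int (x + b')"
    using assms(1) by (metis mod_eq_dvd_iff of_nat_mod)
  then have "int b mod int M = int b' mod int M" by (simp add: mod_eq_dvd_iff)
  then show ?thesis using assms(2,3) by simp
qed

text \<open>Adding a constant permutes the residues modulo \<open>2 ^ W\<close>, so as
  \<open>b\<close> varies the top \<open>l\<close> bits take each value equally often.\<close>

lemma card_mult_shift:
  assumes "l \<le> W" "u < 2 ^ l"
  shows "card {b. b < 2 ^ W \<and> (x + b) mod 2 ^ W div 2 ^ (W - l) = (u::nat)} = 2 ^ (W - l)"
proof -
  let ?M = "(2::nat) ^ W" and ?B = "(2::nat) ^ (W - l)"
  have M: "?M = 2 ^ l * ?B" using assms(1) by (simp add: power_add[symmetric])
  let ?h = "\<lambda>b. (x + b) mod ?M"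
  have inj: "inj_on ?h {..<?M}" by (rule inj_onI) (auto dest: add_mod_inj)
  have "?h ` {..<?M} \<subseteq> {..<?M}" by auto
  then have surj: "?h ` {..<?M} = {..<?M}" using inj by (simp add: endo_inj_surj)
  have "u * ?B + ?B \<le> ?M" using assms(2) unfolding M by (metis Suc_leI add.commute mult_Suc mult_le_mono1)
  then have iv: "{c. c < ?M \<and> c div ?B = u} = {u * ?B..<u * ?B + ?B}"
    using dividend_less_div_times[of ?B] div_times_less_eq_dividend[of _ ?B]
    by (auto intro: div_nat_eqI simp: algebra_simps) 
  have "?h ` {b. b < ?M \<and> ?h b div ?B = u} = {c. c < ?M \<and> c div ?B = u}"
  proof (rule set_eqI)
    fix c
    have "c < ?M \<Longrightarrow> c \<in> ?h ` {..<?M}" by (simp only: surj lessThan_iff)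
    then show "c \<in> ?h ` {b. b < ?M \<and> ?h b div ?B = u} \<longleftrightarrow> c \<in> {c. c < ?M \<and> c div ?B = u}"
      by auto
  qed
  note img = this
  have "inj_on ?h {b. b < ?M \<and> ?h b div ?B = u}"
    by (rule inj_on_subset[OF inj]) auto
  from card_image[OF this] have "card {b. b < ?M \<and> ?h b div ?B = u} = card {c. c < ?M \<and> c div ?B = u}"
    unfolding img by simp
  then show ?thesis by (simp add: iv)
qed

lemma odd_decomposition:
  assumes "0 < (d::nat)"
  obtains j k where "d = 2 ^ j * k" "odd k"
  using assms
proof (induction d arbitrary: thesis rule: less_induct)
  case (less d)
  show ?case
  proof (cases "odd d")
    case True
    then show ?thesis using less.prems(1)[of 0 d] by simp
  next
    case False
    then obtain e where e: "d = 2 * e" by auto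
    then obtain j k where "e = 2 ^ j * k" "odd k" using less.IH[of e] less.prems(2) by auto
    then show ?thesis using less.prems(1)[of "Suc j" k] e by simp
  qed
qed

text \<open>
  Write \<open>g' - g = 2\<^sup>j k\<close> with \<open>k\<close> odd. The hash values and \<open>g' - g\<close> determine \<open>a\<close> modulo
  \<open>2\<^bsup>W - j\<^esup>\<close>, and the residues of the two products modulo \<open>2\<^sup>j\<close> agree.
\<close>

lemma card_mult_shift_pair_less:
  fixes g g' u u' :: nat
  assumes "g < g'" "g' < 2 ^ e" "e + l \<le> W"
  shows "card {(a, b). a < 2 ^ W \<and> b < 2 ^ W \<and> (a * g + b) mod 2 ^ W div 2 ^ (W - l) = u \<and>
     (a * g' + b) mod 2 ^ W div 2 ^ (W - l) = u'} \<le> 2 ^ (W - l) * 2 ^ (W - l)"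
proof -
  define d where "d = g' - g"
  have g': "g' = g + d" "0 < d" "d < 2 ^ e" using assms by (auto simp: d_def)
  obtain j k where jk: "d = 2 ^ j * k" "odd k" using odd_decomposition[OF g'(2)] .
  have "2 ^ j \<le> d" using jk by (cases k) auto
  from order.strict_trans1[OF this g'(3)] have "j < e" by simp
  then have j: "j \<le> W - l" "j \<le> W" using assms(3) by auto
  let ?M = "(2::nat) ^ W" and ?B = "(2::nat) ^ (W - l)"
  define c where "c a b = (a * g + b) mod ?M" for a b
  define c' where "c' a b = (a * g' + b) mod ?M" for a b
  have dvdB: "(2::nat) ^ j dvd ?B" and dvdM: "(2::nat) ^ j dvd ?M" using j by (simp_all add: le_imp_power_dvd)
  have cc': "c' a b = (c a b + a * d) mod ?M" for a b
  proof -
    have "a * g' + b = (a * g + b) + a * d" by (simp add: g' algebra_simps)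
    then show ?thesis by (simp only: c_def c'_def mod_add_left_eq)
  qed
  have res: "c' a b mod 2 ^ j = c a b mod 2 ^ j" for a b
  proof -
    have "c' a b mod 2 ^ j = (c a b + 2 ^ j * (a * k)) mod 2 ^ j"
      using dvdM by (simp add: cc' mod_mod_cancel jk algebra_simps)
    then show ?thesis by simp
  qed
  let ?S = "{(a, b). a < ?M \<and> b < ?M \<and> c a b div ?B = u \<and> c' a b div ?B = u'}"
  \<comment> \<open>What the two hash values leave open: the low bits of the first sum, those of the
    second without the \<open>j\<close> determined ones, and the top \<open>j\<close> bits of
    \<open>a\<close>. The sizes of these ranges multiply to the claimed bound.\<close>
  let ?phi = "\<lambda>(a, b). (c a b mod ?B, c' a b mod ?B div 2 ^ j, a div 2 ^ (W - j))"
  let ?T = "{..<?B} \<times> {..<(2::nat) ^ (W - l - j)} \<times> {..<(2::nat) ^ j}"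
  have "inj_on ?phi ?S"
  proof (rule inj_onI, clarify)
    fix a b a2 b2
    assume lt: "a < ?M" "b < ?M" "a2 < ?M" "b2 < ?M"
      and u: "u = c a b div ?B" "u' = c' a b div ?B" "c a2 b2 div ?B = c a b div ?B" "c' a2 b2 div ?B = c' a b div ?B"
      and eq: "c a b mod ?B = c a2 b2 mod ?B" "c' a b mod ?B div 2 ^ j = c' a2 b2 mod ?B div 2 ^ j"
        "a div 2 ^ (W - j) = a2 div 2 ^ (W - j)"
    have c: "c a b = c a2 b2" using u(3) eq(1) by (metis div_mult_mod_eq)
    have "c' a b mod ?B mod 2 ^ j = c' a2 b2 mod ?B mod 2 ^ j"
      using dvdB c by (simp add: mod_mod_cancel res)
    then have "c' a b mod ?B = c' a2 b2 mod ?B" using eq(2) by (metis div_mult_mod_eq)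
    then have "c' a b = c' a2 b2" using u(4) by (metis div_mult_mod_eq)
    then have "(c a b + a * d) mod ?M = (c a b + a2 * d) mod ?M" using c by (simp add: cc')
    then have "int ?M dvd int (c a b + a * d) - int (c a b + a2 * d)"
      by (metis mod_eq_dvd_iff of_nat_mod)
    then have "int ?M dvd (int a - int a2) * int d" by (simp add: algebra_simps)
    moreover have "int ?M = 2 ^ j * 2 ^ (W - j)" using j by (simp add: power_add[symmetric])
    moreover have "(int a - int a2) * int d = 2 ^ j * ((int a - int a2) * int k)" by (simp add: jk)
    ultimately have "(2::int) ^ (W - j) dvd (int a - int a2) * int k" by simp
    \<comment> \<open>The odd factor \<open>k\<close> is a unit modulo a power of two and can be
      cancelled.\<close>
    moreover have "coprime ((2::int) ^ (W - j)) (int k)" using jk(2) by (simp add: coprime_power_left_iff)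
    ultimately have "(2::int) ^ (W - j) dvd int a - int a2" by (simp add: coprime_dvd_mult_left_iff)
    then have "int a mod 2 ^ (W - j) = int a2 mod 2 ^ (W - j)" by (simp add: mod_eq_dvd_iff)
    then have "int (a mod 2 ^ (W - j)) = int (a2 mod 2 ^ (W - j))" by (simp add: of_nat_mod)
    then have r: "a mod 2 ^ (W - j) = a2 mod 2 ^ (W - j)" by (simp only: of_nat_eq_iff)
    have "a = a div 2 ^ (W - j) * 2 ^ (W - j) + a mod 2 ^ (W - j)" by (rule div_mult_mod_eq[symmetric])
    also have "\<dots> = a2" unfolding r eq(3) by (rule div_mult_mod_eq)
    finally have a: "a = a2" .
    then have "b = b2" using c lt add_mod_inj[of "a * g" b ?M b2] by (simp add: c_def)
    then show "a = a2 \<and> b = b2" using a by simp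
  qed
  moreover have "?phi ` ?S \<subseteq> ?T"
  proof (rule image_subsetI)
    fix z assume z: "z \<in> ?S"
    obtain a b where ab: "z = (a, b)" by force
    then have "a < ?M" using z by simp
    have "?B = 2 ^ (W - l - j) * 2 ^ j" "?M = 2 ^ j * 2 ^ (W - j)" using j by (simp_all add: power_add[symmetric])
    then have "c' a b mod ?B div 2 ^ j < 2 ^ (W - l - j)" "a div 2 ^ (W - j) < 2 ^ j"
      using \<open>a < ?M\<close> by (auto simp: div_less_iff_less_mult)
    then show "?phi z \<in> ?T" by (simp add: ab)
  qed
  ultimately have "card ?S \<le> card ?T" by (rule card_inj_on_le) simp
  also have "\<dots> = ?B * (2 ^ (W - l - j) * 2 ^ j)" by simp
  also have "(2::nat) ^ (W - l - j) * 2 ^ j = ?B" using j by (simp add: power_add[symmetric])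
  finally show ?thesis by (simp add: c_def c'_def)
qed

lemma card_mult_shift_pair:
  fixes g g' u u' :: nat
  assumes "g \<noteq> g'" "g < 2 ^ e" "g' < 2 ^ e" "e + l \<le> W"
  shows "card {(a, b). a < 2 ^ W \<and> b < 2 ^ W \<and> (a * g + b) mod 2 ^ W div 2 ^ (W - l) = u \<and>
     (a * g' + b) mod 2 ^ W div 2 ^ (W - l) = u'} \<le> 2 ^ (W - l) * 2 ^ (W - l)"
proof (cases "g < g'")
  case True
  then show ?thesis using card_mult_shift_pair_less[of g g' e l W u u'] assms by simp
next
  case False
  then have "g' < g" using assms(1) by simp
  from card_mult_shift_pair_less[OF this assms(2,4), of u' u] show ?thesis
    by (simp add: conj_commute conj_left_commute)
qed

text \<open>A single hash value is exactly uniform; the random offset achieves this already for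
  fixed \<open>a\<close>.\<close>

lemma sum_mult_shift:
  fixes F :: "nat \<Rightarrow> real"
  assumes "l \<le> W"
  shows "(\<Sum>a<2 ^ W. \<Sum>b<2 ^ W. F ((a * g + b) mod 2 ^ W div 2 ^ (W - l))) =
     2 ^ W * 2 ^ (W - l) * (\<Sum>x<2 ^ l. F x)"
proof -
  let ?h = "\<lambda>a b. (a * g + b) mod 2 ^ W div 2 ^ (W - l)"
  have M: "(2::nat) ^ W = 2 ^ l * 2 ^ (W - l)" using assms by (simp add: power_add[symmetric])
  have lt: "?h a b < 2 ^ l" for a b :: nat
    by (metis M div_less_iff_less_mult mod_less_divisor zero_less_numeral zero_less_power)
  have "(\<Sum>b<2 ^ W. F (?h a b)) = 2 ^ (W - l) * (\<Sum>x<2 ^ l. F x)" for a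
  proof -
    have "(\<Sum>b<2 ^ W. F (?h a b)) = (\<Sum>x<2 ^ l. \<Sum>b\<in>{b\<in>{..<2 ^ W}. ?h a b = x}. F (?h a b))"
      using lt by (subst sum.group) auto
    also have "\<dots> = (\<Sum>x<2 ^ l. real (card {b. b < 2 ^ W \<and> ?h a b = x}) * F x)"
      by (intro sum.cong) (auto simp: )
    also have "\<dots> = (\<Sum>x<2 ^ l. 2 ^ (W - l) * F x)"
      using assms by (intro sum.cong) (auto simp: card_mult_shift)
    finally show ?thesis by (simp add: sum_distrib_left)
  qed
  then show ?thesis by simp
qed

text \<open>For two inputs the counting argument gives an upper bound, which carries over to
  nonnegative \<open>F\<close>. It is applied to collisions, which count against coverage.\<close>

lemma sum_mult_shift_pair:
  fixes F :: "nat \<Rightarrow> nat \<Rightarrow> real"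
  assumes "g \<noteq> g'" "g < 2 ^ e" "g' < 2 ^ e" "e + l \<le> W" and nonneg: "\<And>x y. 0 \<le> F x y"
  shows "(\<Sum>a<2 ^ W. \<Sum>b<2 ^ W. F ((a * g + b) mod 2 ^ W div 2 ^ (W - l))
       ((a * g' + b) mod 2 ^ W div 2 ^ (W - l))) \<le>
     2 ^ (W - l) * 2 ^ (W - l) * (\<Sum>x<2 ^ l. \<Sum>y<2 ^ l. F x y)"
proof -
  let ?h = "\<lambda>g a b. (a * g + b) mod 2 ^ W div 2 ^ (W - l)"
  let ?A = "{..<(2::nat) ^ W} \<times> {..<(2::nat) ^ W}"
  have M: "(2::nat) ^ W = 2 ^ l * 2 ^ (W - l)" using assms(4) by (simp add: power_add[symmetric])
  have lt: "?h g a b < 2 ^ l" for a b g :: nat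
    by (metis M div_less_iff_less_mult mod_less_divisor zero_less_numeral zero_less_power)
  let ?p = "\<lambda>(a, b). (?h g a b, ?h g' a b)"
  have "(\<Sum>a<2 ^ W. \<Sum>b<2 ^ W. F (?h g a b) (?h g' a b)) = (\<Sum>z\<in>?A. case_prod F (?p z))"
    by (simp add: sum.cartesian_product case_prod_unfold)
  also have "\<dots> = (\<Sum>xy\<in>{..<2 ^ l} \<times> {..<2 ^ l}. \<Sum>z\<in>{z\<in>?A. ?p z = xy}. case_prod F (?p z))"
    using lt by (subst sum.group) auto
  also have "\<dots> = (\<Sum>xy\<in>{..<2 ^ l} \<times> {..<2 ^ l}. real (card {z\<in>?A. ?p z = xy}) * case_prod F xy)"
    by (intro sum.cong) auto
  also have "\<dots> \<le> (\<Sum>xy\<in>{..<2 ^ l} \<times> {..<2 ^ l}. 2 ^ (W - l) * 2 ^ (W - l) * case_prod F xy)"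
  proof (intro sum_mono mult_right_mono)
    fix xy :: "nat \<times> nat"
    obtain x y where xy: "xy = (x, y)" by force
    have "{z\<in>?A. ?p z = xy} = {(a, b). a < 2 ^ W \<and> b < 2 ^ W \<and> ?h g a b = x \<and> ?h g' a b = y}"
      by (auto simp: xy)
    then have "card {z\<in>?A. ?p z = xy} \<le> 2 ^ (W - l) * 2 ^ (W - l)"
      using card_mult_shift_pair[OF assms(1-4), of x y] by simp
    then have "real (card {z\<in>?A. ?p z = xy}) \<le> real (2 ^ (W - l) * 2 ^ (W - l))"
      by (rule of_nat_mono)
    then show "real (card {z\<in>?A. ?p z = xy}) \<le> 2 ^ (W - l) * 2 ^ (W - l)" by simp
    show "0 \<le> case_prod F xy" using nonneg by (simp add: xy)
  qed
  also have "\<dots> = 2 ^ (W - l) * 2 ^ (W - l) * (\<Sum>x<2 ^ l. \<Sum>y<2 ^ l. F x y)"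
    by (simp add: sum_distrib_left sum.cartesian_product)
  finally show ?thesis .
qed


section \<open>Coverage\<close>

context inversion
begin

text \<open>The hash functions behind \<open>xv\<close> and \<open>kv\<close> once more, with the
  seeds as explicit arguments to be summed over.\<close>

definition hx :: "nat \<Rightarrow> nat \<Rightarrow> nat \<Rightarrow> nat" where
  "hx a b g = (a * g + b) mod 2 ^ W div 2 ^ (W - n)"

definition hk :: "nat \<Rightarrow> nat \<Rightarrow> nat \<Rightarrow> nat" where
  "hk a b g = (a * g + b) mod 2 ^ W div 2 ^ (W - (n - 2 * sg))"

text \<open>The elements and the key of the chain from \<open>g\<close> with \<open>q\<close> columns, for the seeds \<open>v\<close>.\<close>

definition xk :: "nat \<Rightarrow> nat list \<Rightarrow> nat \<Rightarrow> nat" where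
  "xk k v g = xv ((!) v) (2 * k) (walk ((!) v) 0 k g)"

definition key :: "nat \<Rightarrow> nat list \<Rightarrow> nat \<Rightarrow> nat" where
  "key q v g = kv ((!) v) (2 * q) (walk ((!) v) 0 q g)"

lemma walk_shift:
  "(\<And>a. a < 2 * k \<Longrightarrow> M (p + a) = M' (p' + a)) \<Longrightarrow> walk M p k g = walk M' p' k g"
proof (induction k)
  case (Suc k)
  have "M (p + (2 * k + 1)) = M' (p' + (2 * k + 1))" "M (p + 2 * k) = M' (p' + 2 * k)"
    by (rule Suc.prems; simp)+
  then show ?case using Suc by (simp add: xv_def hsh_def add.assoc)
qed simp

lemma hx_less: "hx a b g < V"
  using xv_less[of "\<lambda>i. if i = 0 then a else b" 0 g] by (simp add: xv_def hsh_def hx_def drop_bit_eq_div)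

text \<open>Consuming the first column turns a chain from \<open>g\<close> into a chain under the
  remaining seeds, starting from the group of its first element. This drives the inductions over
  columns.\<close>

lemma xk_simps:
  "xk 0 (a # b # v) g = hx a b g"
  "xk (Suc k) (a # b # v) g = xk k v (G (hx a b g))"
proof -
  have "walk ((!) (a # b # v)) (Suc (Suc 0)) k g' = walk ((!) v) 0 k g'" for g'
    by (rule walk_shift) simp
  then show "xk 0 (a # b # v) g = hx a b g" "xk (Suc k) (a # b # v) g = xk k v (G (hx a b g))"
    using walk_add[of "(!) (a # b # v)" 0 1 k g]
    by (simp_all add: xk_def hx_def xv_def hsh_def drop_bit_eq_div)
qed

lemma key_simps:
  "key 0 (a # b # v) g = hk a b g"
  "key (Suc q) (a # b # v) g = key q v (G (hx a b g))"
proof -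
  have "walk ((!) (a # b # v)) (Suc (Suc 0)) q g' = walk ((!) v) 0 q g'" for g'
    by (rule walk_shift) simp
  then show "key 0 (a # b # v) g = hk a b g" "key (Suc q) (a # b # v) g = key q v (G (hx a b g))"
    using walk_add[of "(!) (a # b # v)" 0 1 q g]
    by (simp_all add: key_def hk_def hx_def xv_def kv_def hsh_def drop_bit_eq_div)
qed

text \<open>Chains that meet in the same column stay together from there on.\<close>

lemma key_merge: "k < q \<Longrightarrow> xk k v g = xk k v g' \<Longrightarrow> key q v g = key q v g'"
proof -
  assume "k < q" and eq: "xk k v g = xk k v g'"
  then have "walk ((!) v) 0 q g = walk ((!) v) 0 q g'"
    using walk_add[of "(!) v" 0 "Suc k" "q - Suc k" g] walk_add[of "(!) v" 0 "Suc k" "q - Suc k" g']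
    by (simp add: xk_def)
  then show ?thesis by (simp add: key_def)
qed

lemma Gs_power: "g < Gs \<Longrightarrow> g < 2 ^ n"
  unfolding Gs_def by (erule order.strict_trans2) (simp add: power_increasing)

lemma sum_hx:
  fixes F :: "nat \<Rightarrow> real"
  shows "(\<Sum>a<2 ^ W. \<Sum>b<2 ^ W. F (hx a b g)) / (2 ^ W * 2 ^ W) = (\<Sum>x<V. F x) / V"
proof -
  have "n \<le> W" using n_le_W by simp
  moreover from this have "(2::real) ^ W = 2 ^ n * 2 ^ (W - n)" by (simp add: power_add[symmetric])
  ultimately show ?thesis
    unfolding hx_def using sum_mult_shift[of n W F g] by (simp add: V_def field_simps)
qed

lemma sum_hx_pair:
  fixes F :: "nat \<Rightarrow> nat \<Rightarrow> real"
  assumes "g \<noteq> g'" "g < Gs" "g' < Gs" "\<And>x y. 0 \<le> F x y"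
  shows "(\<Sum>a<2 ^ W. \<Sum>b<2 ^ W. F (hx a b g) (hx a b g')) / (2 ^ W * 2 ^ W) \<le>
    (\<Sum>x<V. \<Sum>y<V. F x y) / (V * V)"
proof -
  have "n + n \<le> W" using n_le_W by simp
  moreover from this have "(2::real) ^ W = 2 ^ n * 2 ^ (W - n)" by (simp add: power_add[symmetric])
  ultimately show ?thesis
    unfolding hx_def
    using sum_mult_shift_pair[of g g' n n W F, OF assms(1) Gs_power[OF assms(2)] Gs_power[OF assms(3)]] assms(4)
    by (simp add: V_def field_simps)
qed

lemma sum_hk_eq:
  assumes "g \<noteq> g'" "g < Gs" "g' < Gs"
  shows "(\<Sum>a<2 ^ W. \<Sum>b<2 ^ W. of_bool (hk a b g = hk a b g')) / (2 ^ W * 2 ^ W) \<le> (1 / Kq :: real)"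
proof -
  let ?l = "n - 2 * sg"
  have l: "n + ?l \<le> W" using n_le_W by simp
  moreover from this have "(2::real) ^ W = 2 ^ ?l * 2 ^ (W - ?l)" by (simp add: power_add[symmetric])
  moreover have "(\<Sum>x<(2::nat) ^ ?l. \<Sum>y<2 ^ ?l. of_bool (x = y)) = (2 ^ ?l :: real)"
  proof -
    have "(\<Sum>y<(2::nat) ^ ?l. of_bool (x = y)) = (1 :: real)" if "x < 2 ^ ?l" for x
      unfolding of_bool_def using that by (subst sum.delta') auto
    then show ?thesis by simp
  qed
  ultimately show ?thesis
    unfolding hk_def
    using sum_mult_shift_pair[of g g' n ?l W "\<lambda>x y. of_bool (x = y)",
        OF assms(1) Gs_power[OF assms(2)] Gs_power[OF assms(3)]]
    by (simp add: Kq_def field_simps)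
qed

lemma card_same_group: "x < V \<Longrightarrow> card ({..<V} \<inter> {y. G x = G y}) = s"
proof -
  assume "x < V"
  then have "card {y. y < V \<and> G y = G x} = s" by (intro G_fibre G_less)
  moreover have "{y. y < V \<and> G y = G x} = {..<V} \<inter> {y. G x = G y}" by auto
  ultimately show ?thesis by simp
qed

text \<open>A column hashes any input uniformly; the columns before \<open>k\<close> merely average
  a constant.\<close>

lemma avg_xk:
  "x < V \<Longrightarrow> 2 * Suc k \<le> L \<Longrightarrow> avg W L (\<lambda>v. of_bool (xk k v g = x)) = 1 / V"
proof (induction k arbitrary: L g)
  case 0
  then obtain L' where L: "L = Suc (Suc L')" by (cases L; cases "L - 1") auto
  have "(\<Sum>y<V. of_bool (y = x)) = (1::real)" using 0 by (simp add: of_bool_def sum.delta)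
  then show ?case unfolding L avg_2 xk_simps avg_const
    using sum_hx[of "\<lambda>y. of_bool (y = x)" g] by simp
next
  case (Suc k)
  then obtain L' where L: "L = Suc (Suc L')" "2 * Suc k \<le> L'" by (cases L; cases "L - 1") auto
  show ?case unfolding L(1) avg_2 xk_simps using Suc.IH[OF Suc.prems(1) L(2)] by simp
qed

text \<open>Different columns have independent seeds, so the two events are independent even for
  chains with the same start.\<close>

lemma avg_xk_xk:
  "x < V \<Longrightarrow> k < k' \<Longrightarrow> 2 * Suc k' \<le> L \<Longrightarrow>
   avg W L (\<lambda>v. of_bool (xk k v g = x \<and> xk k' v g' = x)) = 1 / (real V * V)"
proof (induction k arbitrary: k' L g g')
  case 0
  obtain k2 where k2: "k' = Suc k2" using 0 by (cases k') auto
  obtain L' where L: "L = Suc (Suc L')" "2 * Suc k2 \<le> L'" using 0 k2 by (cases L; cases "L - 1") auto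
  have "avg W L' (\<lambda>v. of_bool (hx a b g = x \<and> xk k2 v (G (hx a b g')) = x)) =
      of_bool (hx a b g = x) / V" for a b
    using avg_xk[OF 0(1) L(2)] by (cases "hx a b g = x") simp_all
  moreover have "(\<Sum>y<V. of_bool (y = x) / real V) = 1 / V"
    using 0 by (simp add: of_bool_def sum.delta flip: sum_divide_distrib)
  ultimately show ?case unfolding L(1) avg_2 k2 xk_simps
    using sum_hx[of "\<lambda>y. of_bool (y = x) / V" g] by simp
next
  case (Suc k)
  obtain k2 where k2: "k' = Suc k2" "k < k2" using Suc by (cases k') auto
  obtain L' where L: "L = Suc (Suc L')" "2 * Suc k2 \<le> L'" using Suc k2 by (cases L; cases "L - 1") auto
  show ?case unfolding L(1) k2(1) avg_2 xk_simps
    using Suc.IH[OF Suc.prems(1) k2(2) L(2)] by simp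
qed

text \<open>Union bound for equal keys of two chains: each of \<open>q\<close> columns merges them
  with probability at most \<open>s / V\<close>, since groups have size \<open>s\<close>, and the
  final hash collides with probability at most \<open>1 / Kq\<close>.\<close>

definition beta :: "nat \<Rightarrow> real" where
  "beta q = real q * s / V + 1 / Kq"

lemma beta_nonneg: "0 \<le> beta q"
  by (simp add: beta_def)

lemma avg_key:
  "g \<noteq> g' \<Longrightarrow> g < Gs \<Longrightarrow> g' < Gs \<Longrightarrow>
   avg W (2 * Suc q) (\<lambda>v. of_bool (key q v g = key q v g')) \<le> beta q"
proof (induction q arbitrary: g g')
  case 0
  have L: "2 * Suc 0 = Suc (Suc 0)" by simp
  show ?case unfolding L avg_2 key_simps avg_const using sum_hk_eq[OF 0] by (simp add: beta_def)
next
  case (Suc q)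
  have L: "2 * Suc (Suc q) = Suc (Suc (2 * Suc q))" by simp
  \<comment> \<open>Either the chains merge in this column, or the induction hypothesis applies to
    two distinct groups.\<close>
  define F where "F x y = of_bool (G x = G y) + beta q" for x y
  have step: "avg W (2 * Suc q) (\<lambda>v. of_bool (key q v (G x) = key q v (G y))) \<le> F x y"
    if "x < V" "y < V" for x y
  proof (cases "G x = G y")
    case False
    then show ?thesis using Suc.IH[OF False] that G_less by (simp add: F_def)
  qed (use beta_nonneg in \<open>simp add: F_def\<close>)
  have "avg W (2 * Suc (Suc q)) (\<lambda>v. of_bool (key (Suc q) v g = key (Suc q) v g')) \<le>
     (\<Sum>a<2 ^ W. \<Sum>b<2 ^ W. F (hx a b g) (hx a b g')) / (2 ^ W * 2 ^ W)"
    unfolding L avg_2 key_simps by (intro divide_right_mono sum_mono step hx_less) simp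
  also have "\<dots> \<le> (\<Sum>x<V. \<Sum>y<V. F x y) / (V * V)"
    using Suc.prems beta_nonneg by (intro sum_hx_pair) (simp_all add: F_def)
  also have "(\<Sum>x<V. \<Sum>y<V. F x y) = V * (s + V * beta q)"
    by (simp add: F_def sum.distrib card_same_group cong: sum.cong_simp)
  also have "\<dots> / (V * V) = beta (Suc q)"
    using pos_params(1) by (simp add: beta_def field_simps)
  finally show ?case .
qed

text \<open>Passing through \<open>x0\<close> costs a factor \<open>1 / V\<close>. In the column of
  the hit, pairwise independence still bounds a merger by \<open>s / V\<close>; the other columns
  have seeds of their own.\<close>

lemma avg_xk_key:
  "x0 < V \<Longrightarrow> k < q \<Longrightarrow> g \<noteq> g' \<Longrightarrow> g < Gs \<Longrightarrow> g' < Gs \<Longrightarrow>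
   avg W (2 * Suc q) (\<lambda>v. of_bool (xk k v g = x0 \<and> key q v g = key q v g')) \<le> beta q / V"
proof (induction k arbitrary: q g g')
  case 0
  obtain p where p: "q = Suc p" using 0 by (cases q) auto
  have L: "2 * Suc (Suc p) = Suc (Suc (2 * Suc p))" by simp
  define F where "F x y = of_bool (x = x0) * (of_bool (G x = G y) + beta p)" for x y
  have step: "avg W (2 * Suc p) (\<lambda>v. of_bool (x = x0 \<and> key p v (G x) = key p v (G y))) \<le> F x y"
    if "x < V" "y < V" for x y
  proof (cases "x = x0 \<and> G x \<noteq> G y")
    case True
    then show ?thesis using avg_key[of "G x" "G y" p] that G_less by (auto simp: F_def)
  qed (use beta_nonneg in \<open>auto simp: F_def\<close>)
  have "avg W (2 * Suc (Suc p)) (\<lambda>v. of_bool (xk 0 v g = x0 \<and> key (Suc p) v g = key (Suc p) v g')) \<le>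
     (\<Sum>a<2 ^ W. \<Sum>b<2 ^ W. F (hx a b g) (hx a b g')) / (2 ^ W * 2 ^ W)"
    unfolding L avg_2 key_simps xk_simps by (intro divide_right_mono sum_mono step hx_less) simp
  also have "\<dots> \<le> (\<Sum>x<V. \<Sum>y<V. F x y) / (V * V)"
    using 0 beta_nonneg by (intro sum_hx_pair) (simp_all add: F_def)
  also have "(\<Sum>x<V. \<Sum>y<V. F x y) = (\<Sum>x<V. of_bool (x = x0) * (s + V * beta p))"
    by (intro sum.cong refl, simp only: F_def flip: sum_distrib_left) (simp add: sum.distrib card_same_group)
  also have "\<dots> = s + V * beta p" using 0 by (simp add: of_bool_def flip: sum_distrib_right)
  also have "\<dots> / (V * V) = beta q / V"
    using pos_params(1) by (simp add: beta_def p field_simps)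
  finally show ?case by (simp add: p)
next
  case (Suc k)
  obtain p where p: "q = Suc p" "k < p" using Suc by (cases q) auto
  have L: "2 * Suc (Suc p) = Suc (Suc (2 * Suc p))" by simp
  \<comment> \<open>If the chains merge before the hit, only the later hit is random; otherwise the
    induction hypothesis bounds both events.\<close>
  define F where "F x y = of_bool (G x = G y) / V + beta p / V" for x y
  have step: "avg W (2 * Suc p) (\<lambda>v. of_bool (xk k v (G x) = x0 \<and> key p v (G x) = key p v (G y))) \<le> F x y"
    if "x < V" "y < V" for x y
  proof (cases "G x = G y")
    case True
    then show ?thesis using avg_xk[OF Suc.prems(1), of k "2 * Suc p"] p(2) beta_nonneg
      by (simp add: F_def)
  next
    case False
    then show ?thesis using Suc.IH[OF Suc.prems(1) p(2) False] that G_less by (simp add: F_def)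
  qed
  have "avg W (2 * Suc (Suc p)) (\<lambda>v. of_bool (xk (Suc k) v g = x0 \<and> key (Suc p) v g = key (Suc p) v g')) \<le>
     (\<Sum>a<2 ^ W. \<Sum>b<2 ^ W. F (hx a b g) (hx a b g')) / (2 ^ W * 2 ^ W)"
    unfolding L avg_2 key_simps xk_simps by (intro divide_right_mono sum_mono step hx_less) simp
  also have "\<dots> \<le> (\<Sum>x<V. \<Sum>y<V. F x y) / (V * V)"
    using Suc.prems beta_nonneg by (intro sum_hx_pair) (simp_all add: F_def)
  also have "(\<Sum>x<V. \<Sum>y<V. F x y) = s + V * beta p"
    using pos_params(1)
    by (simp add: F_def sum.distrib card_same_group field_simps cong: sum.cong_simp flip: sum_divide_distrib)
  also have "\<dots> / (V * V) = beta q / V"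
    using pos_params(1) by (simp add: beta_def p field_simps)
  finally show ?case by (simp add: p)
qed

definition row_covers :: "nat list \<Rightarrow> nat \<Rightarrow> bool" where
  "row_covers v x \<longleftrightarrow> (\<exists>j<m. \<exists>k<s. xk k v j = x \<and> (\<forall>j'<m. j' \<noteq> j \<longrightarrow> key s v j' \<noteq> key s v j))"

text \<open>A term is positive only for the last occurrence of \<open>x\<close>, provided that its key is unique.\<close>

lemma row_covers_ge:
  "(\<Sum>j<m. \<Sum>k<s. of_bool (xk k v j = x)
      - (\<Sum>j'\<in>{..<m} - {j}. of_bool (xk k v j = x \<and> key s v j = key s v j'))
      - (\<Sum>j'<m. \<Sum>k'\<in>{k<..<s}. of_bool (xk k v j = x \<and> xk k' v j' = x))) \<le>
    (of_bool (row_covers v x) :: real)"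
proof -
  define T where "T j k = of_bool (xk k v j = x)
      - (\<Sum>j'\<in>{..<m} - {j}. of_bool (xk k v j = x \<and> key s v j = key s v j'))
      - (\<Sum>j'<m. \<Sum>k'\<in>{k<..<s}. (of_bool (xk k v j = x \<and> xk k' v j' = x) :: real))" for j k
  define good where "good = {(j, k). j < m \<and> k < s \<and> xk k v j = x \<and>
     (\<forall>j'<m. j' \<noteq> j \<longrightarrow> key s v j' \<noteq> key s v j) \<and> (\<forall>j'<m. \<forall>k'. k < k' \<and> k' < s \<longrightarrow> xk k' v j' \<noteq> x)}"
  have T: "T j k \<le> of_bool ((j, k) \<in> good)" if jk: "j < m" "k < s" for j k
  proof (cases "(j, k) \<in> good")
    case True
    have "0 \<le> (\<Sum>j'\<in>{..<m} - {j}. (of_bool (xk k v j = x \<and> key s v j = key s v j') :: real))"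
      "0 \<le> (\<Sum>j'<m. \<Sum>k'\<in>{k<..<s}. (of_bool (xk k v j = x \<and> xk k' v j' = x) :: real))"
      by (intro sum_nonneg; simp)+
    then show ?thesis using True by (simp add: T_def good_def)
  next
    case False
    show ?thesis
    proof (cases "xk k v j = x")
      case hit: True
      have nonneg: "0 \<le> (\<Sum>j'\<in>{..<m} - {j}. (of_bool (xk k v j = x \<and> key s v j = key s v j') :: real))"
        "0 \<le> (\<Sum>j'<m. \<Sum>k'\<in>{k<..<s}. (of_bool (xk k v j = x \<and> xk k' v j' = x) :: real))"
        by (intro sum_nonneg; simp)+
      from False hit jk consider j' where "j' < m" "j' \<noteq> j" "key s v j' = key s v j"
        | j' k' where "j' < m" "k < k'" "k' < s" "xk k' v j' = x"
        unfolding good_def by auto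
      then have "1 \<le> (\<Sum>j'\<in>{..<m} - {j}. (of_bool (xk k v j = x \<and> key s v j = key s v j') :: real)) +
        (\<Sum>j'<m. \<Sum>k'\<in>{k<..<s}. (of_bool (xk k v j = x \<and> xk k' v j' = x) :: real))"
      proof cases
        case 1
        then have "1 = (of_bool (xk k v j = x \<and> key s v j = key s v j') :: real)" using hit by simp
        also have "\<dots> \<le> (\<Sum>j'\<in>{..<m} - {j}. of_bool (xk k v j = x \<and> key s v j = key s v j'))"
          using 1 by (intro member_le_sum) auto
        finally show ?thesis using nonneg(2) by linarith
      next
        case 2
        then have "1 = (of_bool (xk k v j = x \<and> xk k' v j' = x) :: real)" using hit by simp
        also have "\<dots> \<le> (\<Sum>k'\<in>{k<..<s}. of_bool (xk k v j = x \<and> xk k' v j' = x))"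
          using 2 by (intro member_le_sum) auto
        also have "\<dots> \<le> (\<Sum>j'<m. \<Sum>k'\<in>{k<..<s}. of_bool (xk k v j = x \<and> xk k' v j' = x))"
          using 2 by (intro member_le_sum[where f="\<lambda>j'. \<Sum>k'\<in>{k<..<s}. of_bool (xk k v j = x \<and> xk k' v j' = x)"])
            (auto intro!: sum_nonneg)
        finally show ?thesis using nonneg(1) by linarith
      qed
      then show ?thesis using False hit by (simp add: T_def)
    qed (simp add: T_def)
  qed
  \<comment> \<open>Lastness forces equal columns, and equal elements in one column would merge the
    chains against the unique key. The sum, at most the number of good pairs, is therefore at most
    1.\<close>
  have unique: "z = z'" if z: "z \<in> good" "z' \<in> good" for z z'
  proof -
    obtain j k j' k' where jk: "z = (j, k)" "z' = (j', k')" by fastforce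
    have "k = k'" using z unfolding jk good_def by (auto simp: not_less intro: order.antisym) (metis nat_neq_iff)
    moreover have "j = j'"
    proof (rule ccontr)
      assume "j \<noteq> j'"
      then have "key s v j \<noteq> key s v j'" using z unfolding jk good_def by auto
      moreover have "xk k v j = xk k v j'" "k < s" using z \<open>k = k'\<close> unfolding jk good_def by auto
      ultimately show False using key_merge by blast
    qed
    ultimately show ?thesis by (simp add: jk)
  qed
  have fin: "finite good" by (rule finite_subset[of _ "{..<m} \<times> {..<s}"]) (auto simp: good_def)
  have "(\<Sum>j<m. \<Sum>k<s. T j k) \<le> (\<Sum>j<m. \<Sum>k<s. of_bool ((j, k) \<in> good))"
    by (intro sum_mono T) auto
  also have "\<dots> = (\<Sum>z\<in>{..<m} \<times> {..<s}. of_bool (z \<in> good))"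
    unfolding sum.cartesian_product by (rule sum.cong) auto
  also have "\<dots> = real (card good)"
  proof -
    have "({..<m} \<times> {..<s}) \<inter> good = good" by (auto simp: good_def)
    then show ?thesis by (simp add: of_bool_def sum.If_cases)
  qed
  also have "\<dots> \<le> of_bool (row_covers v x)"
  proof (cases "good = {}")
    case False
    then obtain z where "good = {z}" using unique by blast
    moreover have "row_covers v x" using False by (auto simp: good_def row_covers_def)
    ultimately show ?thesis by simp
  qed simp
  finally show ?thesis by (simp add: T_def)
qed

text \<open>The exponents are chosen for these identities: chains times columns times group size is
  a quarter of the domain, and a table has four slots per chain.\<close>

lemma V_eq: "V = 4 * m * s * s" "Kq = 4 * m"
proof -
  define a where "a = n - 2 * sg - 2"
  have "2 * sg + 2 \<le> n" using sg_le n_ge by linarith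
  then have n: "n = 2 + a + sg + sg" by (simp add: a_def)
  have "V = 4 * 2 ^ a * s * s" unfolding V_def s_def by (subst n) (simp add: power_add)
  moreover have "m = 2 ^ a" by (simp add: m_def a_def)
  moreover have "Kq = 4 * 2 ^ a" unfolding Kq_def by (subst n) (simp add: power_add)
  ultimately show "V = 4 * m * s * s" "Kq = 4 * m" by simp_all
qed

text \<open>Expected hits minus expected penalties: of \<open>m * s / V = 1 / (4 * s)\<close> hits,
  key collisions discount at most one half and repeated occurrences at most one quarter.\<close>

lemma avg_row:
  assumes x: "x < V"
  shows "1 / (16 * real s) \<le> avg W cs (\<lambda>v. of_bool (row_covers v x))"
proof -
  have cs: "cs = 2 * Suc s" by (simp add: cs_def)
  have m_Gs: "m \<le> Gs" unfolding m_def Gs_def by (rule power_increasing) auto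
  have pos: "0 < real m" "0 < real s" "0 < real V" using pos_params by simp_all
  define A where "A j k v = (of_bool (xk k v j = x) :: real)" for j k v
  define B where "B j k v = (\<Sum>j'\<in>{..<m} - {j}. (of_bool (xk k v j = x \<and> key s v j = key s v j') :: real))" for j k v
  define C' where "C' j k v = (\<Sum>j'<m. \<Sum>k'\<in>{k<..<s}. (of_bool (xk k v j = x \<and> xk k' v j' = x) :: real))" for j k v
  have trm: "1 / V - m * (beta s / V) - m * (s * (1 / (real V * V))) \<le>
      avg W cs (\<lambda>v. A j k v - B j k v - C' j k v)" if jk: "j < m" "k < s" for j k
  proof -
    have "avg W cs (A j k) = 1 / V"
      unfolding A_def using x jk by (intro avg_xk) (auto simp: cs)
    moreover have "avg W cs (B j k) \<le> m * (beta s / V)"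
    proof -
      have "avg W cs (B j k) = (\<Sum>j'\<in>{..<m} - {j}. avg W cs (\<lambda>v. of_bool (xk k v j = x \<and> key s v j = key s v j')))"
        unfolding B_def by (rule avg_sum)
      also have "\<dots> \<le> real (card ({..<m} - {j})) * (beta s / V)"
      proof (rule sum_bounded_above)
        fix j' assume "j' \<in> {..<m} - {j}"
        then show "avg W cs (\<lambda>v. of_bool (xk k v j = x \<and> key s v j = key s v j')) \<le> beta s / V"
          unfolding cs using x jk m_Gs by (intro avg_xk_key) auto
      qed
      also have "\<dots> \<le> m * (beta s / V)"
        using beta_nonneg[of s] by (intro mult_right_mono) (simp_all add: card_Diff_subset_Int)
      finally show ?thesis .
    qed
    moreover have "avg W cs (C' j k) \<le> m * (s * (1 / (real V * V)))"
    proof -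
      have "avg W cs (C' j k) = (\<Sum>j'<m. \<Sum>k'\<in>{k<..<s}. avg W cs (\<lambda>v. of_bool (xk k v j = x \<and> xk k' v j' = x)))"
        unfolding C'_def by (simp only: avg_sum)
      also have "\<dots> = (\<Sum>j'<m. \<Sum>k'\<in>{k<..<s}. 1 / (real V * V))"
        using x by (intro sum.cong refl avg_xk_xk) (auto simp: cs)
      also have "\<dots> = real m * (real (s - Suc k) * (1 / (real V * V)))" by simp
      also have "\<dots> \<le> m * (s * (1 / (real V * V)))"
        by (intro mult_left_mono mult_right_mono) auto
      finally show ?thesis .
    qed
    ultimately show ?thesis by (simp add: avg_diff)
  qed
  \<comment> \<open>One quarter is \<open>m * s * s / V\<close>, from merging columns, the other is
    \<open>m / Kq\<close>, from colliding slots.\<close>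
  have mb: "m * beta s = 1 / 2"
    using pos by (simp add: beta_def V_eq field_simps)
  have ms: "m * real s / V \<le> 1 / 4" "m * real s * (1 / V) = 1 / (4 * s)"
    using pos by (simp_all add: V_eq field_simps)
  have "1 / (16 * real s) = m * real s * (1 / V) * (1 / 4)" using ms(2) by simp
  also have "\<dots> \<le> m * real s * (1 / V) * (1 - m * beta s - m * real s / V)"
    using ms(1) pos by (intro mult_left_mono) (simp_all add: mb)
  also have "\<dots> = (\<Sum>j<m. \<Sum>k<s. 1 / V - m * (beta s / V) - m * (s * (1 / (real V * V))))"
    using pos by (simp add: field_simps)
  also have "\<dots> \<le> (\<Sum>j<m. \<Sum>k<s. avg W cs (\<lambda>v. A j k v - B j k v - C' j k v))"
    by (intro sum_mono trm) auto
  also have "\<dots> = avg W cs (\<lambda>v. \<Sum>j<m. \<Sum>k<s. A j k v - B j k v - C' j k v)"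
    by (simp only: avg_sum)
  also have "\<dots> \<le> avg W cs (\<lambda>v. of_bool (row_covers v x))"
    unfolding A_def B_def C'_def by (intro avg_mono row_covers_ge)
  finally show ?thesis .
qed

definition row_seeds :: "nat \<Rightarrow> nat list \<Rightarrow> nat list" where
  "row_seeds i \<omega> = take cs (drop (i * cs) \<omega>)"

text \<open>Tables use disjoint seeds, so the probabilities of missing \<open>x\<close>
  multiply.\<close>

lemma avg_rows:
  assumes x: "x < V"
  shows "avg W (i * cs) (\<lambda>\<omega>. of_bool (\<forall>i'<i. \<not> row_covers (row_seeds i' \<omega>) x)) \<le> (1 - 1 / (16 * real s)) ^ i"
proof (induction i)
  case (Suc i)
  have nonneg: "0 \<le> 1 - 1 / (16 * real s)"
  proof -
    have "1 \<le> real s" using pos_params(2) by simp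
    then show ?thesis by simp
  qed
  let ?F = "\<lambda>\<omega>. of_bool (\<forall>i'<i. \<not> row_covers (row_seeds i' \<omega>) x) :: real"
  have split: "(of_bool (\<forall>i'<Suc i. \<not> row_covers (row_seeds i' (u @ v)) x) :: real) =
      (1 - of_bool (row_covers u x)) * ?F v" if "length u = cs" for u v
  proof -
    have "row_seeds (Suc i') (u @ v) = row_seeds i' v" "row_seeds 0 (u @ v) = u" for i'
      using that by (simp_all add: row_seeds_def)
    then show ?thesis by (simp add: All_less_Suc2 of_bool_conj of_bool_not_iff)
  qed
  have "avg W (Suc i * cs) (\<lambda>\<omega>. of_bool (\<forall>i'<Suc i. \<not> row_covers (row_seeds i' \<omega>) x)) =
      avg W cs (\<lambda>u. avg W (i * cs) (\<lambda>v. of_bool (\<forall>i'<Suc i. \<not> row_covers (row_seeds i' (u @ v)) x)))"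
    by (simp add: avg_append)
  also have "\<dots> = avg W cs (\<lambda>u. avg W (i * cs) ?F * (1 - of_bool (row_covers u x)))"
    by (rule avg_cong) (simp add: split avg_cmult)
  also have "\<dots> = avg W (i * cs) ?F * (1 - avg W cs (\<lambda>u. of_bool (row_covers u x)))"
    by (simp add: avg_cmult avg_diff)
  also have "\<dots> \<le> (1 - 1 / (16 * real s)) ^ i * (1 - 1 / (16 * real s))"
  proof (intro mult_mono)
    show "1 - avg W cs (\<lambda>u. of_bool (row_covers u x)) \<le> 1 - 1 / (16 * real s)" using avg_row[OF x] by simp
    have "avg W cs (\<lambda>u. of_bool (row_covers u x)) \<le> avg W cs (\<lambda>_. 1)" by (intro avg_mono) simp
    then show "0 \<le> 1 - avg W cs (\<lambda>u. of_bool (row_covers u x))" by simp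
  qed (use Suc nonneg in auto)
  finally show ?case by (simp add: mult.commute)
qed simp

text \<open>Translates between seeds indexed from 0 within a table and their addresses in
  memory.\<close>

lemma covering_if_rows:
  assumes len: "r * cs \<le> length \<omega>" and rows: "\<And>x. x < N \<Longrightarrow> \<exists>i<r. row_covers (row_seeds i \<omega>) x"
  shows "covering (seed_mem \<omega>)"
  unfolding covering_def
proof (intro allI impI)
  fix x assume "x < N"
  then obtain i j k where *: "i < r" "j < m" "k < s" "xk k (row_seeds i \<omega>) j = x"
    "\<And>j'. j' < m \<Longrightarrow> j' \<noteq> j \<Longrightarrow> key s (row_seeds i \<omega>) j' \<noteq> key s (row_seeds i \<omega>) j"
    using rows unfolding row_covers_def by metis
  let ?v = "row_seeds i \<omega>" and ?p = "Gs + i * cs" and ?M = "seed_mem \<omega>"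
  have "Suc i * cs \<le> r * cs" using *(1) by (intro mult_le_mono1) simp
  then have v: "?v ! a = ?M (?p + a)" if "a < cs" for a
    using that len by (simp add: row_seeds_def seed_mem_def)
  have w: "walk ?M ?p q g = walk ((!) ?v) 0 q g" if "q \<le> s" for q g
    using that by (intro walk_shift) (simp add: v cs_def)
  have "?M (?p + 2 * q) = ?v ! (2 * q)" "?M (?p + 2 * q + 1) = ?v ! (2 * q + 1)" if "q \<le> s" for q
    using that v[of "2 * q"] v[of "2 * q + 1"] by (simp_all add: cs_def)
  then have "xv ?M (?p + 2 * q) (walk ?M ?p q g) = xk q ?v g" "kv ?M (?p + 2 * q) (walk ?M ?p q g) = key q ?v g"
    if "q \<le> s" for q g
    using that w by (simp_all add: xk_def key_def xv_def kv_def hsh_def)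
  then show "\<exists>i<r. \<exists>j<m. \<exists>k<s. xv ?M (Gs + i * cs + 2 * k) (walk ?M (Gs + i * cs) k j) = x \<and>
      (\<forall>j'<m. j' \<noteq> j \<longrightarrow> ckey ?M i j' \<noteq> ckey ?M i j)"
    using * by (intro exI[of _ i] exI[of _ j] exI[of _ k] conjI) (auto simp: ckey_def)
qed

text \<open>The number of tables makes \<open>r / (16 * s)\<close> equal to
  \<open>(d + 1) * n\<close>, so \<open>x\<close> is missed with probability at most
  \<open>2 ^ (- (d + 1) * n)\<close>, hence \<open>N ^ (- (d + 1))\<close>. The union bound over
  \<open>N\<close> elements uses up one power.\<close>

lemma failure_bound:
  assumes "C = 16 * Suc d"
  shows "real N * (1 - 1 / (16 * real s)) ^ r \<le> 1 / real N ^ d"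
proof -
  have s: "1 \<le> real s" using pos_params(2) by simp
  have "(1 - 1 / (16 * real s)) ^ r \<le> exp (- (1 / (16 * real s))) ^ r"
    using s exp_ge_add_one_self[of "- (1 / (16 * real s))"] by (intro power_mono) auto
  also have "\<dots> = exp (- (real r / (16 * real s)))"
    by (simp add: exp_of_nat_mult[symmetric])
  also have "real r / (16 * real s) = real (Suc d * n)"
  proof -
    have "real r = 16 * real (Suc d) * real s * real n" by (subst r_def) (simp add: assms)
    then show ?thesis using s by (simp add: field_simps)
  qed
  also have "exp (- real (Suc d * n)) = exp (- 1) ^ (Suc d * n)"
    by (subst exp_of_nat_mult[symmetric]) simp
  also have "\<dots> \<le> (1 / 2) ^ (Suc d * n)"
  proof (intro power_mono)
    have "2 \<le> exp (1 :: real)" using exp_ge_add_one_self[of 1] by simp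
    then show "exp (- 1) \<le> (1 / 2 :: real)" by (simp add: exp_minus field_simps)
  qed simp
  also have "\<dots> = 1 / real V ^ Suc d"
    by (simp add: V_def power_mult[symmetric] power_one_over power_add mult.commute)
  also have "\<dots> \<le> 1 / real N ^ Suc d"
    using N_pos N_le_V by (intro divide_left_mono power_mono) auto
  finally have "real N * (1 - 1 / (16 * real s)) ^ r \<le> real N * (1 / real N ^ Suc d)"
    by (intro mult_left_mono) auto
  then show ?thesis using N_pos by simp
qed

text \<open>Union bound over all \<open>x\<close>; words beyond the \<open>r * cs\<close> seeds are
  averaged out.\<close>

lemma prob_covering:
  assumes C: "C = 16 * Suc d" and L: "r * cs \<le> L"
  shows "1 - 1 / real N ^ d \<le> measure_pmf.prob (unif_words W L) {\<omega>. covering (seed_mem \<omega>)}"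
proof -
  let ?miss = "\<lambda>x \<omega>. \<forall>i<r. \<not> row_covers (row_seeds i \<omega>) x"
  obtain L' where L': "L = r * cs + L'" using L le_Suc_ex by blast
  have miss: "avg W L (\<lambda>\<omega>. of_bool (?miss x \<omega>)) \<le> (1 - 1 / (16 * real s)) ^ r" if "x < N" for x
  proof -
    have "row_seeds i (u @ v) = row_seeds i u" if "length u = r * cs" "i < r" for i u v
    proof -
      have "Suc i * cs \<le> r * cs" using that by (intro mult_le_mono1) simp
      then show ?thesis using that by (simp add: row_seeds_def)
    qed
    then have "avg W L (\<lambda>\<omega>. of_bool (?miss x \<omega>)) = avg W (r * cs) (\<lambda>u. of_bool (?miss x u))"
      unfolding L' avg_append by (intro avg_cong) simp
    then show ?thesis using avg_rows[of x r] that N_le_V by simp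
  qed
  have "1 - 1 / real N ^ d \<le> 1 - real N * (1 - 1 / (16 * real s)) ^ r"
    using failure_bound[OF C] by simp
  also have "\<dots> \<le> 1 - (\<Sum>x<N. avg W L (\<lambda>\<omega>. of_bool (?miss x \<omega>)))"
    using sum_bounded_above[of "{..<N}" "\<lambda>x. avg W L (\<lambda>\<omega>. of_bool (?miss x \<omega>))"] miss by simp
  also have "\<dots> = avg W L (\<lambda>\<omega>. 1 - (\<Sum>x<N. of_bool (?miss x \<omega>)))"
    by (simp only: avg_diff avg_sum avg_const)
  also have "\<dots> \<le> avg W L (\<lambda>\<omega>. of_bool (covering (seed_mem \<omega>)))"
  proof (rule avg_mono)
    fix \<omega> :: "nat list" assume len: "length \<omega> = L"
    show "1 - (\<Sum>x<N. of_bool (?miss x \<omega>)) \<le> (of_bool (covering (seed_mem \<omega>)) :: real)"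
    proof (cases "\<exists>x<N. ?miss x \<omega>")
      case True
      then obtain x where "x < N" "?miss x \<omega>" by blast
      then have "1 \<le> (\<Sum>x<N. (of_bool (?miss x \<omega>) :: real))"
        using member_le_sum[of x "{..<N}" "\<lambda>x. of_bool (?miss x \<omega>) :: real"] by simp
      then show ?thesis by (simp add: of_bool_def)
    next
      case False
      then have "covering (seed_mem \<omega>)" using L len by (intro covering_if_rows) auto
      then show ?thesis by (simp add: sum_nonneg)
    qed
  qed
  finally show ?thesis by (simp only: prob_unif_words)
qed

end

section \<open>The word RAM programs\<close>

context inversion
begin

text \<open>Queries start with the data structure and their arguments in place of the final memory
  of the construction, so \<open>good\<close> has to be determined by the addresses below
  \<open>D\<close>.\<close>

lemma good_cong:
  assumes eq: "\<And>a. a < D \<Longrightarrow> M a = M' a" and good: "good M"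
  shows "good M'"
  unfolding good_def
proof (intro conjI allI impI)
  fix g assume "g < Gs"
  then show "M' g = smp g" using good eq[of g] by (simp add: good_def D_def aT_def)
next
  fix x assume "x < N"
  then obtain i k where *: "i < r" "k < s" "probe M i k (G x) = x" using good by (auto simp: good_def)
  define p where "p = Gs + i * cs"
  have "Suc i * cs \<le> r * cs" "Suc i * Kq \<le> r * Kq" using *(1) by (intro mult_le_mono1; simp)+
  then have p: "p + 2 * s + 2 \<le> aT" "aT + i * Kq + Kq \<le> D" "aT \<le> D"
    by (simp_all add: D_def aT_def p_def cs_def)
  have w: "walk M p' l g = walk M' p' l g" if "p' + 2 * l \<le> D" for p' l g
    using that by (intro walk_shift eq) simp
  have h: "hsh M a g = hsh M' a g" if "a + 1 < D" for a g
    using that eq by (simp add: hsh_def)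
  have "probe M' i k (G x) = probe M i k (G x)"
    unfolding probe_def p_def[symmetric] Let_def
  proof -
    have e: "walk M (p + 2 * (k + 1)) (s - k - 1) (G x) = walk M' (p + 2 * (k + 1)) (s - k - 1) (G x)"
      using p *(2) by (intro w) simp
    define a where "a = walk M' (p + 2 * (k + 1)) (s - k - 1) (G x)"
    have kv: "kv M (p + 2 * s) a = kv M' (p + 2 * s) a" using p by (simp add: kv_def h)
    have j: "M (aT + i * Kq + kv M' (p + 2 * s) a) = M' (aT + i * Kq + kv M' (p + 2 * s) a)"
      using p kv_less[of M' "p + 2 * s" a] by (intro eq) simp
    have wk: "walk M p k j' = walk M' p k j'" for j' using p *(2) by (intro w) simp
    have xv: "xv M (p + 2 * k) b = xv M' (p + 2 * k) b" for b using p *(2) by (simp add: xv_def h)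
    show "xv M' (p + 2 * k) (walk M' p k (M' (aT + i * Kq +
            kv M' (p + 2 * s) (walk M' (p + 2 * (k + 1)) (s - k - 1) (G x))))) =
          xv M (p + 2 * k) (walk M p k (M (aT + i * Kq +
            kv M (p + 2 * s) (walk M (p + 2 * (k + 1)) (s - k - 1) (G x)))))"
      unfolding e a_def[symmetric] kv j wk xv by simp
  qed
  then show "\<exists>i<r. \<exists>k<s. probe M' i k (G x) = x" using * by metis
qed

text \<open>A common bound for the polylogarithmic quantities; the 30 absorbs additive
  constants.\<close>

definition "X = \<tau> + w + n + 30"

lemma X_bounds: "30 \<le> X" "\<tau> \<le> X" "nw \<le> w" "w \<le> X" "n + 1 \<le> X" "X \<le> X * X" "1 \<le> X" "\<tau> + nw + 20 \<le> X"
proof -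
  show nw: "nw \<le> w" using num_words_le[of W w] pos_params(7) by (simp add: nw_def)
  show "30 \<le> X" "\<tau> \<le> X" "w \<le> X" "n + 1 \<le> X" "1 \<le> X" "\<tau> + nw + 20 \<le> X" using nw by (simp_all add: X_def)
  then show "X \<le> X * X" by simp
qed

lemma r_le: "r \<le> C * s * X"
  using X_bounds(5) unfolding r_def by (intro mult_le_mono2) simp

lemma m_bounds: "m * s * s \<le> V" "4 * m * s = Gs" "s * s \<le> Gs"
proof -
  show "m * s * s \<le> V" by (simp add: V_eq)
  have "4 * m * s * s = Gs * s" by (simp add: Gs_s V_eq)
  then show g: "4 * m * s = Gs" using pos_params(2) by (metis mult_right_cancel neq0_conv)
  have "s \<le> Kq" unfolding s_def Kq_def using sg_le by (intro power_increasing) auto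
  then have "s * s \<le> 4 * m * s" by (simp add: V_eq)
  then show "s * s \<le> Gs" by (simp add: g)
qed

lemma seeds_le: "r * cs \<le> 4 * (C * X * (s * s))"
proof -
  have "cs \<le> 4 * s" using pos_params(2) by (simp add: cs_def)
  then have "r * cs \<le> C * s * X * (4 * s)" using r_le by (intro mult_le_mono)
  then show ?thesis by (simp add: ac_simps)
qed

text \<open>Each part is of order \<open>Gs\<close>: the seeds because of
  \<open>s * s \<le> Gs\<close>, the tables because of
  \<open>s * Kq = 4 * m * s = Gs\<close>.\<close>

lemma D_le: "D \<le> 6 * (C * X * Gs)"
proof -
  have "1 * Gs \<le> C * X * Gs" using C_pos X_bounds(7) by (intro mult_le_mono1) (simp add: Suc_le_eq)
  moreover have "C * X * (s * s) \<le> C * X * Gs" using m_bounds(3) by (rule mult_le_mono2)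
  moreover have "r * Kq \<le> C * X * Gs"
  proof -
    have "r * Kq \<le> C * s * X * Kq" using r_le by (rule mult_le_mono1)
    also have "\<dots> = C * X * (4 * m * s)" by (simp add: V_eq)
    finally show ?thesis by (simp only: m_bounds(2))
  qed
  ultimately show ?thesis using seeds_le unfolding D_def aT_def by linarith
qed

end

context machine
begin

lemma prob_supports:
  assumes n: "\<And>k. 4 \<le> k \<Longrightarrow> N \<le> 2 ^ k \<Longrightarrow> n \<le> k"
    and A: "16 ^ sg \<le> A" "A < 16 ^ Suc sg" "A \<le> N" and C: "C = 16 * Suc d"
    and B: "B_build \<le> Tb" "D \<le> S" "B_rank \<le> Tq" "B_sel \<le> Tq"
  shows "1 - 1 / real N ^ d \<le>
    measure_pmf.prob (run W ev (comp 0 (BUILD C)) Tb (build_start W N w A))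
         {c. halts_within (comp 0 (BUILD C)) Tb c \<and> length (data_structure c) \<le> S \<and>
             supports_ranking W N w A ev f (comp 0 (RANK C)) Tq (data_structure c) \<and>
             supports_selection W N w A ev f (comp 0 (SELECT C)) Tq (data_structure c) \<and>
             supports_median W N w A ev f (comp 0 (MEDIAN C)) Tq (data_structure c)}"
    (is "_ \<le> measure_pmf.prob _ ?good")
proof -
  \<comment> \<open>The deterministic half: whatever produced it, a block of \<open>D\<close> words
    that is \<open>good\<close> answers all queries.\<close>
  have queries: "supports_ranking W N w A ev f (comp 0 (RANK C)) Tq ds \<and>
             supports_selection W N w A ev f (comp 0 (SELECT C)) Tq ds \<and>
             supports_median W N w A ev f (comp 0 (MEDIAN C)) Tq ds"
    if ds: "length ds = D" "good (words_at_start ds)" for ds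
  proof -
    have mem: "words_at_start (ds @ xs) a = words_at_start ds a" if "a < D" for a xs
      using that ds(1) by (simp add: words_at_start_def nth_append)
    have good: "good (words_at_start (ds @ xs))" for xs
      by (rule good_cong[OF _ ds(2)]) (simp add: mem)
    have query: "query N W w n sg C \<tau> f ev (words_at_start (ds @ xs)) y" if "y < 2 ^ w" for y xs
      using that good[of xs] by unfold_locales (auto simp: good_def)
    have num: "num_at D y \<lparr>rg = R, mm = words_at_start (ds @ encode W w y @ xs), rnd = \<omega>\<rparr>" for R \<omega> xs y
      using ds(1) by (auto simp: num_at_def words_at_start_def nth_append encode_nth nw_def)
    have init: "ok W ev (INIT C) B_init (\<lambda>q'. env q' \<and> rg q' 4 = D \<and> rg q' 5 = k \<and> mm q' = M)
       \<lparr>rg = words_at_start [N, w, W, A, length ds, k], mm = M, rnd = \<omega>\<rparr>" for k M \<omega>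
      by (rule ok_mono[OF INIT_ok[OF _ _ _ _ n A]]) (auto simp: words_at_start_def ds(1))
    have "answers W ev (comp 0 (RANK C)) Tq (query_start W N w A ds 0 [y, z]) read_number
          (card {x \<in> {..<N}. f x = y \<and> x < z})" if yz: "y < 2 ^ w" "z < 2 ^ w" for y z
    proof (rule answers_ok)
      let ?M = "words_at_start (ds @ concat (map (encode W w) [y, z]))"
      interpret query N W w n sg C \<tau> f ev ?M y by (rule query) (rule yz)
      fix \<omega>
      have "num_at (D + nw) z \<lparr>rg = R, mm = ?M, rnd = \<omega>\<rparr>" for R
        using ds(1) by (auto simp: num_at_def words_at_start_def nth_append encode_nth nw_def)
      moreover have "nw = 0 \<Longrightarrow> ?M D = 0"
        using ds(1) by (simp add: words_at_start_def nw_def)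
      moreover have "num_at D y \<lparr>rg = R, mm = ?M, rnd = \<omega>\<rparr>" for R
        using num[of y R "encode W w z" \<omega>] by simp
      ultimately have M: "qpre q' \<and> zpre z q'" if "env q' \<and> rg q' 4 = D \<and> rg q' 5 = 0 \<and> mm q' = ?M" for q'
        using that unfolding qpre_def zpre_def num_at_def by simp
      have "ok W ev (INIT C) B_init (\<lambda>q'. qpre q' \<and> zpre z q')
         \<lparr>rg = words_at_start [N, w, W, A, length ds, 0], mm = ?M, rnd = \<omega>\<rparr>"
        by (rule ok_mono[OF init[of 0 ?M \<omega>]]) (rule M, simp_all)
      from RANK_ok[OF this good yz(2)]
      show "ok W ev (RANK C) B_rank (\<lambda>q. read_number \<lparr>pc = 0, regs = rg q, mem = mm q, time = 0\<rparr> =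
              card {x \<in> {..<N}. f x = y \<and> x < z})
         \<lparr>rg = regs (query_start W N w A ds 0 [y, z]), mm = mem (query_start W N w A ds 0 [y, z]), rnd = \<omega>\<rparr>"
        by (simp add: query_start_def start_def read_number_def)
    qed (use B in \<open>simp_all add: query_start_def start_def read_number_def\<close>)
    moreover have "answers W ev (comp 0 (SELECT C)) Tq (query_start W N w A ds k [y]) read_option
          (kth_largest k (preimages N f y))" if y: "y < 2 ^ w" for y k
    proof (rule answers_ok)
      let ?M = "words_at_start (ds @ concat (map (encode W w) [y]))"
      interpret query N W w n sg C \<tau> f ev ?M y by (rule query) (rule y)
      fix \<omega>
      have "num_at D y \<lparr>rg = R, mm = ?M, rnd = \<omega>\<rparr>" for R
        using num[of y R "[]" \<omega>] by simp
      then have M: "qpre q' \<and> rg q' 5 = k" if "env q' \<and> rg q' 4 = D \<and> rg q' 5 = k \<and> mm q' = ?M" for q'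
        using that unfolding qpre_def num_at_def by simp
      have "ok W ev (INIT C) B_init (\<lambda>q'. qpre q' \<and> rg q' 5 = k)
         \<lparr>rg = words_at_start [N, w, W, A, length ds, k], mm = ?M, rnd = \<omega>\<rparr>"
        by (rule ok_mono[OF init[of k ?M \<omega>]]) (rule M, simp_all)
      from SELECT_ok[OF this good]
      show "ok W ev (SELECT C) B_sel (\<lambda>q. read_option \<lparr>pc = 0, regs = rg q, mem = mm q, time = 0\<rparr> =
              kth_largest k (preimages N f y))
         \<lparr>rg = regs (query_start W N w A ds k [y]), mm = mem (query_start W N w A ds k [y]), rnd = \<omega>\<rparr>"
        by (simp add: query_start_def start_def read_option_def result_def cong: if_cong split del: if_split)
    qed (use B in \<open>simp_all add: query_start_def start_def read_option_def\<close>)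
    moreover have "answers W ev (comp 0 (MEDIAN C)) Tq (query_start W N w A ds 0 [y]) read_option
          (median (preimages N f y))" if y: "y < 2 ^ w" for y
    proof (rule answers_ok)
      let ?M = "words_at_start (ds @ concat (map (encode W w) [y]))"
      interpret query N W w n sg C \<tau> f ev ?M y by (rule query) (rule y)
      fix \<omega>
      have "num_at D y \<lparr>rg = R, mm = ?M, rnd = \<omega>\<rparr>" for R
        using num[of y R "[]" \<omega>] by simp
      then have M: "qpre q' \<and> rg q' 5 = 0" if "env q' \<and> rg q' 4 = D \<and> rg q' 5 = 0 \<and> mm q' = ?M" for q'
        using that unfolding qpre_def num_at_def by simp
      have "ok W ev (INIT C) B_init (\<lambda>q'. qpre q' \<and> rg q' 5 = 0)
         \<lparr>rg = words_at_start [N, w, W, A, length ds, 0], mm = ?M, rnd = \<omega>\<rparr>"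
        by (rule ok_mono[OF init[of 0 ?M \<omega>]]) (rule M, simp_all)
      from MEDIAN_ok[OF this good]
      show "ok W ev (MEDIAN C) B_sel (\<lambda>q. read_option \<lparr>pc = 0, regs = rg q, mem = mm q, time = 0\<rparr> =
              median (preimages N f y))
         \<lparr>rg = regs (query_start W N w A ds 0 [y]), mm = mem (query_start W N w A ds 0 [y]), rnd = \<omega>\<rparr>"
        by (simp add: query_start_def start_def read_option_def result_def cong: if_cong split del: if_split)
    qed (use B in \<open>simp_all add: query_start_def start_def read_option_def\<close>)
    ultimately show ?thesis
      unfolding supports_ranking_def supports_selection_def supports_median_def by blast
  qed
  let ?run = "\<lambda>\<omega>. fst ((dstep W ev (comp 0 (BUILD C)) ^^ Tb) (build_start W N w A, \<omega>))"
  \<comment> \<open>A supply of \<open>Tb\<close> words, one for each step, therefore contains all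
    seeds.\<close>
  have K: "r * cs \<le> Tb" using B(1) by (simp add: B_build_def)
  have built: "?run \<omega> \<in> ?good" if \<omega>: "length \<omega> = Tb" "covering (seed_mem \<omega>)" for \<omega>
  proof -
    have init: "ok W ev (INIT C) B_init (\<lambda>q'. env q' \<and> rnd q' = \<omega>)
        \<lparr>rg = regs (build_start W N w A), mm = mem (build_start W N w A), rnd = \<omega>\<rparr>"
      by (rule ok_mono[OF INIT_ok[OF _ _ _ _ n A]])
         (auto simp: build_start_def start_def words_at_start_def)
    have "ok W ev (BUILD C) B_build (\<lambda>q'. rg q' 0 = D \<and> good (mm q'))
        \<lparr>rg = regs (build_start W N w A), mm = mem (build_start W N w A), rnd = \<omega>\<rparr>"
      using BUILD_ok[OF init _ \<omega>(2)] K \<omega>(1) by simp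
    from dstep_ok[OF this B(1)] obtain q :: st where
      q: "halts_within (comp 0 (BUILD C)) Tb (?run \<omega>)" "rg q 0 = D" "good (mm q)"
         "regs (?run \<omega>) = rg q" "mem (?run \<omega>) = mm q"
      by (auto simp: build_start_def start_def)
    define ds where "ds = data_structure (?run \<omega>)"
    have len: "length ds = D" using q by (simp add: ds_def data_structure_def)
    have "good (words_at_start ds)"
      by (rule good_cong[OF _ q(3)]) (use q in \<open>simp add: ds_def data_structure_def words_at_start_def\<close>)
    from queries[OF len this] show ?thesis using q(1) len B(2) by (simp add: ds_def)
  qed
  have "1 - 1 / real N ^ d \<le> measure_pmf.prob (unif_words W Tb) {\<omega>. covering (seed_mem \<omega>)}"
    by (rule prob_covering[OF C K])
  also have "\<dots> \<le> measure_pmf.prob (unif_words W Tb) (?run -` ?good)"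
  proof -
    have "{\<omega>. covering (seed_mem \<omega>)} \<inter> set_pmf (unif_words W Tb) \<subseteq> ?run -` ?good"
      using built by (auto simp: set_replicate_pmf)
    then have "measure_pmf.prob (unif_words W Tb) ({\<omega>. covering (seed_mem \<omega>)} \<inter> set_pmf (unif_words W Tb)) \<le>
        measure_pmf.prob (unif_words W Tb) (?run -` ?good)"
      by (intro measure_pmf.finite_measure_mono) auto
    then show ?thesis by (simp add: measure_Int_set_pmf)
  qed
  also have "\<dots> = measure_pmf.prob (run W ev (comp 0 (BUILD C)) Tb (build_start W N w A)) ?good"
    by (simp add: run_conv_unif_words[OF order.refl] measure_map_pmf)
  finally show ?thesis .
qed


section \<open>Bounds on time and space\<close>

text \<open>The cube arises from \<open>r\<close> tables, \<open>s\<close> columns, and two walks of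
  at most \<open>s\<close> steps per probe; evaluations and binary searches go into powers of
  \<open>X\<close>.\<close>

lemma B_cnt_le: "B_cnt \<le> 130 * (C * s ^ 3 * X ^ 3)"
proof -
  have s: "1 \<le> s" and C1: "1 \<le> C" using pos_params C_pos by simp_all
  define Y where "Y = s * (X * X)"
  have XY: "X * X \<le> Y" "s \<le> Y" "30 \<le> Y" 
  proof -
    have "1 * (X * X) \<le> s * (X * X)" using s by (rule mult_le_mono1)
    then show "X * X \<le> Y" by (simp add: Y_def)
    have "1 * 1 \<le> X * X" using X_bounds(7) by (intro mult_le_mono)
    then have "s * 1 \<le> s * (X * X)" by (intro mult_le_mono2) simp
    then show "s \<le> Y" by (simp add: Y_def)
    show "30 \<le> Y" using \<open>X * X \<le> Y\<close> X_bounds(1,6) by linarith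
  qed
  have 1: "B_less \<le> 15 * X" using X_bounds by (simp add: B_less_def X_def)
  have "(n + 1) * (B_less + 24) \<le> X * (16 * X)" using X_bounds 1 by (intro mult_le_mono) linarith+
  then have 2: "B_loc \<le> 17 * (X * X)" using X_bounds(1,6) unfolding B_loc_def by linarith
  then have 3: "B_grp \<le> 18 * (X * X)" using X_bounds unfolding B_grp_def by linarith
  have "s * (B_grp + 20) \<le> s * (19 * (X * X))" using 3 X_bounds by (intro mult_le_mono2) linarith
  moreover have "s * (19 * (X * X)) = 19 * Y" by (simp add: Y_def)
  ultimately have 4: "B_walk \<le> 20 * Y" using XY unfolding B_walk_def by linarith
  have 5: "B_dedup \<le> 21 * Y" using XY unfolding B_dedup_def by linarith
  have 6: "B_test \<le> 60 * Y" using 1 3 5 XY X_bounds unfolding B_test_def by linarith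
  have 7: "B_try + 3 \<le> 102 * Y" using 4 6 XY unfolding B_try_def by linarith
  define Z where "Z = s * Y"
  have Z: "Y \<le> Z" using s by (simp add: Z_def)
  have "s * (B_try + 3) \<le> s * (102 * Y)" using 7 by (rule mult_le_mono2)
  moreover have "s * (102 * Y) = 102 * Z" by (simp add: Z_def)
  ultimately have "s * (B_try + 3) + 8 \<le> 103 * Z" using Z XY by linarith
  then have 8: "r * (s * (B_try + 3) + 8) \<le> C * s * X * (103 * Z)" using r_le by (intro mult_le_mono)
  have "1 * Z \<le> C * s * X * Z" using C1 s X_bounds(7) by (intro mult_le_mono1) (simp add: Suc_le_eq)
  then have "B_cnt \<le> 130 * (C * s * X * Z)"
    using 8 2 XY Z unfolding B_cnt_def by linarith
  then show ?thesis by (simp add: Z_def Y_def power3_eq_cube ac_simps)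
qed


lemma B_query_le: "B_rank \<le> 600 * (C * s ^ 3 * X ^ 4)" "B_sel \<le> 600 * (C * s ^ 3 * X ^ 4)"
proof -
  define Z where "Z = C * s ^ 3 * X ^ 3"
  have Z4: "C * s ^ 3 * X ^ 4 = X * Z" by (simp add: Z_def numeral_eq_Suc ac_simps)
  have "1 * X ^ 1 \<le> C * s ^ 3 * X ^ 3"
    using C_pos pos_params X_bounds(7) by (intro mult_le_mono power_increasing) (simp_all add: Suc_le_eq)
  then have XZ: "X \<le> Z" by (simp add: Z_def)
  have "1 * Z \<le> X * Z" using X_bounds(7) by (rule mult_le_mono1)
  then have ZX: "Z \<le> X * Z" by simp
  have c: "B_cnt \<le> 130 * Z" using B_cnt_le by (simp add: Z_def)
  have "(n + 1) * (B_cnt + 10) \<le> X * (131 * Z)"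
    using X_bounds c XZ by (intro mult_le_mono) linarith+
  then have f: "B_find \<le> 132 * (X * Z)" using ZX XZ X_bounds(1) unfolding B_find_def by linarith
  have i: "B_init \<le> 20 * X + 60" using X_bounds(5) by (simp add: B_init_def)
  show "B_rank \<le> 600 * (C * s ^ 3 * X ^ 4)" "B_sel \<le> 600 * (C * s ^ 3 * X ^ 4)"
    unfolding Z4 B_rank_def B_sel_def using i c f ZX XZ X_bounds(1,3,4) by linarith+
qed

text \<open>Filling the tables takes about \<open>r * m * s\<close> steps, which is \<open>V\<close>
  up to small factors by \<open>m * s * s \<le> V\<close>; sorting takes \<open>w\<close> rounds
  over arrays of at most \<open>V\<close> cells.\<close>

lemma B_build_le: "B_build \<le> 200 * (C * (X * X) * V)"
proof -
  define U where "U = C * (X * X) * V"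
  have V1: "1 \<le> V" "1 \<le> C" "1 \<le> s" "1 \<le> m" using pos_params C_pos by simp_all
  have XXV: "X * X * V \<le> U" using V1(2) by (simp add: U_def)
  have CXV: "C * X * V \<le> U" unfolding U_def using X_bounds(6) by (intro mult_le_mono) simp_all
  have XV: "X * V \<le> X * X * V" using X_bounds(6) by (intro mult_le_mono1)
  have VX: "30 * V \<le> X * V" using X_bounds(1) by (rule mult_le_mono1)
  have XX: "X \<le> X * V" using V1(1) by simp
  have 1: "B_init \<le> 22 * U" using X_bounds(1,5) XX XV XXV unfolding B_init_def by linarith
  have "C * X * (s * s) \<le> C * X * V"
  proof (intro mult_le_mono2)
    have "s * s \<le> Gs" "Gs \<le> V" using m_bounds(3) Gs_le_V(1) by simp_all
    then show "s * s \<le> V" by simp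
  qed
  then have 2: "r * cs * 6 \<le> 24 * U" using seeds_le CXV by linarith
  have "N * (\<tau> + nw + 20) \<le> V * X" using N_le_V X_bounds(8) by (rule mult_le_mono)
  then have p: "B_pass \<le> X * V + 3" unfolding B_pass_def by (simp add: mult.commute)
  have "B_bit + 3 \<le> 3 * (X * V)" using p N_le_V VX V1(1) unfolding B_bit_def B_copy_def by linarith
  then have "w * (B_bit + 3) \<le> X * (3 * (X * V))" using X_bounds(4) by (intro mult_le_mono)
  moreover have "X * (3 * (X * V)) = 3 * (X * X * V)" by simp
  ultimately have 3: "B_sort \<le> 10 * U"
    using XXV XV VX V1(1) unfolding B_sort_def by linarith
  have "m * (B_chain + 3) + 8 \<le> 38 * (m * s)"
  proof -
    have "m * (B_chain + 3) \<le> m * (30 * s)" using V1(3) by (intro mult_le_mono2) (simp add: B_chain_def)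
    moreover have "1 * 1 \<le> m * s" using V1 by (intro mult_le_mono)
    moreover have "m * (30 * s) = 30 * (m * s)" by simp
    ultimately show ?thesis by linarith
  qed
  then have "r * (m * (B_chain + 3) + 8) \<le> C * s * X * (38 * (m * s))" using r_le by (intro mult_le_mono)
  also have "\<dots> = 38 * (C * X * (m * s * s))" by simp
  also have "\<dots> \<le> 38 * (C * X * V)" using m_bounds(1) by (intro mult_le_mono2)
  finally have 4: "B_tables \<le> 39 * U" using CXV XXV XV VX V1 unfolding B_tables_def by linarith
  have "V * 14 + 30 \<le> 2 * U" using XXV XV VX V1(1) by linarith
  then show ?thesis unfolding U_def[symmetric] B_build_def using 1 2 3 4 by linarith
qed

end

section \<open>Asymptotic estimates and the choice of parameters\<close>

lemma soft_O_power_mono: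
  assumes "c \<le> c'"
  shows "(\<lambda>N. g N * ln (real N) ^ c) \<in> O(\<lambda>N. g N * ln (real N) ^ c')"
proof (rule landau_o.big_mono)
  show "eventually (\<lambda>N. norm (g N * ln (real N) ^ c) \<le> norm (g N * ln (real N) ^ c')) sequentially"
  proof (rule eventually_mono[OF eventually_ge_at_top[of 3]])
    \<comment> \<open>From 3 on the logarithm is at least 1, so that a larger exponent cannot
      decrease the bound.\<close>
    fix N :: nat assume N: "3 \<le> N"
    have "exp 1 \<le> real N" using exp_le N by linarith
    then have "1 \<le> ln (real N)" using N by (subst ln_ge_iff) auto
    then have "\<bar>ln (real N) ^ c\<bar> \<le> \<bar>ln (real N) ^ c'\<bar>" using assms by (simp add: power_increasing)
    then show "norm (g N * ln (real N) ^ c) \<le> norm (g N * ln (real N) ^ c')"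
      by (simp add: abs_mult mult_left_mono)
  qed
qed

lemma soft_O_add:
  assumes "h \<in> soft_O g" "h' \<in> soft_O g"
  shows "(\<lambda>N. h N + h' N) \<in> soft_O g"
proof -
  obtain c c' where c: "h \<in> O(\<lambda>N. g N * ln (real N) ^ c)" "h' \<in> O(\<lambda>N. g N * ln (real N) ^ c')"
    using assms by (auto simp: soft_O_def)
  let ?c = "max c c'"
  have "h \<in> O(\<lambda>N. g N * ln (real N) ^ ?c)" "h' \<in> O(\<lambda>N. g N * ln (real N) ^ ?c)"
    by (rule landau_o.big_trans[OF c(1) soft_O_power_mono], simp,
        rule landau_o.big_trans[OF c(2) soft_O_power_mono], simp)
  then have "(\<lambda>N. h N + h' N) \<in> O(\<lambda>N. g N * ln (real N) ^ ?c)" by (rule sum_in_bigo)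
  then show ?thesis by (auto simp: soft_O_def)
qed

lemma soft_O_mult:
  assumes "h \<in> soft_O g" "h' \<in> soft_O g'"
  shows "(\<lambda>N. h N * h' N) \<in> soft_O (\<lambda>N. g N * g' N)"
proof -
  obtain c c' where c: "h \<in> O(\<lambda>N. g N * ln (real N) ^ c)" "h' \<in> O(\<lambda>N. g' N * ln (real N) ^ c')"
    using assms by (auto simp: soft_O_def)
  have "(\<lambda>N. h N * h' N) \<in> O(\<lambda>N. (g N * ln (real N) ^ c) * (g' N * ln (real N) ^ c'))"
    using c by (rule landau_o.big.mult)
  also have "(\<lambda>N. (g N * ln (real N) ^ c) * (g' N * ln (real N) ^ c')) =
      (\<lambda>N. g N * g' N * ln (real N) ^ (c + c'))"
    by (simp add: power_add ac_simps)
  finally show ?thesis by (auto simp: soft_O_def)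
qed

lemma soft_O_bigo: "h \<in> O(g) \<Longrightarrow> h \<in> soft_O g"
  unfolding soft_O_def by (intro CollectI exI[of _ 0]) simp

lemma soft_O_const [simp]: "(\<lambda>_. c) \<in> soft_O (\<lambda>_. 1)"
  by (rule soft_O_bigo) simp

lemma soft_O_mult_polylog:
  "h \<in> soft_O g \<Longrightarrow> h' \<in> soft_O (\<lambda>_. 1) \<Longrightarrow> (\<lambda>N. h' N * h N) \<in> soft_O g"
  using soft_O_mult[of h' "\<lambda>_. 1" h g] by simp

lemma soft_O_power:
  assumes "h \<in> soft_O (\<lambda>_. 1)"
  shows "(\<lambda>N. h N ^ k) \<in> soft_O (\<lambda>_. 1)"
  by (induction k) (use assms soft_O_mult_polylog in auto)

text \<open>Word lengths have to suffice for every positive \<open>N\<close>, not only eventually.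
  As the base is at least 2, \<open>k < 2 ^ k\<close> moves the constant factor and the finitely
  many exceptions into the exponent.\<close>

lemma polylog_le_power:
  assumes "polylog h"
  shows "\<exists>k. \<forall>N>0. h N \<le> (N + 2) ^ k"
proof -
  obtain c where "(\<lambda>N. real (h N)) \<in> O(\<lambda>N. ln (real N) ^ c)"
    using assms by (auto simp: polylog_def soft_O_def)
  then obtain K where "0 < K" and ev: "eventually (\<lambda>N. norm (real (h N)) \<le> K * norm (ln (real N) ^ c)) sequentially"
    by (rule landau_o.bigE)
  then obtain N0 where N0: "\<And>N. N0 \<le> N \<Longrightarrow> real (h N) \<le> K * \<bar>ln (real N) ^ c\<bar>"
    by (auto simp: eventually_sequentially)
  define k where "k = nat \<lceil>K\<rceil> + (\<Sum>N<N0. h N)"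
  have "h N \<le> (N + 2) ^ (k + c)" if "0 < N" for N
  proof -
    have k: "k \<le> (N + 2) ^ k"
    proof -
      have "k < 2 ^ k" by simp
      also have "(2::nat) ^ k \<le> (N + 2) ^ k" by (intro power_mono) auto
      finally show ?thesis by simp
    qed
    show ?thesis
    proof (cases "N < N0")
      case True
      then have "h N \<le> (\<Sum>N<N0. h N)" by (intro member_le_sum) auto
      also have "\<dots> \<le> k" by (simp add: k_def)
      also note k
      also have "(N + 2) ^ k * 1 \<le> (N + 2) ^ k * (N + 2) ^ c"
        by (intro mult_le_mono2) (simp add: Suc_le_eq)
      then have "(N + 2) ^ k \<le> (N + 2) ^ k * (N + 2) ^ c" by simp
      finally show ?thesis by (simp add: power_add)
    next
      case False
      have ln: "0 \<le> ln (real N)" "ln (real N) \<le> real N + 2"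
        using that ln_le_minus_one[of "real N"] by auto
      have "real (h N) \<le> K * ln (real N) ^ c" using N0[of N] False ln by simp
      also have "\<dots> \<le> real k * (real N + 2) ^ c"
      proof (intro mult_mono power_mono ln)
        show "K \<le> real k" unfolding k_def by linarith
      qed (use ln in simp_all)
      also have "\<dots> = real (k * (N + 2) ^ c)" by (simp add: add.commute)
      finally have "h N \<le> k * (N + 2) ^ c" by (simp only: of_nat_le_iff)
      also have "\<dots> \<le> (N + 2) ^ k * (N + 2) ^ c" using k by (rule mult_le_mono1)
      finally show ?thesis by (simp add: power_add)
    qed
  qed
  then show ?thesis by blast
qed

text \<open>The minimum 4 together with \<open>4 * sg \<le> n\<close> guarantees
  \<open>2 * sg + 2 \<le> n\<close>, so the exponent of \<open>m\<close> is not truncated at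
  0.\<close>

definition dom_bits :: "nat \<Rightarrow> nat" where
  "dom_bits N = (LEAST k. 4 \<le> k \<and> N \<le> 2 ^ k)"

lemma dom_bits:
  shows "4 \<le> dom_bits N" "N \<le> 2 ^ dom_bits N"
    and dom_bits_least: "4 \<le> k \<Longrightarrow> N \<le> 2 ^ k \<Longrightarrow> dom_bits N \<le> k"
    and dom_bits_less: "4 < dom_bits N \<Longrightarrow> 2 ^ (dom_bits N - 1) < N"
proof -
  have "4 \<le> N + 4 \<and> N \<le> 2 ^ (N + 4)"
    using order.trans[OF less_imp_le[OF less_exp[of N]], of "2 ^ (N + 4)"] by (simp add: power_increasing)
  then have *: "4 \<le> dom_bits N \<and> N \<le> 2 ^ dom_bits N" unfolding dom_bits_def by (rule LeastI)
  then show "4 \<le> dom_bits N" "N \<le> 2 ^ dom_bits N" by auto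
  show least: "4 \<le> k \<Longrightarrow> N \<le> 2 ^ k \<Longrightarrow> dom_bits N \<le> k" for k
    unfolding dom_bits_def by (rule Least_le) simp
  show "2 ^ (dom_bits N - 1) < N" if "4 < dom_bits N"
  proof (rule ccontr)
    assume "\<not> 2 ^ (dom_bits N - 1) < N"
    moreover have "4 \<le> dom_bits N - 1" using that by linarith
    ultimately have "dom_bits N \<le> dom_bits N - 1" by (intro least) auto
    then show False using that by linarith
  qed
qed

lemma dom_size_le: "0 < N \<Longrightarrow> 2 ^ dom_bits N \<le> 16 * N"
proof (cases "4 < dom_bits N")
  case True
  then have "2 ^ dom_bits N = 2 * (2::nat) ^ (dom_bits N - 1)" by (cases "dom_bits N") auto
  then show ?thesis using dom_bits_less[OF True] by simp
next
  case False
  then have "dom_bits N = 4" using dom_bits(1)[of N] by simp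
  then show "0 < N \<Longrightarrow> ?thesis" by simp
qed

lemma polylog_dom_bits: "(\<lambda>N. real (dom_bits N)) \<in> soft_O (\<lambda>_. 1)"
proof -
  have "(\<lambda>N. real (dom_bits N)) \<in> O(\<lambda>N. 5 + 2 * ln (real N))"
  proof (rule landau_o.big_mono, rule eventually_mono[OF eventually_ge_at_top[of 1]])
    fix N :: nat assume N: "1 \<le> N"
    have "real (dom_bits N) \<le> 5 + 2 * ln (real N)"
    proof (cases "4 < dom_bits N")
      case True
      then have "real (2 ^ (dom_bits N - 1)) \<le> real N"
        using dom_bits_less[OF True] by (simp only: of_nat_le_iff less_imp_le)
      then have "ln ((2::real) ^ (dom_bits N - 1)) \<le> ln (real N)"
        using N by (subst ln_le_cancel_iff) auto
      then have "real (dom_bits N - 1) * ln 2 \<le> ln (real N)" by (simp add: ln_realpow)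
      moreover have "real (dom_bits N - 1) * (1 / 2) \<le> real (dom_bits N - 1) * ln 2"
        using ln2_ge_two_thirds by (intro mult_left_mono) auto
      ultimately show ?thesis by linarith
    next
      case False
      moreover have "0 \<le> ln (real N)" using N by simp
      ultimately show ?thesis by simp
    qed
    then show "norm (real (dom_bits N)) \<le> norm (5 + 2 * ln (real N))" by simp
  qed
  then have 1: "(\<lambda>N. real (dom_bits N)) \<in> soft_O (\<lambda>N. 5 + 2 * ln (real N))" by (rule soft_O_bigo)
  have "(\<lambda>N. ln (real N)) \<in> soft_O (\<lambda>_. 1)"
    unfolding soft_O_def by (intro CollectI exI[of _ 1]) simp
  then have "(\<lambda>N. 5 + 2 * ln (real N)) \<in> soft_O (\<lambda>_. 1)"
    using soft_O_add[OF soft_O_const soft_O_mult_polylog[OF _ soft_O_const]] by blast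
  then obtain c where "(\<lambda>N. 5 + 2 * ln (real N)) \<in> O(\<lambda>N. ln (real N) ^ c)" by (auto simp: soft_O_def)
  moreover have "(\<lambda>N. real (dom_bits N)) \<in> O(\<lambda>N. 5 + 2 * ln (real N))" by fact
  ultimately show ?thesis
    unfolding soft_O_def by (auto intro: landau_o.big_trans)
qed

text \<open>The logarithm of \<open>A\<close> to the base 16, rounded down:
  \<open>2 ^ group_bits A\<close> is the fourth root of \<open>A\<close> up to a factor 2.\<close>

definition group_bits :: "nat \<Rightarrow> nat" where
  "group_bits A = (LEAST k. A < 16 ^ Suc k)"

lemma group_bits:
  assumes "0 < A"
  shows "16 ^ group_bits A \<le> A" "A < 16 ^ Suc (group_bits A)"
proof -
  have "A < 2 ^ A" by (rule less_exp)
  also have "(2::nat) ^ A \<le> 16 ^ A" by (intro power_mono) auto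
  also have "\<dots> \<le> 16 ^ Suc A" by (rule power_increasing) auto
  finally have "A < 16 ^ Suc A" .
  then show lt: "A < 16 ^ Suc (group_bits A)" unfolding group_bits_def by (rule LeastI)
  show "16 ^ group_bits A \<le> A"
  proof (cases "group_bits A")
    case (Suc k)
    then have "\<not> A < 16 ^ Suc k" using not_less_Least[of k "\<lambda>k. A < 16 ^ Suc k"] by (simp add: group_bits_def)
    then show ?thesis using Suc by simp
  qed (use assms in simp)
qed


lemma real_floor_powr: "0 \<le> \<alpha> \<Longrightarrow> real (nat \<lfloor>real N powr \<alpha>\<rfloor>) \<le> real N powr \<alpha>"
  by (simp add: of_nat_nat)

text \<open>Rounding loses a factor 2 in the group size and padding a factor 16 in the domain, hence
  32.\<close>

lemma groups_le:
  fixes \<alpha> :: real and N :: nat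
  defines "A \<equiv> nat \<lfloor>real N powr \<alpha>\<rfloor>"
  assumes "0 < \<alpha>" "0 < N" and le: "group_bits A \<le> dom_bits N"
  shows "real (2 ^ (dom_bits N - group_bits A)) \<le> 32 * real N powr (1 - \<alpha> / 4)"
proof -
  define s :: real where "s = 2 ^ group_bits A"
  have N: "1 \<le> real N" using assms by simp
  have s: "0 < s" by (simp add: s_def)
  have "1 \<le> real N powr \<alpha>" using N assms by (simp add: ge_one_powr_ge_zero)
  then have A: "0 < A" by (simp add: A_def)
  have "real N powr \<alpha> < real A + 1" unfolding A_def by linarith
  \<comment> \<open>The strict inequality between integers makes up for the floor in
    \<open>A\<close>.\<close>
  also have "\<dots> \<le> 16 ^ Suc (group_bits A)"
    using group_bits(2)[OF A] by (metis Suc_leI of_nat_Suc of_nat_le_iff of_nat_numeral of_nat_power add.commute)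
  also have "\<dots> = (2 * s) ^ 4"
    by (simp add: s_def power_mult_distrib power_mult[symmetric] mult.commute[of _ 4] power_mult)
  finally have lt: "real N powr \<alpha> < (2 * s) ^ 4" .
  have "real N powr (\<alpha> / 4) = (real N powr \<alpha>) powr (1 / 4)" by (simp add: powr_powr)
  also have "\<dots> \<le> ((2 * s) ^ 4) powr (1 / 4)" using lt by (intro powr_mono2) auto
  also have "(2 * s) ^ 4 = (2 * s) powr 4" using s by simp
  also have "((2 * s) powr 4) powr (1 / 4) = (2 * s) powr (4 * (1 / 4))" by (rule powr_powr)
  also have "\<dots> = 2 * s" using s by simp
  finally have root: "real N powr (\<alpha> / 4) \<le> 2 * s" .
  have "real (2 ^ (dom_bits N - group_bits A)) = real (2 ^ dom_bits N) / s"
    using power_add[of "2::real" "dom_bits N - group_bits A" "group_bits A"] le by (simp add: s_def field_simps)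
  also have "\<dots> \<le> 16 * real N / s"
  proof -
    have "real (2 ^ dom_bits N) \<le> real (16 * N)" using dom_size_le[OF assms(3)] by (simp only: of_nat_le_iff)
    then show ?thesis using s by (intro divide_right_mono) auto
  qed
  also have "\<dots> \<le> 16 * real N / (real N powr (\<alpha> / 4) / 2)"
    using root s N by (intro divide_left_mono) auto
  also have "\<dots> = 32 * real N powr (1 - \<alpha> / 4)"
    using N by (simp add: powr_diff)
  finally show ?thesis .
qed

lemma group_bits_le:
  assumes "0 < A" "A \<le> N"
  shows "4 * group_bits A \<le> dom_bits N"
proof -
  have "(2::nat) ^ (4 * group_bits A) = 16 ^ group_bits A" by (simp add: power_mult)
  also have "\<dots> \<le> 2 ^ dom_bits N" using group_bits(1)[OF assms(1)] assms(2) dom_bits(2)[of N] by linarith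
  finally show ?thesis by simp
qed

text \<open>Everything is compared with powers of \<open>N + 2\<close>: the factor
  \<open>151 * C\<close> moves into the exponent, the padded domain takes exponent 4, and
  \<open>2 * dom_bits N\<close> needs exponent 8; the summand 12 has room for either use.\<close>

lemma word_length_bounds:
  assumes N: "0 < N" and X: "X \<le> (N + 2) ^ k" "1 \<le> X" and W: "(N + 2) ^ (k + 151 * C + 12) \<le> (2::nat) ^ W"
    and E: "E \<le> 151 * (C * X * 2 ^ dom_bits N)"
  shows "E + W \<le> 2 ^ W" "2 * dom_bits N \<le> W"
proof -
  have N3: "3 \<le> N + 2" using N by simp
  have V: "2 ^ dom_bits N \<le> (N + 2) ^ 4"
  proof -
    have "2 ^ dom_bits N \<le> 16 * N" by (rule dom_size_le[OF N])
    also have "\<dots> \<le> 3 ^ 3 * (N + 2)" by simp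
    also have "\<dots> \<le> (N + 2) ^ 3 * (N + 2)" using N3 by (intro mult_le_mono1 power_mono) auto
    finally show ?thesis by (simp add: numeral_eq_Suc ac_simps)
  qed
  have mono: "a \<le> b \<Longrightarrow> (N + 2) ^ a \<le> (N + 2) ^ b" for a b by (rule power_increasing) auto
  have C: "151 * C \<le> (N + 2) ^ (151 * C)"
  proof -
    have "151 * C < 2 ^ (151 * C)" by simp
    also have "(2::nat) ^ (151 * C) \<le> (N + 2) ^ (151 * C)" by (intro power_mono) auto
    finally show ?thesis by simp
  qed
  have "E \<le> (151 * C) * X * 2 ^ dom_bits N" using E by (simp add: ac_simps)
  also have "\<dots> \<le> (N + 2) ^ (151 * C) * (N + 2) ^ k * (N + 2) ^ 4" using C X(1) V by (intro mult_le_mono)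
  also have "\<dots> = (N + 2) ^ (k + 151 * C + 4)" by (simp add: power_add ac_simps)
  finally have E1: "E \<le> (N + 2) ^ (k + 151 * C + 4)" .
  \<comment> \<open>One third of the range for \<open>E\<close> and one half for \<open>W\<close>
    keep the sum within a word.\<close>
  have "3 * E \<le> (N + 2) * (N + 2) ^ (k + 151 * C + 4)" using N3 E1 by (rule mult_le_mono)
  also have "\<dots> = (N + 2) ^ (k + 151 * C + 5)" by (simp add: numeral_eq_Suc)
  also have "\<dots> \<le> (N + 2) ^ (k + 151 * C + 12)" by (rule mono) simp
  also note W
  finally have E3: "3 * E \<le> 2 ^ W" .
  have "(2::nat) ^ (2 * dom_bits N) = 2 ^ dom_bits N * 2 ^ dom_bits N" by (simp add: mult_2 power_add)
  also have "\<dots> \<le> (N + 2) ^ 4 * (N + 2) ^ 4" using V by (intro mult_le_mono)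
  also have "\<dots> = (N + 2) ^ 8" by (simp add: power_add[symmetric])
  also have "\<dots> \<le> (N + 2) ^ (k + 151 * C + 12)" by (rule mono) simp
  also note W
  finally show W2: "2 * dom_bits N \<le> W" by simp
  then obtain W' where W': "W = Suc W'" using dom_bits(1)[of N] by (cases W) auto
  have "Suc W' \<le> 2 ^ W'" using less_exp[of W'] by (rule Suc_leI)
  then have "2 * W \<le> 2 ^ W" using W' by simp
  then show "E + W \<le> 2 ^ W" using E3 by linarith
qed

theorem mainTheorem6:
  fixes \<alpha> :: real and w \<tau> :: "nat \<Rightarrow> nat" and d :: nat
  assumes "0 < \<alpha>" and "\<alpha> < 1"
    and "polylog w" and "polylog \<tau>"
  shows "\<exists>(build :: instr list) (rank :: instr list) (select :: instr list) (med :: instr list)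
      (\<kappa> :: nat) (T\<^sub>b :: nat \<Rightarrow> nat) (S :: nat \<Rightarrow> nat) (T\<^sub>q :: nat \<Rightarrow> nat).
    1 \<le> \<kappa> \<and>
    (\<lambda>N. real (T\<^sub>b N)) \<in> soft_O (\<lambda>N. real N) \<and>
    (\<lambda>N. real (S N)) \<in> soft_O (\<lambda>N. real N powr (1 - \<alpha> / 4)) \<and>
    (\<lambda>N. real (T\<^sub>q N)) \<in> soft_O (\<lambda>N. real N powr \<alpha>) \<and>
    (\<forall>(N :: nat) (W :: nat) (f :: nat \<Rightarrow> nat) (F :: basic_instr list) (D :: nat \<Rightarrow> nat).
      0 < N \<longrightarrow> (N + 2) ^ \<kappa> \<le> 2 ^ W \<longrightarrow>
      f ` {..<N} \<subseteq> {..<2 ^ w N} \<longrightarrow>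
      computes_within W N (w N) F D f (\<tau> N) \<longrightarrow>
      (let A = nat \<lfloor>real N powr \<alpha>\<rfloor>; ev = evaluate W N (w N) F D in
       measure_pmf.prob (run W ev build (T\<^sub>b N) (build_start W N (w N) A))
         {c. halts_within build (T\<^sub>b N) c \<and>
             length (data_structure c) \<le> S N \<and>
             supports_ranking W N (w N) A ev f rank (T\<^sub>q N) (data_structure c) \<and>
             supports_selection W N (w N) A ev f select (T\<^sub>q N) (data_structure c) \<and>
             supports_median W N (w N) A ev f med (T\<^sub>q N) (data_structure c)}
       \<ge> 1 - 1 / real N ^ d))"
proof -
  \<comment> \<open>The programs depend on \<open>d\<close> alone, through \<open>C\<close>;
    \<alpha> reaches them only as the input \<open>A\<close>.\<close>
  define C where "C = 16 * Suc d"
  define A where "A N = nat \<lfloor>real N powr \<alpha>\<rfloor>" for N :: nat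
  define X where "X N = \<tau> N + w N + dom_bits N + 30" for N
  define Tb where "Tb N = 200 * (C * (X N * X N) * 2 ^ dom_bits N)" for N
  define S where "S N = 6 * (C * X N * 2 ^ (dom_bits N - group_bits (A N)))" for N
  define Tq where "Tq N = 600 * (C * A N * X N ^ 4)" for N
  have A_pos: "0 < A N" and A_le: "A N \<le> N" if "0 < N" for N
  proof -
    have "1 \<le> real N powr \<alpha>" using that assms by (simp add: ge_one_powr_ge_zero)
    then show "0 < A N" by (simp add: A_def)
    have "real (A N) \<le> real N powr \<alpha>" unfolding A_def using assms by (intro real_floor_powr) simp
    also have "\<dots> \<le> real N powr 1" using that assms by (intro powr_mono) auto
    finally show "A N \<le> N" using that by simp
  qed
  have X: "(\<lambda>N. real (X N)) \<in> soft_O (\<lambda>_. 1)"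
    unfolding X_def of_nat_add
    using assms(3,4) polylog_dom_bits by (intro soft_O_add) (simp_all add: polylog_def)
  then have "polylog X" by (simp add: polylog_def)
  then obtain k where k: "\<And>N. 0 < N \<Longrightarrow> X N \<le> (N + 2) ^ k" using polylog_le_power by blast
  define \<kappa> where "\<kappa> = k + 151 * C + 12"
  have Tb: "(\<lambda>N. real (Tb N)) \<in> soft_O (\<lambda>N. real N)"
  proof -
    have "(\<lambda>N. real (2 ^ dom_bits N)) \<in> O(\<lambda>N. real N)"
    proof (rule landau_o.bigI[of 16], simp, rule eventually_mono[OF eventually_gt_at_top[of 0]])
      fix N :: nat assume "0 < N"
      from dom_size_le[OF this] have "real (2 ^ dom_bits N) \<le> real (16 * N)" by (simp only: of_nat_le_iff)
      then show "norm (real (2 ^ dom_bits N)) \<le> 16 * norm (real N)" by simp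
    qed
    then have "(\<lambda>N. 200 * real C * (real (X N) ^ 2 * real (2 ^ dom_bits N))) \<in> soft_O (\<lambda>N. real N)"
      by (intro soft_O_mult_polylog[OF soft_O_mult_polylog[OF soft_O_bigo soft_O_power[OF X]] soft_O_const])
    then show ?thesis by (simp add: Tb_def power2_eq_square ac_simps)
  qed
  have S: "(\<lambda>N. real (S N)) \<in> soft_O (\<lambda>N. real N powr (1 - \<alpha> / 4))"
  proof -
    have "(\<lambda>N. real (2 ^ (dom_bits N - group_bits (A N)))) \<in> O(\<lambda>N. real N powr (1 - \<alpha> / 4))"
    proof (rule landau_o.bigI[of 32], simp, rule eventually_mono[OF eventually_gt_at_top[of 0]])
      fix N :: nat assume N: "0 < N"
      have "group_bits (A N) \<le> dom_bits N" using group_bits_le[OF A_pos[OF N] A_le[OF N]] by simp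
      from groups_le[OF assms(1) N this[unfolded A_def]]
      show "norm (real (2 ^ (dom_bits N - group_bits (A N)))) \<le> 32 * norm (real N powr (1 - \<alpha> / 4))"
        by (simp add: A_def)
    qed
    then have "(\<lambda>N. 6 * real C * (real (X N) * real (2 ^ (dom_bits N - group_bits (A N)))))
        \<in> soft_O (\<lambda>N. real N powr (1 - \<alpha> / 4))"
      by (intro soft_O_mult_polylog[OF soft_O_mult_polylog[OF soft_O_bigo X] soft_O_const])
    then show ?thesis by (simp add: S_def ac_simps)
  qed
  have Tq: "(\<lambda>N. real (Tq N)) \<in> soft_O (\<lambda>N. real N powr \<alpha>)"
  proof -
    have "(\<lambda>N. real (A N)) \<in> O(\<lambda>N. real N powr \<alpha>)"
      using real_floor_powr[of \<alpha>] assms(1)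
      by (intro landau_o.big_mono always_eventually allI) (simp add: A_def)
    then have "(\<lambda>N. 600 * real C * (real (X N) ^ 4 * real (A N))) \<in> soft_O (\<lambda>N. real N powr \<alpha>)"
      by (intro soft_O_mult_polylog[OF soft_O_mult_polylog[OF soft_O_bigo soft_O_power[OF X]] soft_O_const])
    then show ?thesis by (simp add: Tq_def ac_simps)
  qed
  have main: "1 - 1 / real N ^ d \<le> measure_pmf.prob
       (run W (evaluate W N (w N) F D) (comp 0 (BUILD C)) (Tb N) (build_start W N (w N) (A N)))
         {c. halts_within (comp 0 (BUILD C)) (Tb N) c \<and> length (data_structure c) \<le> S N \<and>
             supports_ranking W N (w N) (A N) (evaluate W N (w N) F D) f (comp 0 (RANK C)) (Tq N) (data_structure c) \<and>
             supports_selection W N (w N) (A N) (evaluate W N (w N) F D) f (comp 0 (SELECT C)) (Tq N) (data_structure c) \<and>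
             supports_median W N (w N) (A N) (evaluate W N (w N) F D) f (comp 0 (MEDIAN C)) (Tq N) (data_structure c)}"
    if N: "0 < N" and W: "(N + 2) ^ \<kappa> \<le> 2 ^ W" and f: "f ` {..<N} \<subseteq> {..<2 ^ w N}"
      and F: "computes_within W N (w N) F D f (\<tau> N)" for N W f F D
  proof -
    let ?n = "dom_bits N" and ?g = "group_bits (A N)" and ?ev = "evaluate W N (w N) F D"
    have W2: "2 * ?n \<le> W"
      using word_length_bounds(2)[of N "X N" k C W 0] N k[OF N] W by (simp add: \<kappa>_def X_def)
    have inv: "inversion N W (w N) ?n ?g C (\<tau> N) f ?ev"
    proof
      show "4 * ?g \<le> ?n" by (rule group_bits_le[OF A_pos[OF N] A_le[OF N]])
      show "\<exists>t\<le>\<tau> N. ?ev x = Some (t, encode W (w N) (f x))" if "x < N" for x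
        using F that by (auto simp: computes_within_def)
      show "f x < 2 ^ w N" if "x < N" for x using f that by auto
    qed (use N W2 dom_bits in \<open>auto simp: C_def\<close>)
    interpret I: inversion N W "w N" ?n ?g C "\<tau> N" f ?ev by (rule inv)
    have XI: "I.X = X N"
      by (simp add: X_def I.X_def)
    have "I.D + 64 * I.V + 8 * I.nw + 8 * I.s + w N + W + 64 \<le> 2 ^ W"
    proof -
      have V: "I.V = 2 ^ ?n" by (simp add: I.V_def)
      define U where "U = C * X N * I.V"
      have "1 \<le> I.V" "1 \<le> C" "1 \<le> X N" using I.pos_params(1) by (simp_all add: C_def X_def)
      then have "1 * 1 * I.V \<le> U" "1 * X N * 1 \<le> U" "1 * 1 * 1 \<le> U"
        unfolding U_def by (intro mult_le_mono; simp)+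
      moreover have "C * X N * I.Gs \<le> U" unfolding U_def using I.Gs_le_V(1) by (intro mult_le_mono2)
      \<comment> \<open>The coefficients add up to 151: 6 from \<open>D_le\<close>, 64 and 8 for
        \<open>V\<close> and \<open>s\<close>, 8 and 1 for \<open>nw\<close> and \<open>w\<close>,
        64 for the constant.\<close>
      ultimately have "I.D + 64 * I.V + 8 * I.nw + 8 * I.s + w N + 64 \<le> 151 * U"
        using I.D_le I.X_bounds(3,4) I.Gs_le_V(2) unfolding XI by linarith
      from word_length_bounds(1)[OF N k[OF N] _ W[unfolded \<kappa>_def] this[unfolded U_def V]]
      show ?thesis by (simp add: X_def V ac_simps)
    qed
    then interpret machine N W "w N" ?n ?g C "\<tau> N" f ?ev by unfold_locales
    show ?thesis
    proof (rule prob_supports)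
      show "?n \<le> k" if "4 \<le> k" "N \<le> 2 ^ k" for k using that by (rule dom_bits_least)
      show "16 ^ ?g \<le> A N" "A N < 16 ^ Suc ?g" using group_bits[OF A_pos[OF N]] by auto
      show "A N \<le> N" by (rule A_le[OF N])
      show "C = 16 * Suc d" by (rule C_def)
      show "B_build \<le> Tb N" using B_build_le unfolding Tb_def XI by (simp add: I.V_def)
      show "I.D \<le> S N" using I.D_le unfolding S_def XI by (simp add: I.Gs_def)
      \<comment> \<open>The query bound has slack: \<open>s ^ 3\<close> is needed, while
        \<open>A\<close> leaves room for \<open>s ^ 4\<close>.\<close>
      have "I.s ^ 3 \<le> I.s ^ 4" using I.pos_params(2) by (intro power_increasing) auto
      also have "I.s ^ 4 = 16 ^ ?g"
        by (simp add: I.s_def power_mult[symmetric] mult.commute[of _ 4]) (simp add: power_mult)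
      also have "\<dots> \<le> A N" by (rule group_bits(1)[OF A_pos[OF N]])
      finally have "C * I.s ^ 3 * X N ^ 4 \<le> C * A N * X N ^ 4" by (intro mult_le_mono) auto
      then show "B_rank \<le> Tq N" "B_sel \<le> Tq N" using B_query_le unfolding Tq_def XI by linarith+
    qed
  qed
  have "1 \<le> \<kappa>" by (simp add: \<kappa>_def)
  then show ?thesis
    unfolding Let_def A_def[symmetric]
    by (intro exI[of _ "comp 0 (BUILD C)"] exI[of _ "comp 0 (RANK C)"] exI[of _ "comp 0 (SELECT C)"]
        exI[of _ "comp 0 (MEDIAN C)"] exI[of _ \<kappa>] exI[of _ Tb] exI[of _ S] exI[of _ Tq] conjI allI impI)
       (assumption, rule Tb, rule S, rule Tq, rule main)
qed

end
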